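(* Let $n$ be a positive integer, $1<p<\infty$ and $\alpha>0$, and let $p'$ be the conjugate exponent to $p$. In the pairing $(f,g)_\alpha=\int_{\mathbb{C}^n}f\overline{g}\,d\gamma_\alpha$, the spaces $L^p_{hol}(\gamma_{\alpha p/2})$ and $L^{p'}_{hol}(\gamma_{\alpha p'/2})$ are dual; and for all $h\in L^{p'}_{hol}(\gamma_{\alpha p'/2})$ the norms satisfy $$\|h\|_{L^{p'}_{hol}(\gamma_{\alpha p'/2})}\le \|(\,\cdot\,,h)_\alpha\|_{(L^p_{hol}(\gamma_{\alpha p/2}))^*}\le \left(2\,\frac{1}{p^{1/p}}\,\frac{1}{p'^{1/p'}}\right)^n\|h\|_{L^{p'}_{hol}(\gamma_{\alpha p'/2})}.$$
   Context: For $\beta>0$, $\gamma_\beta$ is the Gaussian probability measure on $\mathbb{C}^n$ given by $\gamma_\beta(dz)=\left(\frac{\beta}{\pi}\right)^n e^{-\beta|z|^2}\,\lambda(dz)$, with $\lambda$ Lebesgue measure on $\mathbb{C}^n$. $L^p_{hol}(\gamma_\beta)$ is the space of entire holomorphic functions on $\mathbb{C}^n$ lying in $L^p(\mathbb{C}^n,\gamma_\beta)$, with the $L^p(\gamma_\beta)$-norm. "Dual in the pairing" means that the map $h\mapsto(\,\cdot\,,h)_\alpha$ is a (conjugate-linear) bijection from $L^{p'}_{hol}(\gamma_{\alpha p'/2})$ onto the space $(L^p_{hol}(\gamma_{\alpha p/2}))^*$ of bounded linear functionals. Note that the pairing uses $\gamma_\alpha$, while the norms use $\gamma_{\alpha p/2}$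 and $\gamma_{\alpha p'/2}$. *)

theory Defs
  imports "HOL-Analysis.Analysis"
begin

text \<open>
  The space \<open>\<complex>\<^sup>n\<close> is \<^typ>\<open>complex ^ 'n\<close> with \<open>n = CARD('n)\<close>; its norm is the Hermitian one, and
  \<^term>\<open>lborel\<close> on it is Lebesgue measure on the Borel sets of \<open>\<real>\<^sup>2\<^sup>n\<close>.
\<close>

definition gauss :: "real \<Rightarrow> (complex ^ 'n) measure" where
  "gauss \<beta> = density lborel
     (\<lambda>z. ennreal ((\<beta> / pi) ^ CARD('n) * exp (- \<beta> * (norm z)\<^sup>2)))"

text \<open>Holomorphic in several variables: the Frechet derivative exists everywhere and is
  complex linear (real linearity being part of \<^const>\<open>has_derivative\<close>).\<close>

definition entire :: "(complex ^ 'n \<Rightarrow> complex) \<Rightarrow> bool" where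
  "entire f \<longleftrightarrow>
     (\<forall>z. \<exists>L. (f has_derivative L) (at z) \<and> (\<forall>c v. L (c *s v) = c * L v))"

text \<open>Since every nonempty open set has positive Gaussian measure, an entire function is
  determined by its almost-everywhere class, so no quotient is taken.\<close>

definition Lp_hol :: "real \<Rightarrow> (complex ^ 'n) measure \<Rightarrow> (complex ^ 'n \<Rightarrow> complex) set" where
  "Lp_hol p M = {f. entire f \<and> integrable M (\<lambda>z. cmod (f z) powr p)}"

definition Lp_norm :: "real \<Rightarrow> 'a measure \<Rightarrow> ('a \<Rightarrow> complex) \<Rightarrow> real" where
  "Lp_norm p M f = (\<integral>z. cmod (f z) powr p \<partial>M) powr (1 / p)"

text \<open>Bounded complex-linear functionals on a space \<open>V\<close> of functions with norm \<open>N\<close>.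
  Functionals are \<^const>\<open>undefined\<close> outside \<open>V\<close>, so that equality is equality on \<open>V\<close>.\<close>

definition bounded_functionals ::
    "('a \<Rightarrow> complex) set \<Rightarrow> (('a \<Rightarrow> complex) \<Rightarrow> real) \<Rightarrow> (('a \<Rightarrow> complex) \<Rightarrow> complex) set" where
  "bounded_functionals V N = {\<Phi> \<in> extensional V.
     (\<forall>f\<in>V. \<forall>g\<in>V. \<Phi> (\<lambda>z. f z + g z) = \<Phi> f + \<Phi> g) \<and>
     (\<forall>c. \<forall>f\<in>V. \<Phi> (\<lambda>z. c * f z) = c * \<Phi> f) \<and>
     (\<exists>C. \<forall>f\<in>V. cmod (\<Phi> f) \<le> C * N f)}"

definition functional_norm ::
    "('a \<Rightarrow> complex) set \<Rightarrow> (('a \<Rightarrow> complex) \<Rightarrow> real) \<Rightarrow> (('a \<Rightarrow> complex) \<Rightarrow> complex) \<Rightarrow> real" where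
  "functional_norm V N \<Phi> = (SUP f\<in>{f \<in> V. N f \<le> 1}. cmod (\<Phi> f))"

definition pairing ::
    "real \<Rightarrow> (complex ^ 'n \<Rightarrow> complex) \<Rightarrow> (complex ^ 'n \<Rightarrow> complex) \<Rightarrow> complex" where
  "pairing \<alpha> f g = (\<integral>z. f z * cnj (g z) \<partial>gauss \<alpha>)"

definition pairing_functional ::
    "real \<Rightarrow> (complex ^ 'n \<Rightarrow> complex) set \<Rightarrow> (complex ^ 'n \<Rightarrow> complex)
      \<Rightarrow> (complex ^ 'n \<Rightarrow> complex) \<Rightarrow> complex" where
  "pairing_functional \<alpha> V h = (\<lambda>f\<in>V. pairing \<alpha> f h)"

text \<open>The map from \<open>h\<close> to \<open>( \<cdot> , h)\<close> is a conjugate-linear bijection of \<open>W\<close> onto the dual of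
  \<open>(V, N)\<close>. Integrability is demanded because the Bochner integral of a non-integrable function
  is \<open>0\<close> by convention.\<close>

definition dual_in_pairing ::
    "real \<Rightarrow> (complex ^ 'n \<Rightarrow> complex) set \<Rightarrow> ((complex ^ 'n \<Rightarrow> complex) \<Rightarrow> real)
      \<Rightarrow> (complex ^ 'n \<Rightarrow> complex) set \<Rightarrow> bool" where
  "dual_in_pairing \<alpha> V N W \<longleftrightarrow>
     (\<forall>f\<in>V. \<forall>h\<in>W. integrable (gauss \<alpha>) (\<lambda>z. f z * cnj (h z))) \<and>
     (\<forall>f\<in>V. \<forall>h\<in>W. \<forall>k\<in>W. pairing \<alpha> f (\<lambda>z. h z + k z) = pairing \<alpha> f h + pairing \<alpha> f k) \<and>
     (\<forall>c. \<forall>f\<in>V. \<forall>h\<in>W. pairing \<alpha> f (\<lambda>z. c * h z) = cnj c * pairing \<alpha> f h) \<and>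
     bij_betw (pairing_functional \<alpha> V) W (bounded_functionals V N)"

end

theory Submission
  imports Defs "HOL-Probability.Probability" "HOL-Complex_Analysis.Complex_Analysis"
begin

text \<open>
  The upper bound is Hoelder's inequality for \<open>f e\<^bsup>-\<alpha>|z|\<^sup>2/2\<^esup>\<close> and \<open>h e\<^bsup>-\<alpha>|z|\<^sup>2/2\<^esup>\<close>. For
  the lower bound and surjectivity, a bounded functional \<open>\<Phi>\<close> is represented by its values on the
  coherent states, \<open>h(w) = cnj (\<Phi> (e\<^bsup>\<alpha>\<langle>\<cdot>,w\<rangle>\<^esup>))\<close>. Everything then follows from the sharp fact that
  \<open>u \<mapsto> \<integral> u(w) e\<^bsup>\<alpha>\<langle>z,w\<rangle>\<^esup> d\<gamma>\<^bsub>\<alpha>p'/2\<^esub>(w)\<close> is a contraction from \<open>L\<^sup>p(\<gamma>\<^bsub>\<alpha>p'/2\<^esub>)\<close> to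
  \<open>L\<^sup>p(\<gamma>\<^bsub>\<alpha>p/2\<^esub>)\<close>: it is applied to truncations of \<open>h |h|\<^bsup>p'-2\<^esup>\<close>.

  After scaling, the operator is \<open>Q u(x) = \<integral> u(y) e\<^bsup>r\<langle>x,y\<rangle>\<^esup> d\<gamma>\<^sub>1(y)\<close> with \<open>r\<^sup>2 = 4/(pp')\<close>, acting on
  \<open>L\<^sup>p(\<gamma>\<^sub>1)\<close>. For \<open>p \<le> 2\<close> one splits a Gaussian vector as \<open>\<surd>(1-t) w + \<surd>t y\<close> and applies \<open>Q\<close> in the
  variable \<open>y\<close> only; the \<open>p\<close>-th moment of the result is nonincreasing in \<open>t\<close>, because its derivative has
  the sign of a quadratic form in the holomorphic and antiholomorphic gradients of the current function,
  which is nonpositive for \<open>r\<^sup>2 \<le> 4(p-1)/p\<^sup>2\<close>. The case \<open>p \<ge> 2\<close> is dual to this one.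
\<close>

section \<open>Gaussian measures and their symmetries\<close>

text \<open>The kernel of \<open>Q\<close> is complex, and taking its modulus loses the constant:
  already the image of \<open>1\<close> would exceed \<open>1\<close>. What helps is that
  \<open>Q\<close> fixes constants, multiplies a holomorphic linear form by \<open>r\<close> and
  annihilates an antiholomorphic one. To second order, a pair of gradients \<open>a\<close>,
  \<open>b\<close> therefore becomes \<open>r a\<close>, \<open>0\<close>, and the comparison of the
  two quadratic forms is a one-parameter inequality whose worst case is
  \<open>r^2 = 4 (p - 1) / p^2\<close>. This number equals \<open>4 / (p p')\<close>, which is
  symmetric in the two exponents and exactly what rescaling the two Gaussian measures produces. No
  derivative in \<open>t\<close> is taken. Times \<open>t\<close> and \<open>t + d\<close> are
  compared directly with an error of order \<open>d^(3/2)\<close>, so the errors of all steps add up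
  to something negligible. To make the expansions uniform, \<open>|z|^p\<close> is replaced by
  \<open>(e + |z|^2)^(p/2)\<close> and \<open>u\<close> by a Gaussian mollification, which commutes
  with applying \<open>Q\<close> in another variable. The symbol of a functional is at first only
  known to be entire. Continuous cutoffs therefore make each integral finite before a power of it is
  cancelled.\<close>

text \<open>Uniqueness of a translation-invariant measure, carried out by hand: Fubini compares the
  image measure with \<open>lborel\<close> against the unit ball, which \<open>T\<close> preserves.
  Only invariance under translations and reflections enters, no determinant.\<close>

lemma distr_lborel_isometry:
  fixes T :: "'a::euclidean_space \<Rightarrow> 'a"
  assumes lin: "linear T" and norm: "\<And>x. norm (T x) = norm x"
  shows "distr lborel borel T = lborel"
proof (rule measure_eqI)
  have T[measurable]: "T \<in> borel_measurable borel"
    using lin by (intro borel_measurable_continuous_onI linear_continuous_on linear_conv_bounded_linear[THEN iffD1])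
  have "inj T"
    using lin norm by (metis linear_injective_0 norm_eq_zero)
  with lin have surj: "surj T"
    by (simp add: linear_injective_imp_surjective)
  have shift: "(\<integral>\<^sup>+x. f (x + c) \<partial>lborel) = (\<integral>\<^sup>+x. f x \<partial>lborel)"
    if [measurable]: "f \<in> borel_measurable borel" for f and c :: 'a
  proof -
    have "(\<integral>\<^sup>+x. f x \<partial>lborel) = (\<integral>\<^sup>+x. f x \<partial>distr lborel borel ((+) c))"
      by (simp add: lborel_distr_plus)
    also have "\<dots> = (\<integral>\<^sup>+x. f (x + c) \<partial>lborel)"
      by (subst nn_integral_distr) (simp_all add: add.commute)
    finally show ?thesis by simp
  qed
  have refl: "(\<integral>\<^sup>+x. f (c - x) \<partial>lborel) = (\<integral>\<^sup>+x. f x \<partial>lborel)"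
    if [measurable]: "f \<in> borel_measurable borel" for f and c :: 'a
    using arg_cong[OF lborel_affine[of "-1" c], of "\<lambda>M. nn_integral M f"]
    by (simp add: nn_integral_distr density_1)
  fix A assume "A \<in> sets (distr lborel borel T)"
  then have [measurable]: "A \<in> sets borel" by simp
  define B where "B = ball (0::'a) 1"
  have [measurable]: "B \<in> sets borel" by (simp add: B_def)
  \<comment> \<open>Surjectivity enters here: shifting \<open>T x\<close> by \<open>c\<close> is
    shifting \<open>x\<close> by a preimage of \<open>c\<close>.\<close>
  have shiftT: "(\<integral>\<^sup>+x. f (T x + c) \<partial>lborel) = (\<integral>\<^sup>+x. f (T x) \<partial>lborel)"
    if [measurable]: "f \<in> borel_measurable borel" for f and c :: 'a
  proof -
    obtain d where "c = T d" using surj by (metis surjD)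
    then have "(\<integral>\<^sup>+x. f (T x + c) \<partial>lborel) = (\<integral>\<^sup>+x. (\<lambda>x. f (T x)) (x + d) \<partial>lborel)"
      using linear_add[OF lin] by simp
    also have "\<dots> = (\<integral>\<^sup>+x. f (T x) \<partial>lborel)"
      by (rule shift) (use that in simp)
    finally show ?thesis .
  qed
  have "emeasure (distr lborel borel T) A * emeasure lborel B
      = (\<integral>\<^sup>+x. indicator A (T x) \<partial>lborel) * (\<integral>\<^sup>+y. indicator B y \<partial>lborel)"
    by (simp add: nn_integral_distr flip: nn_integral_indicator)
  also have "\<dots> = (\<integral>\<^sup>+x. \<integral>\<^sup>+y. indicator A (T x) * indicator B (y + T x) \<partial>lborel \<partial>lborel)"
    by (simp add: nn_integral_cmult shift flip: nn_integral_multc)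
  also have "\<dots> = (\<integral>\<^sup>+y. \<integral>\<^sup>+x. indicator A (T x) * indicator B (y + T x) \<partial>lborel \<partial>lborel)"
    by (rule lborel_pair.Fubini') simp
  also have "\<dots> = (\<integral>\<^sup>+y. \<integral>\<^sup>+x. indicator A (T x - y) * indicator B (T x) \<partial>lborel \<partial>lborel)"
  proof (rule nn_integral_cong)
    fix y :: 'a
    show "(\<integral>\<^sup>+x. indicator A (T x) * indicator B (y + T x) \<partial>lborel)
        = (\<integral>\<^sup>+x. indicator A (T x - y) * indicator B (T x) \<partial>lborel)"
      using shiftT[of "\<lambda>z. indicator A (z - y) * indicator B z" y] by (simp add: add.commute)
  qed
  also have "\<dots> = (\<integral>\<^sup>+x. \<integral>\<^sup>+y. indicator A (T x - y) * indicator B (T x) \<partial>lborel \<partial>lborel)"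
    by (rule lborel_pair.Fubini'[symmetric]) simp
  \<comment> \<open>\<open>y\<close> occurs only through \<open>T x - y\<close>, so the integral
    over \<open>y\<close> is \<open>emeasure lborel A\<close> by translation and reflection. What
    remains is the ball, unchanged by \<open>T\<close>.\<close>
  also have "\<dots> = (\<integral>\<^sup>+x. emeasure lborel A * indicator B (T x) \<partial>lborel)"
    by (simp add: nn_integral_multc refl)
  also have "\<dots> = emeasure lborel A * (\<integral>\<^sup>+x. indicator B x \<partial>lborel)"
    by (simp add: nn_integral_cmult B_def norm indicator_def)
  also have "\<dots> = emeasure lborel A * emeasure lborel B"
    by simp
  finally have "emeasure (distr lborel borel T) A * emeasure lborel B = emeasure lborel A * emeasure lborel B" .
  moreover have "emeasure lborel B \<noteq> 0" "emeasure lborel B \<noteq> \<infinity>"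
    using emeasure_lborel_ball_finite[of "0::'a" 1] content_ball_pos[of 1 "0::'a"]
    by (auto simp: B_def measure_def)
  ultimately show "emeasure (distr lborel borel T) A = emeasure lborel A"
    by (metis ennreal_mult_cancel_left infinity_ennreal_def mult.commute)
qed simp

section \<open>Gaussian integrals, normalisation and scaling\<close>

lemma nn_integral_exp_square:
  fixes b :: real
  assumes "0 < b"
  shows "(\<integral>\<^sup>+x. ennreal (exp (- b * x\<^sup>2)) \<partial>lborel) = ennreal (sqrt (pi / b))"
proof -
  \<comment> \<open>The normal density of variance \<open>1 / (2 * b)\<close> is the integrand up to
    its constant, so its total mass one gives the value.\<close>
  define s where "s = 1 / sqrt (2 * b)"
  have s: "0 < s" "s\<^sup>2 = 1 / (2 * b)"
    using assms by (auto simp: s_def power_divide)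
  interpret prob_space "density lborel (normal_density 0 s)"
    by (rule prob_space_normal_density) (use s in auto)
  have "1 = (\<integral>\<^sup>+x. ennreal (normal_density 0 s x) \<partial>lborel)"
    using emeasure_space_1 by (simp add: emeasure_density)
  also have "\<dots> = (\<integral>\<^sup>+x. ennreal (1 / sqrt (pi / b)) * ennreal (exp (- b * x\<^sup>2)) \<partial>lborel)"
    using assms by (intro nn_integral_cong) (simp add: normal_density_def s mult.commute flip: ennreal_mult)
  also have "\<dots> = ennreal (1 / sqrt (pi / b)) * (\<integral>\<^sup>+x. ennreal (exp (- b * x\<^sup>2)) \<partial>lborel)"
    by (rule nn_integral_cmult) simp
  finally have "ennreal (sqrt (pi / b)) * 1 = ennreal (sqrt (pi / b)) * (ennreal (1 / sqrt (pi / b)) * (\<integral>\<^sup>+x. ennreal (exp (- b * x\<^sup>2)) \<partial>lborel))"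
    by simp
  also have "\<dots> = (\<integral>\<^sup>+x. ennreal (exp (- b * x\<^sup>2)) \<partial>lborel)"
    using assms by (simp add: mult.assoc[symmetric] flip: ennreal_mult)
  finally show ?thesis by simp
qed

lemma nn_integral_exp_norm_square:
  fixes b :: real
  assumes "0 < b"
  shows "(\<integral>\<^sup>+z. ennreal (exp (- b * (norm (z :: complex ^ 'n))\<^sup>2)) \<partial>lborel) = ennreal ((pi / b) ^ CARD('n))"
proof -
  have "(\<integral>\<^sup>+z. ennreal (exp (- b * (norm (z :: complex ^ 'n))\<^sup>2)) \<partial>lborel)
      = (\<integral>\<^sup>+z. (\<Prod>i\<in>Basis. ennreal (exp (- b * (z \<bullet> i)\<^sup>2))) \<partial>(lborel :: (complex ^ 'n) measure))"
    unfolding power2_norm_eq_inner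
    by (subst euclidean_inner) (simp add: prod_ennreal sum_distrib_left exp_sum power2_eq_square sum_negf[symmetric])
  also have "\<dots> = (\<Prod>i\<in>(Basis :: (complex ^ 'n) set). ennreal (sqrt (pi / b)))"
    by (subst nn_integral_lborel_prod) (auto simp: nn_integral_exp_square[OF assms, simplified])
  also have "\<dots> = ennreal (sqrt (pi / b) ^ (2 * CARD('n)))"
    using assms by (simp add: prod_ennreal mult.commute ennreal_power)
  also have "\<dots> = ennreal ((pi / b) ^ CARD('n))"
    using assms by (simp add: power_mult)
  finally show ?thesis .
qed

definition gauss_dens :: "real \<Rightarrow> complex ^ 'n \<Rightarrow> real" where
  "gauss_dens b z = (b / pi) ^ CARD('n) * exp (- b * (norm z)\<^sup>2)"

lemma gauss_dens_pos: "0 < b \<Longrightarrow> 0 < gauss_dens b z"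
  by (simp add: gauss_dens_def)

lemma gauss_dens_measurable[measurable]: "gauss_dens b \<in> borel_measurable borel"
  unfolding gauss_dens_def by measurable

lemma gauss_eq: "gauss b = density lborel (\<lambda>z. ennreal (gauss_dens b z))"
  by (simp add: gauss_def gauss_dens_def)

lemma sets_gauss[simp, measurable_cong]: "sets (gauss b) = sets borel"
  by (simp add: gauss_eq)

lemma space_gauss[simp]: "space (gauss b) = UNIV"
  by (simp add: gauss_eq)

lemma prob_space_gauss:
  assumes "0 < b" shows "prob_space (gauss b :: (complex ^ 'n) measure)"
proof
  have "emeasure (gauss b) (space (gauss b :: (complex ^ 'n) measure))
      = (\<integral>\<^sup>+z. ennreal ((b / pi) ^ CARD('n)) * ennreal (exp (- b * (norm (z :: complex ^ 'n))\<^sup>2)) \<partial>lborel)"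
    using assms by (simp add: gauss_def emeasure_density ennreal_mult')
  also have "\<dots> = ennreal ((b / pi) ^ CARD('n)) * ennreal ((pi / b) ^ CARD('n))"
    using assms by (subst nn_integral_cmult) (simp_all only: nn_integral_exp_norm_square, simp_all)
  also have "\<dots> = 1"
    using assms by (simp add: power_divide flip: ennreal_mult)
  finally show "emeasure (gauss b) (space (gauss b :: (complex ^ 'n) measure)) = 1" .
qed

lemma nn_integral_gauss:
  assumes [measurable]: "f \<in> borel_measurable borel"
  shows "(\<integral>\<^sup>+z. f z \<partial>gauss b) = (\<integral>\<^sup>+z. ennreal (gauss_dens b z) * f z \<partial>lborel)"
  unfolding gauss_eq by (rule nn_integral_density) auto

lemma integrable_gauss_iff:
  fixes f :: "complex ^ 'n \<Rightarrow> 'b::{banach, second_countable_topology}"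
  assumes [measurable]: "f \<in> borel_measurable borel" and "0 < b"
  shows "integrable (gauss b) f \<longleftrightarrow> integrable lborel (\<lambda>z. gauss_dens b z *\<^sub>R f z)"
  unfolding gauss_eq using assms
  by (intro integrable_density) (auto intro!: less_imp_le gauss_dens_pos)

lemma integral_gauss:
  fixes f :: "complex ^ 'n \<Rightarrow> 'b::{banach, second_countable_topology}"
  assumes [measurable]: "f \<in> borel_measurable borel" and "0 < b"
  shows "(\<integral>z. f z \<partial>gauss b) = (\<integral>z. gauss_dens b z *\<^sub>R f z \<partial>lborel)"
  unfolding gauss_eq using assms
  by (intro integral_density) (auto intro!: less_imp_le gauss_dens_pos)

lemma distr_gauss_isometry:
  fixes T :: "complex ^ 'n \<Rightarrow> complex ^ 'n"
  assumes "linear T" and "\<And>x. norm (T x) = norm x" 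
  shows "distr (gauss b) borel T = gauss b"
proof -
  have [measurable]: "T \<in> borel_measurable borel"
    using assms by (intro borel_measurable_continuous_onI linear_continuous_on linear_conv_bounded_linear[THEN iffD1])
  have "gauss b = density (distr lborel borel T) (\<lambda>z. ennreal (gauss_dens b z))"
    using assms by (simp add: gauss_eq distr_lborel_isometry)
  also have "\<dots> = distr (density lborel (\<lambda>z. ennreal (gauss_dens b (T z)))) borel T"
    by (rule density_distr) auto
  also have "\<dots> = distr (gauss b) borel T"
    using assms by (simp add: gauss_eq gauss_dens_def)
  finally show ?thesis ..
qed

text \<open>The product density depends only on the norm of the pair, so the argument for a single
  factor applies to every linear isometry of the product. It is used for rotations that mix the two
  factors.\<close>

lemma distr_gauss_pair_isometry:
  fixes T :: "(complex ^ 'n) \<times> (complex ^ 'n) \<Rightarrow> (complex ^ 'n) \<times> (complex ^ 'n)"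
  assumes "linear T" and "\<And>x. norm (T x) = norm x" and b: "0 < b"
  shows "distr (gauss b \<Otimes>\<^sub>M gauss b) borel T = gauss b \<Otimes>\<^sub>M gauss b"
proof -
  have [measurable]: "T \<in> borel_measurable borel"
    using assms by (intro borel_measurable_continuous_onI linear_continuous_on linear_conv_bounded_linear[THEN iffD1])
  define d :: "(complex ^ 'n) \<times> (complex ^ 'n) \<Rightarrow> ennreal" 
    where "d z = ennreal ((b / pi) ^ CARD('n) * (b / pi) ^ CARD('n) * exp (- b * (norm z)\<^sup>2))" for z
  have [measurable]: "d \<in> borel_measurable borel"
    unfolding d_def[abs_def] by (intro measurable_compose[OF _ measurable_ennreal] borel_measurable_continuous_onI continuous_intros)
  interpret prob_space "gauss b :: (complex ^ 'n) measure" by (rule prob_space_gauss[OF b])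
  have eq: "gauss b \<Otimes>\<^sub>M gauss b = density lborel d"
  proof -
    have "gauss b \<Otimes>\<^sub>M gauss b = density (lborel \<Otimes>\<^sub>M lborel) (\<lambda>(x, y :: complex ^ 'n). ennreal (gauss_dens b (x :: complex ^ 'n)) * ennreal (gauss_dens b y))"
      unfolding gauss_eq
      by (rule pair_measure_density)
         (use sigma_finite_measure_axioms in \<open>auto simp: gauss_eq lborel.sigma_finite_measure_axioms\<close>)
    also have "(\<lambda>(x, y :: complex ^ 'n). ennreal (gauss_dens b (x :: complex ^ 'n)) * ennreal (gauss_dens b y)) = d"
      using b by (auto simp: fun_eq_iff d_def gauss_dens_def norm_Pair algebra_simps exp_add[symmetric]
            simp flip: ennreal_mult exp_add)
    finally show ?thesis by (simp add: lborel_prod)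
  qed
  have "density lborel d = density (distr lborel borel T) d"
    using assms by (simp add: distr_lborel_isometry)
  also have "\<dots> = distr (density lborel (\<lambda>z. d (T z))) borel T"
    by (rule density_distr) auto
  also have "\<dots> = distr (density lborel d) borel T"
    using assms unfolding d_def by simp
  finally show ?thesis by (simp add: eq)
qed

lemma nn_integral_lborel_scale:
  fixes f :: "'a::euclidean_space \<Rightarrow> ennreal"
  assumes [measurable]: "f \<in> borel_measurable borel" and c: "0 < c"
  shows "(\<integral>\<^sup>+z. f z \<partial>lborel) = ennreal (c ^ DIM('a)) * (\<integral>\<^sup>+z. f (c *\<^sub>R z) \<partial>lborel)"
  using c by (subst lborel_affine[of c 0])
    (simp_all add: nn_integral_density nn_integral_distr nn_integral_cmult)

lemma gauss_scale:
  fixes b :: real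
  assumes b: "0 < b"
  shows "(gauss b :: (complex ^ 'n) measure) = distr (gauss 1) borel (\<lambda>z. (1 / sqrt b) *\<^sub>R z)"
proof (rule measure_eqI)
  fix A assume "A \<in> sets (gauss b :: (complex ^ 'n) measure)"
  then have [measurable]: "A \<in> sets borel" by simp
  have "emeasure (gauss b) A = (\<integral>\<^sup>+z. indicator A z \<partial>gauss b)" by simp
  also have "\<dots> = (\<integral>\<^sup>+z. ennreal (gauss_dens b z) * indicator A z \<partial>lborel)"
    by (rule nn_integral_gauss) simp
  also have "\<dots> = ennreal ((1 / sqrt b) ^ DIM(complex ^ 'n)) * 
      (\<integral>\<^sup>+z. ennreal (gauss_dens b ((1 / sqrt b) *\<^sub>R z)) * indicator A ((1 / sqrt b) *\<^sub>R z) \<partial>lborel)"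
    using b by (intro nn_integral_lborel_scale) auto
  also have "\<dots> = (\<integral>\<^sup>+z. ennreal ((1 / sqrt b) ^ DIM(complex ^ 'n) * gauss_dens b ((1 / sqrt b) *\<^sub>R z)) * indicator A ((1 / sqrt b) *\<^sub>R z) \<partial>lborel)"
    using b by (subst nn_integral_cmult[symmetric]) (auto intro!: nn_integral_cong simp: ennreal_mult mult.assoc gauss_dens_pos less_imp_le)
  also have "\<dots> = (\<integral>\<^sup>+z. ennreal (gauss_dens 1 z) * indicator A ((1 / sqrt b) *\<^sub>R z) \<partial>lborel)"
  proof -
    have "(1 / sqrt b) ^ DIM(complex ^ 'n) * gauss_dens b ((1 / sqrt b) *\<^sub>R z) = gauss_dens 1 z" for z :: "complex ^ 'n"
    proof -
      have "(1 / sqrt b) ^ (CARD('n) * 2) = (1 / b) ^ CARD('n)"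
        using b by (simp add: mult.commute[of _ 2] power_mult power_divide del: mult_2)
      then show ?thesis
        using b by (simp add: gauss_dens_def power_mult_distrib power_divide)
    qed
    then show ?thesis by simp
  qed
  also have "\<dots> = emeasure (distr (gauss 1) borel (\<lambda>z. (1 / sqrt b) *\<^sub>R z)) A"
    by (simp add: nn_integral_gauss nn_integral_distr flip: nn_integral_indicator)
  finally show "emeasure (gauss b) A = emeasure (distr (gauss 1) borel (\<lambda>z. (1 / sqrt b) *\<^sub>R z)) A" .
qed simp

text \<open>Most domination arguments below end here: growth with a quadratic exponent below the one
  of the Gaussian is integrable.\<close>

lemma integrable_exp_norm_square:
  fixes c :: real
  assumes c: "c < b" and b: "0 < b"
  shows "integrable (gauss b) (\<lambda>z :: complex ^ 'n. exp (c * (norm z)\<^sup>2))"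
proof (rule integrableI_bounded)
  have "(\<integral>\<^sup>+z. ennreal (norm (exp (c * (norm (z :: complex ^ 'n))\<^sup>2))) \<partial>gauss b)
      = (\<integral>\<^sup>+z. ennreal (gauss_dens b z) * ennreal (norm (exp (c * (norm (z :: complex ^ 'n))\<^sup>2))) \<partial>lborel)"
    by (rule nn_integral_gauss) simp
  also have "\<dots> = (\<integral>\<^sup>+z. ennreal ((b / pi) ^ CARD('n)) * ennreal (exp (- (b - c) * (norm (z :: complex ^ 'n))\<^sup>2)) \<partial>lborel)"
    using b by (intro nn_integral_cong) (simp add: gauss_dens_def mult.assoc algebra_simps flip: ennreal_mult exp_add)
  also have "\<dots> = ennreal ((b / pi) ^ CARD('n)) * ennreal ((pi / (b - c)) ^ CARD('n))"
    using c by (subst nn_integral_cmult) (simp_all only: nn_integral_exp_norm_square diff_gt_0_iff_gt, simp_all)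
  also have "\<dots> < \<infinity>" by (simp add: ennreal_mult_less_top)
  finally show "(\<integral>\<^sup>+z. ennreal (norm (exp (c * (norm (z :: complex ^ 'n))\<^sup>2))) \<partial>gauss b) < \<infinity>" .
qed simp

lemma measurable_gauss[simp]: "measurable (gauss b) N = measurable borel N" "measurable N (gauss b) = measurable N borel"
  by (rule measurable_cong_sets; simp)+

section \<open>The mean value property and the reproducing kernel\<close>

definition cip :: "complex ^ 'n \<Rightarrow> complex ^ 'n \<Rightarrow> complex" where
  "cip z w = (\<Sum>i\<in>UNIV. z $ i * cnj (w $ i))"

lemma cip_simps:
  "cip (z + z') w = cip z w + cip z' w" "cip z (w + w') = cip z w + cip z w'"
  "cip (z - z') w = cip z w - cip z' w" "cip z (w - w') = cip z w - cip z w'"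
  "cip (- z) w = - cip z w" "cip z (- w) = - cip z w"
  "cip (c *s z) w = c * cip z w" "cip z (c *s w) = cnj c * cip z w"
  "cip (x *\<^sub>R z) w = of_real x * cip z w" "cip z (x *\<^sub>R w) = of_real x * cip z w"
  "cip 0 w = 0" "cip z 0 = 0"
  by (simp_all add: cip_def algebra_simps sum.distrib sum_subtractf sum_distrib_left sum_negf scaleR_conv_of_real[where 'a = complex])

lemma cnj_cip: "cnj (cip z w) = cip w z"
  by (simp add: cip_def mult.commute)

lemma Re_cip: "Re (cip z w) = inner z w"
  by (simp add: cip_def inner_vec_def inner_complex_def)

lemma cip_self: "cip z z = of_real ((norm z)\<^sup>2)"
proof -
  have "Im (cip z z) = 0"
    using arg_cong[OF cnj_cip[of z z], of Im] by simp
  then show ?thesis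
    by (simp add: complex_eq_iff Re_cip power2_norm_eq_inner)
qed

lemma norm_cip_commute: "cmod (cip z w) = cmod (cip w z)"
  using complex_mod_cnj[of "cip z w"] by (simp only: cnj_cip)

lemma norm_vector_scalar_mult: "norm (c *s z) = cmod c * norm (z :: complex ^ 'n)"
  by (simp add: norm_vec_def norm_mult L2_set_right_distrib)

lemma norm_cip_le: "cmod (cip z w) \<le> norm z * norm w"
proof (cases "cip z w = 0")
  case False
  \<comment> \<open>A unimodular factor that makes the product real and nonnegative reduces the
    claim to the real Cauchy-Schwarz inequality.\<close>
  define c where "c = cnj (cip z w) / of_real (cmod (cip z w))"
  have c: "cmod c = 1" using False by (simp add: c_def norm_divide)
  have "c * cip z w = of_real (cmod (cip z w))"
    using False by (simp add: c_def complex_norm_square[symmetric] mult.commute power2_eq_square)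
  then have "cmod (cip z w) = Re (cip (c *s z) w)" by (simp add: cip_simps)
  also have "\<dots> \<le> norm (c *s z) * norm w"
    by (simp add: Re_cip norm_cauchy_schwarz)
  finally show ?thesis using c by (simp add: norm_vector_scalar_mult)
qed simp

lemma bounded_bilinear_cip: "bounded_bilinear cip"
  by standard (auto simp: cip_simps scaleR_conv_of_real[where 'a = complex] intro!: exI[of _ 1] norm_cip_le)

lemmas continuous_on_cip[continuous_intros] = bounded_bilinear.continuous_on[OF bounded_bilinear_cip]
lemmas tendsto_cip[tendsto_intros] = bounded_bilinear.tendsto[OF bounded_bilinear_cip]

lemma borel_measurable_cip[measurable (raw)]:
  assumes [measurable]: "f \<in> borel_measurable M" "g \<in> borel_measurable M"
  shows "(\<lambda>x. cip (f x) (g x)) \<in> borel_measurable M"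
  by (rule borel_measurable_continuous_Pair[OF assms]) (intro continuous_intros)

lemma continuous_on_vector_scalar_mult[continuous_intros]:
  fixes g :: "'a::topological_space \<Rightarrow> complex ^ 'n"
  assumes "continuous_on S f" "continuous_on S g"
  shows "continuous_on S (\<lambda>x. f x *s g x)"
  unfolding vector_scalar_mult_def by (intro continuous_intros assms)

section \<open>Entire functions of several variables\<close>

lemma entireD:
  "entire f \<Longrightarrow> \<exists>L. (f has_derivative L) (at z) \<and> (\<forall>c v. L (c *s v) = c * L v)"
  by (simp add: entire_def)

lemma entireI:
  assumes "\<And>z. (f has_derivative L z) (at z)" "\<And>z c v. L z (c *s v) = c * L z v"
  shows "entire f"
  using assms unfolding entire_def by blast

lemma continuous_on_entire:
  assumes "entire f" shows "continuous_on S f"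
proof (rule continuous_at_imp_continuous_on, rule ballI)
  fix z show "isCont f z"
    using assms unfolding entire_def by (meson has_derivative_continuous)
qed

lemma borel_measurable_entire: "entire f \<Longrightarrow> f \<in> borel_measurable borel"
  by (intro borel_measurable_continuous_onI continuous_on_entire)

lemma entire_const: "entire (\<lambda>_. c)"
  by (rule entireI[where L = "\<lambda>_ _. 0"]) auto

lemma entire_mult:
  assumes "entire f" "entire g" shows "entire (\<lambda>z. f z * g z)"
  unfolding entire_def
proof
  fix z
  obtain L where L: "(f has_derivative L) (at z)" "\<And>c v. L (c *s v) = c * L v"
    using entireD[OF assms(1)] by blast
  obtain M where M: "(g has_derivative M) (at z)" "\<And>c v. M (c *s v) = c * M v"
    using entireD[OF assms(2)] by blast
  show "\<exists>N. ((\<lambda>z. f z * g z) has_derivative N) (at z) \<and> (\<forall>c v. N (c *s v) = c * N v)"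
    using has_derivative_mult[OF L(1) M(1)] L(2) M(2)
    by (intro exI[of _ "\<lambda>h. f z * M h + L h * g z"]) (auto simp: algebra_simps)
qed

lemma entire_add:
  assumes "entire f" "entire g" shows "entire (\<lambda>z. f z + g z)"
  unfolding entire_def
proof
  fix z
  obtain L where L: "(f has_derivative L) (at z)" "\<And>c v. L (c *s v) = c * L v"
    using entireD[OF assms(1)] by blast
  obtain M where M: "(g has_derivative M) (at z)" "\<And>c v. M (c *s v) = c * M v"
    using entireD[OF assms(2)] by blast
  show "\<exists>N. ((\<lambda>z. f z + g z) has_derivative N) (at z) \<and> (\<forall>c v. N (c *s v) = c * N v)"
    using has_derivative_add[OF L(1) M(1)] L(2) M(2)
    by (intro exI[of _ "\<lambda>h. L h + M h"]) (auto simp: algebra_simps)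
qed

lemma entire_cip: "entire (\<lambda>z. cip z w)"
  by (rule entireI[where L = "\<lambda>_ v. cip v w"])
    (auto simp: cip_simps intro!: bounded_linear_imp_has_derivative bounded_bilinear.bounded_linear_left[OF bounded_bilinear_cip])

lemma entire_exp:
  assumes "entire f" shows "entire (\<lambda>z. exp (f z))"
  unfolding entire_def
proof
  fix z
  obtain L where L: "(f has_derivative L) (at z)" "\<And>c v. L (c *s v) = c * L v"
    using entireD[OF assms(1)] by blast
  have "((\<lambda>z. exp (f z)) has_derivative (\<lambda>h. L h * exp (f z))) (at z)"
    by (rule has_derivative_compose[OF L(1), of exp "\<lambda>h. h * exp (f z)"])
       (use DERIV_exp[of "f z"] in \<open>simp add: has_field_derivative_def mult_commute_abs\<close>)
  then show "\<exists>N. ((\<lambda>z. exp (f z)) has_derivative N) (at z) \<and> (\<forall>c v. N (c *s v) = c * N v)"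
    using L(2) by (intro exI[of _ "\<lambda>h. L h * exp (f z)"]) auto
qed

lemma entire_shift:
  assumes "entire f" shows "entire (\<lambda>z. f (a + z))"
  unfolding entire_def
proof
  fix z
  obtain L where L: "(f has_derivative L) (at (a + z))" "\<And>c v. L (c *s v) = c * L v"
    using entireD[OF assms(1)] by blast
  have "((\<lambda>z. f (a + z)) has_derivative (\<lambda>h. L h)) (at z)"
    by (rule has_derivative_compose[of "(+) a" "\<lambda>h. h" z UNIV f L]) (auto intro!: derivative_eq_intros L)
  then show "\<exists>N. ((\<lambda>z. f (a + z)) has_derivative N) (at z) \<and> (\<forall>c v. N (c *s v) = c * N v)"
    using L(2) by auto
qed

text \<open>Complex linearity of the derivative makes the restriction to a complex line holomorphic
  in one variable, so that Cauchy's formula becomes available.\<close>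

lemma holomorphic_slice:
  assumes "entire f" shows "(\<lambda>t. f (t *s v)) holomorphic_on S"
proof (rule holomorphic_onI)
  fix t
  obtain L where L: "(f has_derivative L) (at (t *s v))" "\<And>c v. L (c *s v) = c * L v"
    using entireD[OF assms(1)] by blast
  have "((\<lambda>t. t *s v) has_derivative (\<lambda>h. h *s v)) (at t)"
    by (intro bounded_linear_imp_has_derivative linear_conv_bounded_linear[THEN iffD1] linearI)
      (auto simp: vec_eq_iff algebra_simps)
  then have "((\<lambda>t. f (t *s v)) has_derivative (\<lambda>h. L (h *s v))) (at t)"
    by (rule has_derivative_compose[of "\<lambda>t. t *s v" "\<lambda>h. h *s v" t UNIV f L]) (rule L(1))
  then have "((\<lambda>t. f (t *s v)) has_field_derivative L v) (at t)"
    using L(2) by (simp add: has_field_derivative_def mult_commute_abs)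
  then show "(\<lambda>t. f (t *s v)) field_differentiable at t within S"
    by (meson field_differentiable_at_within field_differentiable_def)
qed

section \<open>Mean value property and reproducing formula\<close>

text \<open>Cauchy's formula at the centre of the unit circle in the line through \<open>v\<close>.
  It is phrased as a Lebesgue integral over \<open>{0..1}\<close> so that Fubini can exchange it
  with a Gaussian integral.\<close>

lemma circle_mean_value:
  assumes "entire g"
  shows "(\<integral>t. indicator {0..1} t *\<^sub>R g (exp (2 * of_real pi * \<i> * of_real t) *s v) \<partial>lborel) = g 0"
proof -
  let ?e = "\<lambda>t::real. exp (2 * of_real pi * \<i> * of_real t)"
  have "((\<lambda>u. g (u *s v) / (u - 0)) has_contour_integral (2 * of_real pi * \<i> * g (0 *s v))) (circlepath 0 1)"
    by (rule Cauchy_integral_circlepath_simple) (auto intro!: holomorphic_slice assms)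
  then have "((\<lambda>t. g (?e t *s v) / ?e t * (2 * pi * \<i> * ?e t)) has_integral (2 * of_real pi * \<i> * g 0)) {0..1}"
    unfolding has_contour_integral_def vector_smult_lzero
    by (rule has_integral_eq[rotated]) (simp add: vector_derivative_circlepath01, simp add: circlepath)
  then have "((\<lambda>t. (2 * pi * \<i>) * g (?e t *s v)) has_integral (2 * pi * \<i> * g 0)) {0..1}"
    by (simp add: mult_ac)
  from has_integral_mult_right[OF this, of "1 / (2 * pi * \<i>)"]
  have *: "((\<lambda>t. g (?e t *s v)) has_integral g 0) {0..1}"
    by (simp add: mult.assoc[symmetric])
  have "continuous_on {0..1} (\<lambda>t. g (?e t *s v))"
    by (intro continuous_on_compose2[OF continuous_on_entire[OF assms, of UNIV]] continuous_intros) auto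
  then have "set_integrable lborel {0..1} (\<lambda>t. g (?e t *s v))"
    by (rule borel_integrable_atLeastAtMost')
  from set_borel_integral_eq_integral(2)[OF this] * show ?thesis
    by (simp add: set_lebesgue_integral_def integral_unique)
qed

lemma linear_vector_scalar_mult: "linear ((*s) (c :: complex) :: complex ^ 'n \<Rightarrow> complex ^ 'n)"
  by (rule linearI) (auto simp: vec_eq_iff algebra_simps)

text \<open>The Gaussian measure is invariant under multiplication by a phase. Averaging over the
  phase and exchanging the integrals replaces \<open>g v\<close> by its mean over a circle, which is
  \<open>g 0\<close>. Integrability is the only growth condition.\<close>

lemma gauss_mean_value:
  fixes g :: "complex ^ 'n \<Rightarrow> complex"
  assumes g: "entire g" and int: "integrable (gauss b) g" and b: "0 < b"
  shows "(\<integral>v. g v \<partial>gauss b) = g 0"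
proof -
  let ?e = "\<lambda>t::real. exp (2 * of_real pi * \<i> * of_real t)"
  interpret G: prob_space "gauss b :: (complex ^ 'n) measure" by (rule prob_space_gauss[OF b])
  interpret pair_sigma_finite "lborel :: real measure" "gauss b :: (complex ^ 'n) measure" ..
  have [measurable]: "g \<in> borel_measurable borel" by (rule borel_measurable_entire[OF g])
  have e1: "cmod (?e t) = 1" for t
    by (simp add: mult.commute[of _ "\<i>"] mult.assoc flip: of_real_mult)
  have inv: "distr (gauss b) borel ((*s) (?e t)) = gauss b" for t
    by (rule distr_gauss_isometry) (simp_all add: linear_vector_scalar_mult norm_vector_scalar_mult e1)
  have meas_e: "(*s) (?e t) \<in> borel_measurable borel" for t
    by (intro borel_measurable_continuous_onI continuous_intros)
  have [measurable]: "(\<lambda>x :: real \<times> (complex ^ 'n). ?e (fst x) *s snd x) \<in> borel_measurable (lborel \<Otimes>\<^sub>M gauss b)"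
  proof -
    have "(\<lambda>x :: real \<times> (complex ^ 'n). ?e (fst x) *s snd x) \<in> borel_measurable (borel \<Otimes>\<^sub>M borel)"
      unfolding borel_prod by (intro borel_measurable_continuous_onI continuous_intros)
    then show ?thesis by (simp cong: measurable_cong_sets sets_pair_measure_cong)
  qed
  have rot: "integrable (gauss b) (\<lambda>v. g (?e t *s v))" "(\<integral>v. g (?e t *s v) \<partial>gauss b) = (\<integral>v. g v \<partial>gauss b)"
    "(\<integral>v. cmod (g (?e t *s v)) \<partial>gauss b) = (\<integral>v. cmod (g v) \<partial>gauss b)" for t
    using int integrable_distr_eq[of "(*s) (?e t)" "gauss b" borel g] meas_e[of t]
      integral_distr[of "(*s) (?e t)" "gauss b" borel g, symmetric] 
      integral_distr[of "(*s) (?e t)" "gauss b" borel "\<lambda>v. cmod (g v)", symmetric]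
    by (simp_all add: inv)
  have "integrable (lborel \<Otimes>\<^sub>M gauss b) (\<lambda>(t, v). indicator {0..1} t *\<^sub>R g (?e t *s v))"
  proof (rule Fubini_integrable)
    show "(\<lambda>(t, v). indicator {0..1} t *\<^sub>R g (?e t *s v)) \<in> borel_measurable (lborel \<Otimes>\<^sub>M gauss b)"
      unfolding split_beta by measurable
    have "integrable lborel (\<lambda>t::real. indicator {0..1} t *\<^sub>R (\<integral>v. cmod (g v) \<partial>gauss b))"
      using borel_integrable_atLeastAtMost'[of 0 1 "\<lambda>_. \<integral>v. cmod (g v) \<partial>gauss b"]
      by (simp add: set_integrable_def)
    then show "integrable lborel (\<lambda>t. \<integral>v. norm (case (t, v) of (t, v) \<Rightarrow> indicator {0..1} t *\<^sub>R g (?e t *s v)) \<partial>gauss b)"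
      by (simp add: rot abs_of_nonneg)
  qed (auto simp: rot)
  from Fubini_integral[OF this]
  have "(\<integral>v. \<integral>t. indicator {0..1} t *\<^sub>R g (?e t *s v) \<partial>lborel \<partial>gauss b)
      = (\<integral>v. g v \<partial>gauss b)"
    by (simp add: rot)
  then show ?thesis
    using G.prob_space by (simp add: circle_mean_value[OF g])
qed

text \<open>Completing the square: \<open>- |z + v|^2 + cip z (z + v) = - |v|^2 - cip v z\<close>.
  Besides the Gaussian weight in \<open>v\<close>, what multiplies \<open>h (z + v)\<close> is
  holomorphic in \<open>v\<close>.\<close>

lemma gauss_dens_shift:
  "gauss_dens b (z + v) *\<^sub>R (h (z + v) * exp (of_real b * cip z (z + v)))
     = gauss_dens b v *\<^sub>R (h (z + v) * exp (- of_real b * cip v z))"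
proof -
  have "complex_of_real (- b * (norm (z + v))\<^sup>2) + of_real b * cip z (z + v)
      = of_real (- b * (norm v)\<^sup>2) + (- of_real b * cip v z)"
    by (simp only: of_real_mult of_real_minus of_real_add cip_self[symmetric] cip_simps) (simp add: algebra_simps)
  then have "exp (complex_of_real (- b * (norm (z + v))\<^sup>2)) * exp (of_real b * cip z (z + v))
      = exp (of_real (- b * (norm v)\<^sup>2)) * exp (- of_real b * cip v z)"
    by (simp only: mult_exp_exp)
  moreover have "c * e1 * (k * e2) = c * e3 * (k * e4)" if "e1 * e2 = e3 * e4" for c k e1 e2 e3 e4 :: complex
  proof -
    have "c * e1 * (k * e2) = c * k * (e1 * e2)" by simp
    also have "\<dots> = c * e3 * (k * e4)" unfolding that by simp
    finally show ?thesis .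
  qed
  ultimately show ?thesis
    unfolding gauss_dens_def scaleR_conv_of_real of_real_mult[of "(b / pi) ^ CARD('a)"] exp_of_real[symmetric]
    by blast
qed

text \<open>After the translation \<open>w = z + v\<close> the integrand is a Gaussian weight times
  the entire function \<open>g\<close>, and the mean value property evaluates it at
  \<open>v = 0\<close>, where \<open>g 0 = h z\<close>.\<close>

lemma reproducing:
  fixes h :: "complex ^ 'n \<Rightarrow> complex"
  assumes h: "entire h" and b: "0 < b"
    and int: "integrable (gauss b) (\<lambda>w. h w * exp (of_real b * cip z w))"
  shows "(\<integral>w. h w * exp (of_real b * cip z w) \<partial>gauss b) = h z"
proof -
  have [measurable]: "h \<in> borel_measurable borel" by (rule borel_measurable_entire[OF h])
  define F where "F w = gauss_dens b w *\<^sub>R (h w * exp (of_real b * cip z w))" for w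
  define g where "g v = h (z + v) * exp (- of_real b * cip v z)" for v
  have [measurable]: "F \<in> borel_measurable borel" "g \<in> borel_measurable borel"
    unfolding F_def[abs_def] g_def[abs_def] by measurable
  have Fg: "F (z + v) = gauss_dens b v *\<^sub>R g v" for v
    unfolding F_def g_def by (rule gauss_dens_shift[of b z v h])
  have "integrable lborel F"
    unfolding F_def[abs_def] by (rule integrable_gauss_iff[THEN iffD1, OF _ b int]) measurable
  then have "integrable (distr lborel borel ((+) z)) F"
    by (simp only: lborel_distr_plus)
  then have "integrable lborel (\<lambda>v. F (z + v))"
    by (rule integrable_distr[rotated]) simp
  then have int_g: "integrable (gauss b) g"
    unfolding Fg by (rule integrable_gauss_iff[THEN iffD2, OF _ b, rotated]) simp
  have ent_g: "entire g"
    unfolding g_def by (rule entire_mult[OF entire_shift[OF h] entire_exp[OF entire_mult[OF entire_const entire_cip]]])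
  have "(\<integral>v. g v \<partial>gauss b) = g 0"
    by (rule gauss_mean_value[OF ent_g int_g b])
  then have "g 0 = (\<integral>v. F (z + v) \<partial>lborel)"
    using b by (simp only: Fg integral_gauss \<open>g \<in> borel_measurable borel\<close>)
  also have "\<dots> = (\<integral>v. F v \<partial>distr lborel borel ((+) z))"
    by (rule integral_distr[symmetric]) auto
  also have "\<dots> = (\<integral>w. h w * exp (of_real b * cip z w) \<partial>gauss b)"
    using b by (simp add: lborel_distr_plus F_def[abs_def] integral_gauss)
  finally show ?thesis
    by (simp add: g_def cip_simps)
qed

lemma integrable_gauss_bound:
  fixes f :: "complex ^ 'n \<Rightarrow> 'b::{banach, second_countable_topology}"
  assumes [measurable]: "f \<in> borel_measurable borel" and "0 < b" "c < b"
    and le: "\<And>y. norm (f y) \<le> C * exp (c * (norm y)\<^sup>2)"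
  shows "integrable (gauss b) f"
proof (rule Bochner_Integration.integrable_bound)
  show "integrable (gauss b) (\<lambda>y :: complex ^ 'n. C * exp (c * (norm y)\<^sup>2))"
    by (rule integrable_mult_right, rule integrable_exp_norm_square) (use assms(2,3) in simp_all)
  show "AE y in gauss b. norm (f y) \<le> norm (C * exp (c * (norm y)\<^sup>2))"
    proof (rule AE_I2)
    fix y show "norm (f y) \<le> norm (C * exp (c * (norm y)\<^sup>2))"
      using order_trans[OF le[of y] abs_ge_self] by (simp only: real_norm_def)
  qed
  show "f \<in> borel_measurable (gauss b)" by measurable
qed


section \<open>Elementary exponential bounds\<close>

text \<open>Trades a linear exponent for an arbitrarily small quadratic one; in this way
  exponentials of norms and of \<open>cip\<close> are absorbed into the Gaussian.\<close>

lemma mult_le_square: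
  fixes K x e :: real assumes "0 < e" shows "K * x \<le> K\<^sup>2 / (4 * e) + e * x\<^sup>2"
proof -
  have "0 \<le> (K / (2 * sqrt e) - sqrt e * x)\<^sup>2" by simp
  also have "\<dots> = K\<^sup>2 / (4 * e) + e * x\<^sup>2 - K * x"
    using assms by (simp add: power2_diff power_mult_distrib power_divide)
  finally show ?thesis by simp
qed

lemma square_le_exp:
  fixes x e :: real assumes "0 < e" shows "x\<^sup>2 \<le> 1 / e * exp (e * x\<^sup>2)"
proof -
  have "e * x\<^sup>2 \<le> exp (e * x\<^sup>2)" using exp_ge_add_one_self[of "e * x\<^sup>2"] by linarith
  then show ?thesis using assms by (simp add: field_simps)
qed

lemma le_exp_square:
  fixes x :: real shows "x \<le> exp (x\<^sup>2 / 4)"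
proof -
  have "x \<le> 1 + x\<^sup>2 / 4" using mult_le_square[of "1/4" 1 x] by simp
  then show ?thesis using exp_ge_add_one_self[of "x\<^sup>2 / 4"] by linarith
qed

lemma exp_mult_le:
  fixes K x e :: real assumes "0 < e"
  shows "exp (K * x) \<le> exp (K\<^sup>2 / (4 * e)) * exp (e * x\<^sup>2)"
  using mult_le_square[OF assms] by (simp flip: exp_add)

lemma norm_exp_minus_one_le: "cmod (exp z - 1) \<le> cmod z * exp (cmod z)"
  using Taylor_exp_field[of z 0] by (simp add: mult.commute)

lemma norm_exp_minus_linear_le: "cmod (exp z - 1 - z) \<le> (cmod z)\<^sup>2 * exp (cmod z)"
  using Taylor_exp_field[of z 1] by (simp add: mult.commute power2_eq_square diff_diff_eq)

section \<open>First and second Gaussian moments\<close>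

lemma norm_cip_exp_le:
  "cmod (cip y a) \<le> norm a * exp ((norm y)\<^sup>2 / 4)" 
  using mult_right_mono[OF le_exp_square[of "norm y"], of "norm a"] norm_cip_le[of y a]
  by (simp add: mult.commute)

lemma gauss_moment_1: "(\<integral>y. cip y a \<partial>gauss 1) = 0" "integrable (gauss 1) (\<lambda>y. cip y a)"
proof -
  show *: "integrable (gauss 1) (\<lambda>y. cip y a)"
    by (rule integrable_gauss_bound[where c = "1/4" and C = "norm a"]) (use norm_cip_exp_le[of _ a] in auto)
  show "(\<integral>y. cip y a \<partial>gauss 1) = 0"
    by (subst gauss_mean_value) (auto simp: entire_cip * cip_simps)
qed

lemma norm_cip_mult_le: "cmod (cip y a) * cmod (cip y b) \<le> norm a * norm b * exp ((norm y)\<^sup>2 / 2)"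
proof -
  have "cmod (cip y a) * cmod (cip y b) \<le> (norm a * exp ((norm y)\<^sup>2 / 4)) * (norm b * exp ((norm y)\<^sup>2 / 4))"
    by (intro mult_mono norm_cip_exp_le) auto
  also have "\<dots> = norm a * norm b * (exp ((norm y)\<^sup>2 / 4) * exp ((norm y)\<^sup>2 / 4))" by simp
  also have "\<dots> = norm a * norm b * exp ((norm y)\<^sup>2 / 2)" unfolding mult_exp_exp by simp
  finally show ?thesis .
qed

lemma gauss_moment_2_hol: "(\<integral>y. cip y a * cip y b \<partial>gauss 1) = 0" "integrable (gauss 1) (\<lambda>y. cip y a * cip y b)"
proof -
  show *: "integrable (gauss 1) (\<lambda>y. cip y a * cip y b)"
    by (rule integrable_gauss_bound[where c = "1/2" and C = "norm a * norm b"]) (use norm_cip_mult_le[of _ a b] in \<open>auto simp: norm_mult\<close>)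
  show "(\<integral>y. cip y a * cip y b \<partial>gauss 1) = 0"
    by (subst gauss_mean_value) (auto simp: entire_cip entire_mult * cip_simps)
qed

lemma integrable_moment_2: "integrable (gauss 1) (\<lambda>y. cip y a * cip b y)"
  by (rule integrable_gauss_bound[where c = "1/2" and C = "norm a * norm b"])
    (use norm_cip_mult_le[of _ a b] in \<open>auto simp: norm_mult norm_cip_commute[of b]\<close>)

text \<open>Obtained by differentiating the reproducing formula: integrated against
  \<open>exp (t * cip b y)\<close>, the form \<open>cip y a\<close> gives
  \<open>t * cip b a\<close>, and the difference quotients at \<open>t = 0\<close> converge under
  the integral.\<close>

lemma gauss_moment_2:
  fixes a b :: "complex ^ 'n"
  shows "(\<integral>y. cip y a * cip b y \<partial>gauss 1) = cip b a"
proof -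
  define s where "s k = inverse (real (Suc k))" for k
  have s: "0 < s k" "s k \<le> 1" for k by (auto simp: s_def field_simps)
  have s0: "s \<longlonglongrightarrow> 0" unfolding s_def by (rule LIMSEQ_inverse_real_of_nat)
  \<comment> \<open>The exponents add up as \<open>1/4 + 1/8 = 3/8\<close>; a further
    \<open>1/4\<close> from \<open>cip y b\<close> gives \<open>5/8\<close>, still below the
    exponent \<open>1\<close> of \<open>gauss 1\<close>.\<close>
  have b1: "cmod (cip y a) * exp (cmod (cip b y)) \<le> norm a * exp (2 * (norm b)\<^sup>2) * exp (3 / 8 * (norm y)\<^sup>2)" for y
  proof -
    have "exp (cmod (cip b y)) \<le> exp (norm b * norm y)" using norm_cip_le[of b y] by simp
    also have "\<dots> \<le> exp ((norm b)\<^sup>2 / (4 * (1/8))) * exp (1/8 * (norm y)\<^sup>2)" by (rule exp_mult_le) simp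
    finally have "exp (cmod (cip b y)) \<le> exp (2 * (norm b)\<^sup>2) * exp (1/8 * (norm y)\<^sup>2)" by (simp add: mult.commute)
    from mult_mono[OF norm_cip_exp_le this]
    have "cmod (cip y a) * exp (cmod (cip b y)) \<le> norm a * exp (2 * (norm b)\<^sup>2) * (exp ((norm y)\<^sup>2 / 4) * exp (1/8 * (norm y)\<^sup>2))"
      by (simp add: mult_ac)
    then show ?thesis unfolding mult_exp_exp by (simp add: field_simps)
  qed
  have int: "integrable (gauss 1) (\<lambda>y. cip y a * exp (of_real t * cip b y))" if "0 \<le> t" "t \<le> 1" for t
  proof (rule integrable_gauss_bound)
    fix y
    have "t * Re (cip b y) \<le> cmod (cip b y)"
      using that mult_left_mono[OF complex_Re_le_cmod[of "cip b y"], of t] mult_left_le_one_le[of "cmod (cip b y)" t]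
      by simp
    then have "cmod (cip y a * exp (of_real t * cip b y)) \<le> cmod (cip y a) * exp (cmod (cip b y))"
      by (simp add: norm_mult mult_left_mono)
    also note b1
    finally show "cmod (cip y a * exp (of_real t * cip b y)) \<le> norm a * exp (2 * (norm b)\<^sup>2) * exp (3 / 8 * (norm y)\<^sup>2)" .
  qed auto
  have val: "(\<integral>y. cip y a * exp (of_real t * cip b y) \<partial>gauss 1) = of_real t * cip b a" if "0 \<le> t" "t \<le> 1" for t
    using reproducing[of "\<lambda>y. cip y a" 1 "t *\<^sub>R b"] int[OF that] by (simp add: entire_cip cip_simps)
  have "(\<lambda>k. \<integral>y. cip y a * ((exp (of_real (s k) * cip b y) - 1) / of_real (s k)) \<partial>gauss 1)
      \<longlonglongrightarrow> (\<integral>y. cip y a * cip b y \<partial>gauss 1)"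
  proof (rule integral_dominated_convergence)
    show "integrable (gauss 1) (\<lambda>y. (norm a * norm b) * (exp (2 * (norm b)\<^sup>2) * exp (5 / 8 * (norm y)\<^sup>2)))"
      by (rule integrable_mult_right, rule integrable_mult_right, rule integrable_exp_norm_square) auto
    fix k
    show "AE y in gauss 1. cmod (cip y a * ((exp (of_real (s k) * cip b y) - 1) / of_real (s k)))
      \<le> (norm a * norm b) * (exp (2 * (norm b)\<^sup>2) * exp (5 / 8 * (norm y)\<^sup>2))"
    proof (rule AE_I2)
      fix y
      have "cmod ((exp (of_real (s k) * cip b y) - 1) / of_real (s k)) 
          \<le> (cmod (of_real (s k) * cip b y) * exp (cmod (of_real (s k) * cip b y))) / s k"
        using s[of k] norm_exp_minus_one_le[of "of_real (s k) * cip b y"] by (simp add: norm_divide divide_right_mono)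
      also have "\<dots> = cmod (cip b y) * exp (s k * cmod (cip b y))"
        using s[of k] by (simp add: norm_mult)
      also have "\<dots> \<le> cmod (cip b y) * exp (cmod (cip b y))"
        using s[of k] by (simp add: mult_left_mono mult_left_le_one_le)
      finally have "cmod (cip y a * ((exp (of_real (s k) * cip b y) - 1) / of_real (s k)))
        \<le> cmod (cip y a) * (cmod (cip b y) * exp (cmod (cip b y)))"
        unfolding norm_mult by (rule mult_left_mono) simp
      also have "\<dots> = cmod (cip y b) * (cmod (cip y a) * exp (cmod (cip b y)))"
        by (simp add: norm_cip_commute[of b y] mult_ac)
      also have "\<dots> \<le> (norm b * exp ((norm y)\<^sup>2 / 4)) * (norm a * exp (2 * (norm b)\<^sup>2) * exp (3 / 8 * (norm y)\<^sup>2))"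
        by (intro mult_mono norm_cip_exp_le b1) auto
      also have "\<dots> = (norm a * norm b) * (exp (2 * (norm b)\<^sup>2) * (exp ((norm y)\<^sup>2 / 4) * exp (3 / 8 * (norm y)\<^sup>2)))"
        by (simp add: mult_ac)
      also have "\<dots> = (norm a * norm b) * (exp (2 * (norm b)\<^sup>2) * exp (5 / 8 * (norm y)\<^sup>2))"
        unfolding mult_exp_exp by (simp add: field_simps)
      finally show "cmod (cip y a * ((exp (of_real (s k) * cip b y) - 1) / of_real (s k)))
        \<le> (norm a * norm b) * (exp (2 * (norm b)\<^sup>2) * exp (5 / 8 * (norm y)\<^sup>2))" .
    qed
  next
    have "((\<lambda>t. (exp (t * c) - 1) / t) \<longlongrightarrow> c) (at 0)" for c :: complex
    proof -
      have "((\<lambda>t. exp (t * c)) has_field_derivative c) (at 0)"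
        by (auto intro!: derivative_eq_intros)
      then show ?thesis by (simp add: has_field_derivative_def DERIV_def flip: has_field_derivative_def)
    qed
    moreover have "filterlim (\<lambda>k. complex_of_real (s k)) (at 0) sequentially"
      using s s0 tendsto_of_real[of s 0 sequentially] by (auto simp: filterlim_at less_imp_neq[THEN not_sym] intro!: always_eventually)
    ultimately have "(\<lambda>k. (exp (of_real (s k) * c) - 1) / of_real (s k)) \<longlonglongrightarrow> c" for c :: complex
      by (rule filterlim_compose[where g = "\<lambda>t. (exp (t * c) - 1) / t"])
    then show "AE y in gauss 1. (\<lambda>k. cip y a * ((exp (of_real (s k) * cip b y) - 1) / of_real (s k))) \<longlonglongrightarrow> cip y a * cip b y"
      by (intro AE_I2 tendsto_mult tendsto_const)
  qed measurable
  moreover have "(\<integral>y. cip y a * ((exp (of_real (s k) * cip b y) - 1) / of_real (s k)) \<partial>gauss 1) = cip b a" for k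
  proof -
    have "(\<integral>y. cip y a * ((exp (of_real (s k) * cip b y) - 1) / of_real (s k)) \<partial>gauss 1)
      = (\<integral>y. (cip y a * exp (of_real (s k) * cip b y) - cip y a) / of_real (s k) \<partial>gauss 1)"
      by (simp add: algebra_simps diff_divide_distrib)
    also have "\<dots> = of_real (s k) * cip b a / of_real (s k)"
      using s[of k] int[of "s k"] by (simp add: Bochner_Integration.integral_diff val gauss_moment_1)
    also have "\<dots> = cip b a" using s[of k] by simp
    finally show ?thesis .
  qed
  ultimately show ?thesis
    by (simp add: LIMSEQ_const_iff)
qed

section \<open>The infinitesimal contraction estimate\<close>

lemma integral_norm_cip_square:
  "(\<integral>y. (cmod (cip y a))\<^sup>2 \<partial>gauss 1) = (norm a)\<^sup>2" "integrable (gauss 1) (\<lambda>y. (cmod (cip y a))\<^sup>2)"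
proof -
  have eq: "(cmod (cip y a))\<^sup>2 = Re (cip y a * cip a y)" for y
    by (simp add: cnj_cip[of y a, symmetric] complex_mult_cnj cmod_power2)
  show "integrable (gauss 1) (\<lambda>y. (cmod (cip y a))\<^sup>2)"
    unfolding eq by (intro integrable_Re integrable_moment_2)
  show "(\<integral>y. (cmod (cip y a))\<^sup>2 \<partial>gauss 1) = (norm a)\<^sup>2"
    unfolding eq by (subst integral_Re[OF integrable_moment_2]) (simp add: gauss_moment_2 cip_self)
qed

text \<open>\<open>(Re z)^2\<close> is the mean of \<open>|z|^2\<close> and \<open>Re (z^2)\<close>.
  The square of \<open>cip y c\<close> is holomorphic in \<open>y\<close> and vanishes at the
  origin, so it does not contribute; hence the factor one half.\<close>

lemma integral_Re_cip_square:
  "(\<integral>y. (Re (cip y c))\<^sup>2 \<partial>gauss 1) = (norm c)\<^sup>2 / 2" "integrable (gauss 1) (\<lambda>y. (Re (cip y c))\<^sup>2)"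
proof -
  have eq: "(Re z)\<^sup>2 = ((cmod z)\<^sup>2 + Re (z * z)) / 2" for z
    unfolding cmod_power2 by (simp add: power2_eq_square)
  have i: "integrable (gauss 1) (\<lambda>y. Re (cip y c * cip y c))"
    by (intro integrable_Re gauss_moment_2_hol)
  show "integrable (gauss 1) (\<lambda>y. (Re (cip y c))\<^sup>2)"
    unfolding eq by (intro integrable_divide Bochner_Integration.integrable_add i integral_norm_cip_square)
  have "(\<integral>y. Re (cip y c * cip y c) \<partial>gauss 1) = 0"
    by (subst integral_Re) (simp_all add: gauss_moment_2_hol)
  then show "(\<integral>y. (Re (cip y c))\<^sup>2 \<partial>gauss 1) = (norm c)\<^sup>2 / 2"
    unfolding eq by (simp add: Bochner_Integration.integral_add integral_norm_cip_square i del: times_complex.sel)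
qed

text \<open>The cross term of \<open>|z + cnj w|^2\<close> is \<open>2 * Re (z * w)\<close>, the
  real part of a holomorphic function vanishing at the origin. Hence the holomorphic and
  antiholomorphic parts contribute separately.\<close>

lemma integral_norm_linear_square:
  "(\<integral>y. (cmod (cip y a + cnj (cip y b)))\<^sup>2 \<partial>gauss 1) = (norm a)\<^sup>2 + (norm b)\<^sup>2"
  "integrable (gauss 1) (\<lambda>y. (cmod (cip y a + cnj (cip y b)))\<^sup>2)"
proof -
  have eq: "(cmod (z + cnj w))\<^sup>2 = (cmod z)\<^sup>2 + (cmod w)\<^sup>2 + 2 * Re (z * w)" for z w
    unfolding cmod_power2 by (simp add: power2_eq_square algebra_simps)
  have i: "integrable (gauss 1) (\<lambda>y. Re (cip y a * cip y b))"
    by (intro integrable_Re gauss_moment_2_hol)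
  have "(\<integral>y. Re (cip y a * cip y b) \<partial>gauss 1) = 0"
    by (subst integral_Re) (simp_all add: gauss_moment_2_hol)
  then show "(\<integral>y. (cmod (cip y a + cnj (cip y b)))\<^sup>2 \<partial>gauss 1) = (norm a)\<^sup>2 + (norm b)\<^sup>2"
    unfolding eq by (simp add: Bochner_Integration.integral_add integral_norm_cip_square i del: times_complex.sel)
  show "integrable (gauss 1) (\<lambda>y. (cmod (cip y a + cnj (cip y b)))\<^sup>2)"
    unfolding eq by (simp add: integral_norm_cip_square i del: times_complex.sel)
qed

text \<open>The quadratic term of the Taylor expansion of \<open>(e + |z|\<^sup>2)\<^sup>m\<close> at \<open>A\<close>, where \<open>m = p / 2\<close>;
  the summand \<open>e\<close> removes the singularity of \<open>|z|\<^sup>p\<close> at the origin.\<close>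

definition quad :: "real \<Rightarrow> real \<Rightarrow> complex \<Rightarrow> complex \<Rightarrow> real" where
  "quad e m A B = m * (e + (cmod A)\<^sup>2) powr (m - 1) * (cmod B)\<^sup>2
     + 2 * m * (m - 1) * (e + (cmod A)\<^sup>2) powr (m - 2) * (Re (cnj A * B))\<^sup>2"

section \<open>Taylor estimates for the regularised power\<close>

text \<open>Third-order Taylor formula for \<open>S t powr m\<close> along the segment from
  \<open>A\<close> to \<open>A + B\<close>. Since \<open>|S'| \<le> 2 * |B| * sqrt S\<close>, both
  terms of the third derivative are controlled by \<open>|B|^3 * S powr (m - 3/2)\<close>; the
  exponent is negative, so \<open>S \<ge> e\<close> bounds this uniformly in \<open>A\<close>. The
  two terms contribute 8 and 4, and 12 divided by the factorial of 3 is the constant 2.\<close>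

lemma taylor_power:
  fixes e m :: real and A B :: complex
  assumes e: "0 < e" and m: "0 < m" "m \<le> 1"
  shows "\<bar>(e + (cmod (A + B))\<^sup>2) powr m - (e + (cmod A)\<^sup>2) powr m
    - 2 * m * (e + (cmod A)\<^sup>2) powr (m - 1) * Re (cnj A * B) - quad e m A B\<bar> \<le> 2 * e powr (m - 3/2) * (cmod B)^3"
proof -
  define be where "be = Re (cnj A * B)"
  define n where "n = cmod B"
  define s where "s = e + (cmod A)\<^sup>2"
  define S where "S t = s + 2 * be * t + n\<^sup>2 * t\<^sup>2" for t
  define S' where "S' t = 2 * be + 2 * n\<^sup>2 * t" for t
  have S_eq: "S t = e + (cmod (A + of_real t * B))\<^sup>2" for t
    unfolding S_def s_def be_def n_def cmod_power2 by (simp add: power2_eq_square algebra_simps)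
  have S'_eq: "S' t = 2 * Re (cnj (A + of_real t * B) * B)" for t
    unfolding S'_def be_def n_def cmod_power2 by (simp add: power2_eq_square algebra_simps)
  have S_ge: "e \<le> S t" "0 < S t" for t using e by (auto simp: S_eq add_pos_nonneg)
  have S'_le: "\<bar>S' t\<bar> \<le> 2 * n * S t powr (1/2)" for t
  proof -
    have "\<bar>Re (cnj (A + of_real t * B) * B)\<bar> \<le> cmod (cnj (A + of_real t * B) * B)"
      by (rule abs_Re_le_cmod)
    also have "\<dots> = cmod (A + of_real t * B) * n" by (simp only: norm_mult complex_mod_cnj n_def)
    also have "\<dots> \<le> sqrt (S t) * n"
      using e by (intro mult_right_mono real_le_rsqrt) (auto simp: S_eq n_def)
    finally show ?thesis using S_ge(2)[of t] by (simp add: S'_eq powr_half_sqrt mult.commute abs_mult del: times_complex.sel)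
  qed
  have dS: "(S has_real_derivative S' t) (at t)" for t
    unfolding S_def[abs_def] S'_def by (auto intro!: derivative_eq_intros)
  have dS': "(S' has_real_derivative 2 * n\<^sup>2) (at t)" for t
    unfolding S'_def[abs_def] by (auto intro!: derivative_eq_intros)
  have dpow: "((\<lambda>t. S t powr c) has_real_derivative c * S t powr (c - 1) * S' t) (at t)" for c t
    using DERIV_fun_powr[OF dS S_ge(2), of c t] by simp
  \<comment> \<open>\<open>D k\<close> is the \<open>k\<close>-th derivative of
    \<open>S t powr m\<close>, the last branch being the third.\<close>
  define D where "D k = (if k = 0 then (\<lambda>t. S t powr m) else if k = 1 then (\<lambda>t. m * S t powr (m - 1) * S' t)
     else if k = 2 then (\<lambda>t. m * (m - 1) * S t powr (m - 2) * (S' t)\<^sup>2 + 2 * m * n\<^sup>2 * S t powr (m - 1))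
     else (\<lambda>t. m * (m - 1) * (m - 2) * S t powr (m - 3) * (S' t)^3 + 6 * m * (m - 1) * n\<^sup>2 * S t powr (m - 2) * S' t))"
    for k :: nat
  have d1: "((\<lambda>t. S t powr (m - 1)) has_real_derivative (m - 1) * S t powr (m - 2) * S' t) (at t)" for t
    using dpow[of "m - 1"] by (simp add: algebra_simps)
  have d2: "((\<lambda>t. S t powr (m - 2)) has_real_derivative (m - 2) * S t powr (m - 3) * S' t) (at t)" for t
    using dpow[of "m - 2"] by (simp add: algebra_simps)
  have "\<exists>t. 0 < t \<and> t < 1 \<and> S 1 powr m = (\<Sum>k<3. D k 0 / fact k * 1 ^ k) + D 3 t / fact 3 * 1 ^ 3"
  proof (rule Maclaurin)
    show "\<forall>k t. k < 3 \<and> 0 \<le> t \<and> t \<le> 1 \<longrightarrow> (D k has_real_derivative D (Suc k) t) (at t)"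
    proof (intro allI impI)
      fix k :: nat and t :: real assume "k < 3 \<and> 0 \<le> t \<and> t \<le> 1"
      then consider "k = 0" | "k = 1" | "k = 2" by linarith
      then show "(D k has_real_derivative D (Suc k) t) (at t)"
      proof cases
        case 1 then show ?thesis using dpow[of m t] by (simp add: D_def)
      next
        case 2
        have "((\<lambda>t. m * S t powr (m - 1) * S' t) has_real_derivative 
          m * ((m - 1) * S t powr (m - 2) * S' t) * S' t + m * S t powr (m - 1) * (2 * n\<^sup>2)) (at t)"
          by (auto intro!: derivative_eq_intros d1 dS' dS S_ge(2))
        then show ?thesis using 2 by (simp add: D_def power2_eq_square algebra_simps)
      next
        case 3
        have "((\<lambda>t. m * (m - 1) * S t powr (m - 2) * (S' t)\<^sup>2 + 2 * m * n\<^sup>2 * S t powr (m - 1)) has_real_derivative 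
          m * (m - 1) * ((m - 2) * S t powr (m - 3) * S' t) * (S' t)\<^sup>2 + m * (m - 1) * S t powr (m - 2) * (2 * S' t * (2 * n\<^sup>2))
          + 2 * m * n\<^sup>2 * ((m - 1) * S t powr (m - 2) * S' t)) (at t)"
          by (auto intro!: derivative_eq_intros d1 d2 dS' dS S_ge(2))
        moreover have "m * (m - 1) * ((m - 2) * S t powr (m - 3) * S' t) * (S' t)\<^sup>2 + m * (m - 1) * S t powr (m - 2) * (2 * S' t * (2 * n\<^sup>2))
          + 2 * m * n\<^sup>2 * ((m - 1) * S t powr (m - 2) * S' t) = D 3 t"
          by (simp add: D_def power2_eq_square power3_eq_cube)
        moreover have "D 2 = (\<lambda>t. m * (m - 1) * S t powr (m - 2) * (S' t)\<^sup>2 + 2 * m * n\<^sup>2 * S t powr (m - 1))"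
          by (simp add: D_def)
        ultimately have "(D 2 has_real_derivative D 3 t) (at t)" by (simp only:)
        then show ?thesis using 3 by simp
      qed
    qed
  qed (auto simp: D_def)
  then obtain t where "S 1 powr m = (\<Sum>k<3. D k 0 / fact k * 1 ^ k) + D 3 t / fact 3 * 1 ^ 3"
    by blast
  then have t: "S 1 powr m = (\<Sum>k<3. D k 0 / fact k) + D 3 t / 6"
    by (simp add: fact_numeral)
  have "{..<3::nat} = {0, 1, 2}" by auto
  then have "(\<Sum>k<3. D k 0 / fact k) = D 0 0 + D 1 0 + D 2 0 / 2"
    by (simp add: fact_numeral)
  also have "\<dots> = s powr m + m * s powr (m - 1) * (2 * be) + (m * (m - 1) * s powr (m - 2) * (2 * be)\<^sup>2 + 2 * m * n\<^sup>2 * s powr (m - 1)) / 2"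
    by (simp only: D_def) (simp add: S_def S'_def)
  also have "\<dots> = s powr m + 2 * m * s powr (m - 1) * be + quad e m A B"
    unfolding quad_def s_def[symmetric] be_def[symmetric] n_def[symmetric]
    by (simp add: power2_eq_square field_simps)
  finally have "(\<Sum>k<3. D k 0 / fact k) = s powr m + 2 * m * s powr (m - 1) * be + quad e m A B" .
  with t have "(e + (cmod (A + B))\<^sup>2) powr m - s powr m - 2 * m * s powr (m - 1) * be - quad e m A B = D 3 t / 6"
    using S_eq[of 1] by simp
  moreover have "\<bar>D 3 t\<bar> \<le> 12 * (e powr (m - 3/2) * n^3)"
  proof -
    have n0: "0 \<le> n" by (simp add: n_def)
    have "\<bar>D 3 t\<bar> \<le> \<bar>m * (m - 1) * (m - 2) * S t powr (m - 3) * (S' t)^3\<bar> + \<bar>6 * m * (m - 1) * n\<^sup>2 * S t powr (m - 2) * S' t\<bar>"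
      by (simp add: D_def)
    also have "\<bar>m * (m - 1) * (m - 2) * S t powr (m - 3) * (S' t)^3\<bar> \<le> 1 * (S t powr (m - 3) * (2 * n * S t powr (1/2))^3)"
    proof -
      have "m * (1 - m) * (2 - m) \<le> 1 / 4 * 2"
      proof (rule mult_mono)
        show "m * (1 - m) \<le> 1 / 4" using zero_le_power2[of "m - 1/2"] by (simp add: power2_eq_square algebra_simps)
      qed (use m in auto)
      then have "\<bar>m * (m - 1) * (m - 2)\<bar> \<le> 1"
        using m by (simp add: abs_mult)
      moreover have "\<bar>S' t\<bar>^3 \<le> (2 * n * S t powr (1/2))^3" by (intro power_mono S'_le) auto
      ultimately show ?thesis unfolding abs_mult[of "m * (m - 1) * (m - 2) * _"] abs_mult[of "m * (m - 1) * (m - 2)"] power_abs mult.assoc[of _ "\<bar>S t powr (m - 3)\<bar>"]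
        by (intro mult_mono) auto
    qed
    also have "S t powr (m - 3) * (2 * n * S t powr (1/2))^3 = 8 * n^3 * S t powr (m - 3/2)"
    proof -
      have "(S t powr (1/2))^3 = S t powr (3/2)"
        using S_ge(2)[of t] by (simp add: powr_powr flip: powr_realpow)
      then have "S t powr (m - 3) * (2 * n * S t powr (1/2))^3 = 8 * n^3 * (S t powr (m - 3) * S t powr (3/2))"
        by (simp add: power_mult_distrib)
      also have "S t powr (m - 3) * S t powr (3/2) = S t powr (m - 3/2)"
        by (simp flip: powr_add)
      finally show ?thesis .
    qed
    also have "\<bar>6 * m * (m - 1) * n\<^sup>2 * S t powr (m - 2) * S' t\<bar> \<le> 2 * (n\<^sup>2 * S t powr (m - 2) * (2 * n * S t powr (1/2)))"
    proof -
      have "m * (1 - m) \<le> 1 / 4" using zero_le_power2[of "m - 1/2"] by (simp add: power2_eq_square algebra_simps)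
      then have "\<bar>6 * m * (m - 1)\<bar> \<le> 2"
        using m by (simp add: abs_mult)
      moreover have "\<bar>n\<^sup>2 * S t powr (m - 2) * S' t\<bar> \<le> n\<^sup>2 * S t powr (m - 2) * (2 * n * S t powr (1/2))"
        using S'_le[of t] by (simp add: abs_mult mult_left_mono)
      ultimately have "\<bar>6 * m * (m - 1)\<bar> * \<bar>n\<^sup>2 * S t powr (m - 2) * S' t\<bar> \<le> 2 * (n\<^sup>2 * S t powr (m - 2) * (2 * n * S t powr (1/2)))"
        by (intro mult_mono) auto
      then show ?thesis by (simp add: mult.assoc flip: abs_mult)
    qed
    also have "n\<^sup>2 * S t powr (m - 2) * (2 * n * S t powr (1/2)) = 2 * n^3 * S t powr (m - 3/2)"
    proof -
      have "S t powr (m - 2) * S t powr (1/2) = S t powr (m - 3/2)"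
        by (simp flip: powr_add)
      then show ?thesis by (simp add: power3_eq_cube power2_eq_square mult_ac)
    qed
    finally have "\<bar>D 3 t\<bar> \<le> 12 * (n^3 * S t powr (m - 3/2))" by simp
    also have "\<dots> \<le> 12 * (n^3 * e powr (m - 3/2))"
      using m e S_ge[of t] n0 by (intro mult_left_mono powr_mono2') auto
    finally show ?thesis by (simp add: mult.commute)
  qed
  ultimately show ?thesis
    by (simp add: s_def be_def n_def)
qed

text \<open>The Taylor formula produces \<open>quad\<close> at the full increment, while its
  Gaussian mean is computed at the linear part; this controls the exchange. \<open>quad\<close> is a
  quadratic form in \<open>B\<close>, and \<open>|A|^2 \<le> s\<close> absorbs the extra negative
  power of \<open>s\<close> in its second term.\<close>

lemma quad_diff_le:
  fixes e m :: real and A B B' :: complex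
  assumes e: "0 < e" and m: "0 < m" "m \<le> 1"
  shows "\<bar>quad e m A B - quad e m A B'\<bar> \<le> 3 * e powr (m - 1) * (cmod (B - B') * (cmod B + cmod B'))"
proof -
  define s where "s = e + (cmod A)\<^sup>2"
  have s: "e \<le> s" "0 < s" using e by (auto simp: s_def add_pos_nonneg)
  define X where "X = cmod (B - B') * (cmod B + cmod B')"
  have X0: "0 \<le> X" by (simp add: X_def)
  have "\<bar>(cmod B)\<^sup>2 - (cmod B')\<^sup>2\<bar> = \<bar>cmod B - cmod B'\<bar> * (cmod B + cmod B')"
    by (simp add: power2_eq_square square_diff_square_factored abs_mult)
  also have "\<dots> \<le> X" unfolding X_def
    by (intro mult_right_mono norm_triangle_ineq3) auto
  finally have 1: "\<bar>(cmod B)\<^sup>2 - (cmod B')\<^sup>2\<bar> \<le> X" .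
  have "(Re (cnj A * B))\<^sup>2 - (Re (cnj A * B'))\<^sup>2 = Re (cnj A * (B - B')) * Re (cnj A * (B + B'))"
    by (simp add: power2_eq_square algebra_simps)
  then have "\<bar>(Re (cnj A * B))\<^sup>2 - (Re (cnj A * B'))\<^sup>2\<bar> = \<bar>Re (cnj A * (B - B'))\<bar> * \<bar>Re (cnj A * (B + B'))\<bar>"
    by (simp add: abs_mult)
  also have "\<dots> \<le> (cmod A * cmod (B - B')) * (cmod A * (cmod B + cmod B'))"
  proof (intro mult_mono)
    show "\<bar>Re (cnj A * (B - B'))\<bar> \<le> cmod A * cmod (B - B')"
      using abs_Re_le_cmod[of "cnj A * (B - B')"] by (simp only: norm_mult complex_mod_cnj)
    have "\<bar>Re (cnj A * (B + B'))\<bar> \<le> cmod A * cmod (B + B')"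
      using abs_Re_le_cmod[of "cnj A * (B + B')"] by (simp only: norm_mult complex_mod_cnj)
    also have "\<dots> \<le> cmod A * (cmod B + cmod B')"
      by (intro mult_left_mono norm_triangle_ineq) auto
    finally show "\<bar>Re (cnj A * (B + B'))\<bar> \<le> cmod A * (cmod B + cmod B')" .
  qed auto
  also have "\<dots> = (cmod A)\<^sup>2 * X" by (simp add: X_def power2_eq_square)
  also have "\<dots> \<le> s * X" using X0 e by (intro mult_right_mono) (auto simp: s_def)
  finally have 2: "\<bar>(Re (cnj A * B))\<^sup>2 - (Re (cnj A * B'))\<^sup>2\<bar> \<le> s * X" .
  have "quad e m A B - quad e m A B' = m * s powr (m - 1) * ((cmod B)\<^sup>2 - (cmod B')\<^sup>2)
      + 2 * m * (m - 1) * s powr (m - 2) * ((Re (cnj A * B))\<^sup>2 - (Re (cnj A * B'))\<^sup>2)"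
    by (simp add: quad_def algebra_simps flip: s_def)
  also have "\<bar>\<dots>\<bar> \<le> \<bar>m * s powr (m - 1) * ((cmod B)\<^sup>2 - (cmod B')\<^sup>2)\<bar>
      + \<bar>2 * m * (m - 1) * s powr (m - 2) * ((Re (cnj A * B))\<^sup>2 - (Re (cnj A * B'))\<^sup>2)\<bar>"
    by (rule abs_triangle_ineq)
  also have "\<bar>m * s powr (m - 1) * ((cmod B)\<^sup>2 - (cmod B')\<^sup>2)\<bar> \<le> 1 * s powr (m - 1) * X"
    unfolding abs_mult using 1 m by (intro mult_mono) auto
  also have "\<bar>2 * m * (m - 1) * s powr (m - 2) * ((Re (cnj A * B))\<^sup>2 - (Re (cnj A * B'))\<^sup>2)\<bar>
     \<le> 2 * s powr (m - 2) * (s * X)"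
  proof -
    have "m * \<bar>m - 1\<bar> \<le> 1 * 1" using m by (intro mult_mono) auto
    then have "\<bar>2 * m * (m - 1)\<bar> \<le> 2" using m by (simp add: abs_mult)
    then show ?thesis
      unfolding abs_mult[of "_ * s powr _"] abs_mult[of _ "s powr _"] using 2 by (intro mult_mono) auto
  qed
  also have "2 * s powr (m - 2) * (s * X) = 2 * s powr (m - 1) * X"
    using s by (simp add: powr_diff power2_eq_square)
  finally have "\<bar>quad e m A B - quad e m A B'\<bar> \<le> 3 * s powr (m - 1) * X" by (simp add: mult.commute)
  also have "\<dots> \<le> 3 * e powr (m - 1) * X"
    using s e m X0 by (intro mult_right_mono mult_left_mono powr_mono2') auto
  finally show ?thesis by (simp add: X_def)
qed

text \<open>The admissible \<open>r\<close> is decided here. Multiplied by \<open>1 - k\<close>, the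
  right-hand side is \<open>(1 - 2 * k) * a^2\<close> plus the square of
  \<open>(1 - k) * b - k * a\<close>. Dropping the square leaves the condition
  \<open>r^2 \<le> (1 - 2 * k) / (1 - k)^2\<close>. The quotient decreases in \<open>k\<close>, so
  the worst case is \<open>k = 1 - m\<close>, where it equals
  \<open>(2 * m - 1) / m^2\<close>.\<close>

lemma quadratic_estimate:
  fixes m k r a b :: real
  assumes m: "1 / 2 < m" and k: "0 \<le> k" "k \<le> 1 - m" and r: "r\<^sup>2 = (2 * m - 1) / m\<^sup>2"
  shows "r\<^sup>2 * (1 - k) * a\<^sup>2 \<le> a\<^sup>2 + b\<^sup>2 - k * (a + b)\<^sup>2"
proof -
  have k1: "k < 1" using m k by linarith
  have 1: "(2 * m - 1) * (1 - k)\<^sup>2 \<le> (1 - 2 * k) * m\<^sup>2"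
  proof -
    \<comment> \<open>The difference vanishes in the worst case \<open>k = 1 - m\<close>, which
      explains the first factor.\<close>
    have "(1 - 2 * k) * m\<^sup>2 - (2 * m - 1) * (1 - k)\<^sup>2 = (1 - m - k) * ((1 - m) * (1 - k) + k * m)"
      by (simp add: power2_eq_square algebra_simps)
    moreover have "0 \<le> (1 - m) * (1 - k) + k * m" using m k k1 by (intro add_nonneg_nonneg mult_nonneg_nonneg) auto
    ultimately show ?thesis using k by (smt (verit) mult_nonneg_nonneg)
  qed
  have "r\<^sup>2 * (1 - k) * a\<^sup>2 * (1 - k) = (2 * m - 1) * (1 - k)\<^sup>2 / m\<^sup>2 * a\<^sup>2"
    unfolding r by (simp add: power2_eq_square)
  also have "\<dots> \<le> (1 - 2 * k) * a\<^sup>2"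
    using 1 m by (intro mult_right_mono) (auto simp: divide_le_eq)
  also have "\<dots> \<le> (1 - 2 * k) * a\<^sup>2 + ((1 - k) * b - k * a)\<^sup>2" by simp
  also have "\<dots> = (a\<^sup>2 + b\<^sup>2 - k * (a + b)\<^sup>2) * (1 - k)"
    by (simp add: power2_eq_square algebra_simps)
  finally show ?thesis using k1 by (simp only: mult_le_cancel_right)
qed

lemma borel_measurable_cnj[measurable (raw)]:
  assumes "f \<in> borel_measurable M"
  shows "(\<lambda>x. cnj (f x)) \<in> borel_measurable M"
  by (rule measurable_compose[OF assms borel_measurable_continuous_onI]) (intro continuous_intros)

lemma norm_integral_le_integral:
  fixes f :: "'a \<Rightarrow> 'b::{banach, second_countable_topology}"
  assumes "integrable M f" "integrable M g" "\<And>x. norm (f x) \<le> g x"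
  shows "norm (\<integral>x. f x \<partial>M) \<le> (\<integral>x. g x \<partial>M)"
  by (rule order_trans[OF integral_norm_bound integral_mono]) (use assms in auto)

section \<open>Growth bounds for the kernel\<close>

definition ker :: "real \<Rightarrow> complex ^ 'n \<Rightarrow> complex ^ 'n \<Rightarrow> complex" where
  "ker r x y = exp (of_real r * cip x y)"

lemma borel_measurable_ker[measurable (raw)]:
  assumes [measurable]: "f \<in> borel_measurable M" "g \<in> borel_measurable M"
  shows "(\<lambda>x. ker r (f x) (g x)) \<in> borel_measurable M"
  unfolding ker_def by measurable

text \<open>The weight \<open>7/8\<close> on \<open>y\<close> forces
  \<open>1 / (4 * 7/8) = 2/7\<close> on \<open>x\<close>. Both are dictated by later integrability:
  \<open>7/8\<close> plus a growth of \<open>1/16\<close> in the transformed function is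
  \<open>15/16 < 1\<close>, and the third power of the bound in \<open>x\<close> has the exponent
  \<open>6/7 < 1\<close>.\<close>

lemma norm_ker_le:
  assumes "0 \<le> r" "r \<le> 1"
  shows "cmod (ker r x y) \<le> exp (2/7 * (norm x)\<^sup>2) * exp (7/8 * (norm y)\<^sup>2)"
proof -
  have "cmod (ker r x y) = exp (r * Re (cip x y))" by (simp add: ker_def)
  also have "r * Re (cip x y) \<le> 1 * (norm x * norm y)"
    using assms complex_Re_le_cmod[of "cip x y"] norm_cip_le[of x y]
    by (smt (verit) mult_left_le_one_le mult_mono norm_ge_zero mult_nonneg_nonneg mult_left_mono)
  then have "exp (r * Re (cip x y)) \<le> exp (norm x * norm y)" by simp
  also have "\<dots> \<le> exp ((norm x)\<^sup>2 / (4 * (7/8))) * exp (7/8 * (norm y)\<^sup>2)"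
    by (rule exp_mult_le) simp
  finally show ?thesis by (simp add: mult.commute)
qed

lemma integrable_ker:
  fixes f :: "complex ^ 'n \<Rightarrow> complex"
  assumes [measurable]: "f \<in> borel_measurable borel" and r: "0 \<le> r" "r \<le> 1"
    and C: "0 \<le> C" and le: "\<And>y. cmod (f y) \<le> C * exp (1/16 * (norm y)\<^sup>2)"
  shows "integrable (gauss 1) (\<lambda>y. f y * ker r x y)"
proof (rule integrable_gauss_bound)
  fix y
  have "cmod (f y * ker r x y) \<le> (C * exp (1/16 * (norm y)\<^sup>2)) * (exp (2/7 * (norm x)\<^sup>2) * exp (7/8 * (norm y)\<^sup>2))"
    unfolding norm_mult using C by (intro mult_mono le norm_ker_le r) auto
  also have "\<dots> = C * exp (2/7 * (norm x)\<^sup>2) * (exp (1/16 * (norm y)\<^sup>2) * exp (7/8 * (norm y)\<^sup>2))"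
    by simp
  also have "\<dots> = C * exp (2/7 * (norm x)\<^sup>2) * exp (15/16 * (norm y)\<^sup>2)"
    unfolding mult_exp_exp by (simp add: field_simps)
  finally show "cmod (f y * ker r x y) \<le> C * exp (2/7 * (norm x)\<^sup>2) * exp (15/16 * (norm y)\<^sup>2)" .
qed auto

text \<open>A constant that depends on the dimension alone, which the \<open>itself\<close> argument
  carries.\<close>

definition cker :: "'n::finite itself \<Rightarrow> real" where
  "cker _ = (\<integral>y. exp (15/16 * (norm (y :: complex ^ 'n))\<^sup>2) \<partial>gauss 1)"

lemma cker_ge_1: "1 \<le> cker TYPE('n::finite)"
proof -
  interpret prob_space "gauss 1 :: (complex ^ 'n) measure" by (rule prob_space_gauss) simp
  have "(\<integral>y. 1 \<partial>(gauss 1 :: (complex ^ 'n) measure)) \<le> cker TYPE('n)"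
    unfolding cker_def by (intro integral_mono integrable_exp_norm_square) auto
  then show ?thesis using prob_space by simp
qed

lemma norm_integral_ker_le:
  fixes f :: "complex ^ 'n \<Rightarrow> complex"
  assumes [measurable]: "f \<in> borel_measurable borel" and r: "0 \<le> r" "r \<le> 1"
    and C: "0 \<le> C" and le: "\<And>y. cmod (f y) \<le> C * exp (1/16 * (norm y)\<^sup>2)"
  shows "cmod (\<integral>y. f y * ker r x y \<partial>gauss 1) \<le> C * cker TYPE('n) * exp (2/7 * (norm x)\<^sup>2)"
proof -
  have "cmod (\<integral>y. f y * ker r x y \<partial>gauss 1) \<le> (\<integral>y. C * exp (2/7 * (norm x)\<^sup>2) * exp (15/16 * (norm y)\<^sup>2) \<partial>(gauss 1 :: (complex ^ 'n) measure))"
  proof (rule norm_integral_le_integral)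
    fix y
    have "cmod (f y * ker r x y) \<le> (C * exp (1/16 * (norm y)\<^sup>2)) * (exp (2/7 * (norm x)\<^sup>2) * exp (7/8 * (norm y)\<^sup>2))"
      unfolding norm_mult using C by (intro mult_mono le norm_ker_le r) auto
    also have "\<dots> = C * exp (2/7 * (norm x)\<^sup>2) * (exp (1/16 * (norm y)\<^sup>2) * exp (7/8 * (norm y)\<^sup>2))"
      by simp
    also have "\<dots> = C * exp (2/7 * (norm x)\<^sup>2) * exp (15/16 * (norm y)\<^sup>2)"
      unfolding mult_exp_exp by (simp add: field_simps)
    finally show "cmod (f y * ker r x y) \<le> C * exp (2/7 * (norm x)\<^sup>2) * exp (15/16 * (norm y)\<^sup>2)" .
  next
    show "integrable (gauss 1) (\<lambda>y :: complex ^ 'n. C * exp (2/7 * (norm x)\<^sup>2) * exp (15/16 * (norm y)\<^sup>2))"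
      by (rule integrable_mult_right, rule integrable_exp_norm_square) simp_all
  qed (rule integrable_ker[OF assms(1) r C le])
  then show ?thesis by (simp add: cker_def mult_ac)
qed

section \<open>Comparison of the second-order terms\<close>

text \<open>Conjugating the antiholomorphic part does not change a real part, so
  \<open>Re (cnj A * B)\<close> becomes the real part of the single form
  \<open>cip y (A *s a + cnj A *s b)\<close>. The factor 2 in \<open>quad\<close> cancels the one
  half in the mean of a squared real part.\<close>

lemma integral_quad:
  "(\<integral>y. quad e m A (cip y a + cnj (cip y b)) \<partial>gauss 1)
     = m * (e + (cmod A)\<^sup>2) powr (m - 1) * ((norm a)\<^sup>2 + (norm b)\<^sup>2)
     + m * (m - 1) * (e + (cmod A)\<^sup>2) powr (m - 2) * (norm (A *s a + cnj A *s b))\<^sup>2"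
  "integrable (gauss 1) (\<lambda>y. quad e m A (cip y a + cnj (cip y b)))"
proof -
  have "Re (cnj A * (cip y a + cnj (cip y b))) = Re (cip y (A *s a + cnj A *s b))" for y
    by (simp add: cip_simps algebra_simps)
  then have eq: "quad e m A (cip y a + cnj (cip y b)) = m * (e + (cmod A)\<^sup>2) powr (m - 1) * (cmod (cip y a + cnj (cip y b)))\<^sup>2
     + 2 * m * (m - 1) * (e + (cmod A)\<^sup>2) powr (m - 2) * (Re (cip y (A *s a + cnj A *s b)))\<^sup>2" for y
    by (simp only: quad_def)
  note i = integral_norm_linear_square[of a b] integral_Re_cip_square[of "A *s a + cnj A *s b"]
  show "integrable (gauss 1) (\<lambda>y. quad e m A (cip y a + cnj (cip y b)))"
    unfolding eq using i by simp
  show "(\<integral>y. quad e m A (cip y a + cnj (cip y b)) \<partial>gauss 1)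
     = m * (e + (cmod A)\<^sup>2) powr (m - 1) * ((norm a)\<^sup>2 + (norm b)\<^sup>2)
     + m * (m - 1) * (e + (cmod A)\<^sup>2) powr (m - 2) * (norm (A *s a + cnj A *s b))\<^sup>2"
    unfolding eq using i by simp
qed

text \<open>The gradients \<open>r *\<^sub>R a\<close> and \<open>0\<close> on the left are what the
  kernel operator makes of \<open>a\<close> and \<open>b\<close>. The weight
  \<open>k = (1 - m) * |A|^2 / s\<close> measures how much the negative second term of
  \<open>quad\<close> takes away from the first; the triangle inequality for
  \<open>A *s a + cnj A *s b\<close> reduces the vectors to their norms.\<close>

lemma integral_quad_le:
  assumes e: "0 < e" and m: "1 / 2 < m" "m \<le> 1" and r: "r\<^sup>2 = (2 * m - 1) / m\<^sup>2"
  shows "(\<integral>y. quad e m A (cip y (r *\<^sub>R a) + cnj (cip y 0)) \<partial>gauss 1)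
    \<le> (\<integral>y. quad e m A (cip y a + cnj (cip y b)) \<partial>gauss 1)"
proof -
  define s where "s = e + (cmod A)\<^sup>2"
  have s: "0 < s" using e by (simp add: s_def add_pos_nonneg)
  define k where "k = (1 - m) * (cmod A)\<^sup>2 / s"
  have k: "0 \<le> k" "k \<le> 1 - m"
  proof -
    have "(cmod A)\<^sup>2 / s \<le> 1" using s e by (simp add: s_def)
    from mult_left_mono[OF this, of "1 - m"] show "k \<le> 1 - m" using m by (simp add: k_def)
    show "0 \<le> k" using m s by (simp add: k_def)
  qed
  have ps: "s powr (m - 2) = s powr (m - 1) / s"
    using s by (simp add: powr_diff power2_eq_square)
  have "(norm (A *s (r *\<^sub>R a) + cnj A *s 0))\<^sup>2 = (cmod A)\<^sup>2 * (r\<^sup>2 * (norm a)\<^sup>2)"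
    by (simp add: norm_vector_scalar_mult power_mult_distrib)
  then have "(\<integral>y. quad e m A (cip y (r *\<^sub>R a) + cnj (cip y 0)) \<partial>gauss 1) 
      = m * s powr (m - 1) * (r\<^sup>2 * (norm a)\<^sup>2) + m * (m - 1) * s powr (m - 2) * ((cmod A)\<^sup>2 * (r\<^sup>2 * (norm a)\<^sup>2))"
    unfolding integral_quad s_def by (simp add: power_mult_distrib)
  also have "\<dots> = m * s powr (m - 1) * (r\<^sup>2 * (1 - k) * (norm a)\<^sup>2)"
    using s unfolding ps k_def by (simp add: field_simps)
  also have "\<dots> \<le> m * s powr (m - 1) * ((norm a)\<^sup>2 + (norm b)\<^sup>2 - k * (norm a + norm b)\<^sup>2)"
    using m by (intro mult_left_mono quadratic_estimate[OF _ k r]) auto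
  also have "\<dots> = m * s powr (m - 1) * ((norm a)\<^sup>2 + (norm b)\<^sup>2) - m * (1 - m) * s powr (m - 2) * ((cmod A)\<^sup>2 * (norm a + norm b)\<^sup>2)"
    using s unfolding ps k_def by (simp add: field_simps)
  also have "\<dots> \<le> m * s powr (m - 1) * ((norm a)\<^sup>2 + (norm b)\<^sup>2) - m * (1 - m) * s powr (m - 2) * (norm (A *s a + cnj A *s b))\<^sup>2"
  proof -
    have "norm (A *s a + cnj A *s b) \<le> cmod A * (norm a + norm b)"
      using norm_triangle_ineq[of "A *s a" "cnj A *s b"] by (simp add: norm_vector_scalar_mult algebra_simps)
    then have "(norm (A *s a + cnj A *s b))\<^sup>2 \<le> (cmod A)\<^sup>2 * (norm a + norm b)\<^sup>2"
      unfolding power_mult_distrib[symmetric] by (rule power_mono) simp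
    then show ?thesis using m by (intro diff_left_mono mult_left_mono) auto
  qed
  also have "\<dots> = (\<integral>y. quad e m A (cip y a + cnj (cip y b)) \<partial>gauss 1)"
    unfolding integral_quad s_def[symmetric] by (simp add: algebra_simps)
  finally show ?thesis .
qed

lemma powr_le_one_plus:
  fixes x m :: real assumes "0 \<le> x" "0 < m" "m \<le> 1" shows "x powr m \<le> 1 + x"
proof (cases "x \<le> 1")
  case True
  then have "x powr m \<le> 1 powr m" using assms by (intro powr_mono2) auto
  then show ?thesis using assms by simp
next
  case False
  then have "x powr m \<le> x powr 1" using assms by (intro powr_mono) auto
  then show ?thesis using assms False by simp
qed

lemma exp_power: "exp (c * x) ^ k = exp (real k * c * x)" for c x :: real
  by (simp add: mult.assoc flip: exp_of_nat_mult)

lemma integrable_power_gauss: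
  fixes f :: "complex ^ 'n \<Rightarrow> complex"
  assumes [measurable]: "f \<in> borel_measurable borel" and e: "0 < e" and m: "0 < m" "m \<le> 1"
    and le: "\<And>y. cmod (f y) \<le> C * exp (2/7 * (norm y)\<^sup>2)"
  shows "integrable (gauss 1) (\<lambda>y. (e + (cmod (f y))\<^sup>2) powr m)"
proof (rule integrable_gauss_bound)
  fix y
  have "(e + (cmod (f y))\<^sup>2) powr m \<le> 1 + (e + (cmod (f y))\<^sup>2)"
    using e m by (intro powr_le_one_plus) auto
  also have "(cmod (f y))\<^sup>2 \<le> (C * exp (2/7 * (norm y)\<^sup>2))\<^sup>2"
    by (intro power_mono le) auto
  also have "\<dots> = C\<^sup>2 * exp (4/7 * (norm y)\<^sup>2)"
    unfolding power_mult_distrib exp_power by simp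
  also have "1 + (e + C\<^sup>2 * exp (4/7 * (norm y)\<^sup>2)) \<le> (1 + e + C\<^sup>2) * exp (4/7 * (norm y)\<^sup>2)"
  proof -
    have "1 \<le> exp (4/7 * (norm y)\<^sup>2)" by simp
    then have "(1 + e) * 1 \<le> (1 + e) * exp (4/7 * (norm y)\<^sup>2)" using e by (intro mult_left_mono) auto
    then show ?thesis by (simp add: algebra_simps)
  qed
  finally show "norm ((e + (cmod (f y))\<^sup>2) powr m) \<le> (1 + e + C\<^sup>2) * exp (4/7 * (norm y)\<^sup>2)"
    by simp
qed auto

text \<open>The linear part of the increment has size \<open>sqrt d\<close> and mean zero, and
  \<open>G\<close> has size \<open>d\<close>. To order \<open>d\<close>, only the mean of
  \<open>G\<close> and the quadratic term of the linear part survive; all else is of order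
  \<open>d * sqrt d\<close>, uniformly in \<open>A\<close>.\<close>

lemma integral_expansion:
  fixes G :: "complex ^ 'n \<Rightarrow> complex" and a b :: "complex ^ 'n"
  assumes e: "0 < e" and m: "0 < m" "m \<le> 1" and d: "0 \<le> d" "d \<le> 1" and M: "1 \<le> M"
    and a: "norm a \<le> sqrt d * M" and b: "norm b \<le> sqrt d * M"
    and G[measurable]: "G \<in> borel_measurable borel" 
    and Gle: "\<And>y. cmod (G y) \<le> d * M * exp (2/7 * (norm y)\<^sup>2)"
  defines "B \<equiv> \<lambda>y. cip y a + cnj (cip y b) + G y"
  shows "integrable (gauss 1) (\<lambda>y. (e + (cmod (A + B y))\<^sup>2) powr m)" (is ?thesis1)
    "\<bar>(\<integral>y. (e + (cmod (A + B y))\<^sup>2) powr m \<partial>gauss 1) - (e + (cmod A)\<^sup>2) powr m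
      - 2 * m * (e + (cmod A)\<^sup>2) powr (m - 1) * Re (cnj A * (\<integral>y. G y \<partial>gauss 1))
      - (\<integral>y. quad e m A (cip y a + cnj (cip y b)) \<partial>gauss 1)\<bar>
     \<le> (54 * e powr (m - 3/2) + 15 * e powr (m - 1)) * (d * sqrt d * M^3) 
        * (\<integral>y. exp (6/7 * (norm (y :: complex ^ 'n))\<^sup>2) \<partial>gauss 1)" (is ?thesis2)
proof -
  interpret prob_space "gauss 1 :: (complex ^ 'n) measure" by (rule prob_space_gauss) simp
  \<comment> \<open>A common bound for the growth of all parts of the increment; its cube, which the
    Taylor remainder needs, is still integrable because \<open>6/7 < 1\<close>.\<close>
  define W where "W y = exp (2/7 * (norm y)\<^sup>2)" for y :: "complex ^ 'n"
  have W1: "1 \<le> W y" for y by (simp add: W_def)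
  define l where "l y = cip y a + cnj (cip y b)" for y
  have [measurable]: "B \<in> borel_measurable borel" "l \<in> borel_measurable borel"
    unfolding B_def l_def[abs_def] by measurable
  have dsq: "d \<le> sqrt d" using d by (simp add: real_le_rsqrt power2_eq_square mult_left_le)
  have Bl: "B y - l y = G y" for y by (simp add: B_def l_def)
  have lin: "cmod (cip y c) \<le> sqrt d * M * W y" if "norm c \<le> sqrt d * M" for y c
  proof -
    have "cmod (cip y c) \<le> norm c * exp ((norm y)\<^sup>2 / 4)" by (rule norm_cip_exp_le)
    also have "\<dots> \<le> (sqrt d * M) * W y" 
      using that d M by (intro mult_mono) (auto simp: W_def)
    finally show ?thesis .
  qed
  have l_le: "cmod (l y) \<le> 2 * (sqrt d * M * W y)" for y
    using norm_triangle_ineq[of "cip y a" "cnj (cip y b)"] lin[OF a, of y] lin[OF b, of y] by (simp add: l_def)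
  have G_le: "cmod (G y) \<le> sqrt d * M * W y" for y
  proof -
    have "d * M * W y \<le> sqrt d * M * W y" using M W1[of y] by (intro mult_right_mono dsq) auto
    then show ?thesis using Gle[of y] by (simp add: W_def)
  qed
  have B_le: "cmod (B y) \<le> 3 * (sqrt d * M * W y)" for y
    using norm_triangle_ineq[of "l y" "G y"] l_le[of y] G_le[of y] by (simp add: B_def l_def)
  have int_l: "integrable (gauss 1) l" "(\<integral>y. l y \<partial>gauss 1) = 0"
    unfolding l_def[abs_def] by (simp_all add: gauss_moment_1)
  have int_G: "integrable (gauss 1) G"
    by (rule integrable_gauss_bound[OF _ _ _ Gle]) auto
  have B_eq: "B = (\<lambda>y. l y + G y)" by (simp add: B_def l_def)
  have int_B: "integrable (gauss 1) B" "(\<integral>y. B y \<partial>gauss 1) = (\<integral>y. G y \<partial>gauss 1)"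
    unfolding B_eq using int_l int_G by simp_all
  have W3: "integrable (gauss 1) (\<lambda>y :: complex ^ 'n. W y ^ 3)" 
    "(\<integral>y. W y ^ 3 \<partial>gauss 1) = (\<integral>y. exp (6/7 * (norm (y :: complex ^ 'n))\<^sup>2) \<partial>gauss 1)"
    unfolding W_def exp_power using integrable_exp_norm_square[of "6/7" 1, where 'n = 'n] by simp_all
  show 1: ?thesis1
  proof (rule integrable_power_gauss[OF _ e m])
    show "cmod (A + B y) \<le> (cmod A + 3 * (sqrt d * M)) * exp (2/7 * (norm y)\<^sup>2)" for y
      using norm_triangle_ineq[of A "B y"] B_le[of y] mult_left_mono[OF W1[of y], of "cmod A"]
      unfolding W_def[symmetric] by (simp add: algebra_simps)
  qed measurable
  define lhs where "lhs y = (e + (cmod (A + B y))\<^sup>2) powr m - (e + (cmod A)\<^sup>2) powr m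
    - 2 * m * (e + (cmod A)\<^sup>2) powr (m - 1) * Re (cnj A * B y) - quad e m A (l y)" for y
  \<comment> \<open>\<open>54 = 2 * 3^3\<close> is the Taylor remainder for an increment of at most
    three times \<open>sqrt d * M * W y\<close>; \<open>15 = 3 * (3 + 2)\<close> comes from
    exchanging the increment for its linear part in \<open>quad\<close>.\<close>
  define K where "K = (54 * e powr (m - 3/2) + 15 * e powr (m - 1)) * (d * sqrt d * M^3)"
  have pt: "\<bar>lhs y\<bar> \<le> K * W y ^ 3" for y
  proof -
    have q0: "0 \<le> sqrt d * M * W y" using d M W1[of y] by auto
    have "\<bar>(e + (cmod (A + B y))\<^sup>2) powr m - (e + (cmod A)\<^sup>2) powr m
      - 2 * m * (e + (cmod A)\<^sup>2) powr (m - 1) * Re (cnj A * B y) - quad e m A (B y)\<bar> \<le> 2 * e powr (m - 3/2) * (cmod (B y))^3"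
      by (rule taylor_power[OF e m])
    also have "\<dots> \<le> 2 * e powr (m - 3/2) * (3 * (sqrt d * M * W y))^3"
      by (intro mult_left_mono power_mono B_le) auto
    also have "(3 * (sqrt d * M * W y))^3 = 27 * ((sqrt d)^3 * M^3 * W y^3)"
      by (simp add: power_mult_distrib)
    also have "(sqrt d)^3 = d * sqrt d" using d by (simp add: power3_eq_cube)
    finally have 1: "\<bar>(e + (cmod (A + B y))\<^sup>2) powr m - (e + (cmod A)\<^sup>2) powr m
      - 2 * m * (e + (cmod A)\<^sup>2) powr (m - 1) * Re (cnj A * B y) - quad e m A (B y)\<bar> \<le> 54 * e powr (m - 3/2) * (d * sqrt d * M^3 * W y^3)"
      by simp
    have "\<bar>quad e m A (B y) - quad e m A (l y)\<bar> \<le> 3 * e powr (m - 1) * (cmod (B y - l y) * (cmod (B y) + cmod (l y)))"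
      by (rule quad_diff_le[OF e m])
    also have "\<dots> \<le> 3 * e powr (m - 1) * ((d * M * W y) * (3 * (sqrt d * M * W y) + 2 * (sqrt d * M * W y)))"
      unfolding Bl using Gle[of y] d M W1[of y]
      by (intro mult_left_mono mult_mono add_mono B_le l_le) (auto simp: W_def)
    also have "\<dots> = 15 * e powr (m - 1) * (d * sqrt d * (M\<^sup>2 * (W y)\<^sup>2))"
      by (simp add: power2_eq_square)
    also have "\<dots> \<le> 15 * e powr (m - 1) * (d * sqrt d * (M^3 * W y^3))"
      using d M W1[of y] by (intro mult_left_mono mult_mono power_increasing) auto
    finally have 2: "\<bar>quad e m A (B y) - quad e m A (l y)\<bar> \<le> 15 * e powr (m - 1) * (d * sqrt d * M^3 * W y^3)" 
      by (simp add: mult_ac)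
    have "\<bar>lhs y\<bar> \<le> 54 * e powr (m - 3/2) * (d * sqrt d * M^3 * W y^3) + 15 * e powr (m - 1) * (d * sqrt d * M^3 * W y^3)"
      using 1 2 unfolding lhs_def by linarith
    then show ?thesis by (simp add: K_def algebra_simps)
  qed
  have iRe: "integrable (gauss 1) (\<lambda>y. Re (cnj A * B y))" "(\<integral>y. Re (cnj A * B y) \<partial>gauss 1) = Re (cnj A * (\<integral>y. G y \<partial>gauss 1))"
    using int_B by (simp_all add: integral_Re del: times_complex.sel)
  have iq: "integrable (gauss 1) (\<lambda>y. quad e m A (l y))"
    unfolding l_def by (rule integral_quad)
  have int_lhs: "integrable (gauss 1) lhs" 
    unfolding lhs_def[abs_def]
    by (intro Bochner_Integration.integrable_diff 1 iq integrable_mult_right iRe(1)) simp_all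
  have "(\<integral>y. lhs y \<partial>gauss 1) = (\<integral>y. (e + (cmod (A + B y))\<^sup>2) powr m \<partial>gauss 1) - (e + (cmod A)\<^sup>2) powr m
      - 2 * m * (e + (cmod A)\<^sup>2) powr (m - 1) * Re (cnj A * (\<integral>y. G y \<partial>gauss 1))
      - (\<integral>y. quad e m A (cip y a + cnj (cip y b)) \<partial>gauss 1)"
    unfolding lhs_def iRe(2)[symmetric] using 1 iq iRe(1) prob_space
    by (simp add: l_def del: times_complex.sel)
  moreover have "\<bar>\<integral>y. lhs y \<partial>gauss 1\<bar> \<le> (\<integral>y. K * W y ^ 3 \<partial>gauss 1)"
    unfolding real_norm_def[symmetric]
    by (rule norm_integral_le_integral) (use int_lhs W3 pt in simp_all)
  ultimately show ?thesis2
    using W3 by (simp add: K_def)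
qed

text \<open>Both integrals are expanded around the same \<open>A\<close>. The zeroth-order terms
  agree, the first-order terms agree by \<open>mean\<close>, and the second-order terms are ordered
  by \<open>integral_quad_le\<close>. The two remainders account for the factor 2.\<close>

lemma one_step:
  fixes G H :: "complex ^ 'n \<Rightarrow> complex" and a b :: "complex ^ 'n"
  assumes e: "0 < e" and m: "1 / 2 < m" "m \<le> 1" and r: "0 \<le> r" "r \<le> 1" "r\<^sup>2 = (2 * m - 1) / m\<^sup>2"
    and d: "0 \<le> d" "d \<le> 1" and M: "1 \<le> M"
    and a: "norm a \<le> sqrt d * M" and b: "norm b \<le> sqrt d * M"
    and G[measurable]: "G \<in> borel_measurable borel" 
    and Gle: "\<And>y. cmod (G y) \<le> d * M * exp (2/7 * (norm y)\<^sup>2)"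
    and H[measurable]: "H \<in> borel_measurable borel" 
    and Hle: "\<And>y. cmod (H y) \<le> d * M * exp (2/7 * (norm y)\<^sup>2)"
    and mean: "(\<integral>y. H y \<partial>gauss 1) = (\<integral>y. G y \<partial>gauss 1)"
  shows "(\<integral>y. (e + (cmod (A + (of_real r * cip y a + H y)))\<^sup>2) powr m \<partial>gauss 1)
    \<le> (\<integral>y. (e + (cmod (A + (cip y a + cnj (cip y b) + G y)))\<^sup>2) powr m \<partial>gauss 1)
     + 2 * ((54 * e powr (m - 3/2) + 15 * e powr (m - 1)) * (d * sqrt d * M^3) 
        * (\<integral>y. exp (6/7 * (norm (y :: complex ^ 'n))\<^sup>2) \<partial>gauss 1))"
proof -
  have m0: "0 < m" using m by simp
  have ra: "norm (r *\<^sub>R a) \<le> sqrt d * M"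
  proof -
    have "r * norm a \<le> 1 * norm a" using r by (intro mult_right_mono) auto
    then show ?thesis using a r by simp
  qed
  have z: "norm (0 :: complex ^ 'n) \<le> sqrt d * M" using d M by simp
  have eq: "of_real r * cip y a + H y = cip y (r *\<^sub>R a) + cnj (cip y 0) + H y" for y
    by (simp add: cip_simps)
  note 1 = integral_expansion(2)[OF e m0 m(2) d M ra z H Hle, of A]
  note 2 = integral_expansion(2)[OF e m0 m(2) d M a b G Gle, of A]
  show ?thesis
    unfolding eq using abs_le_D1[OF 1[unfolded mean]] abs_le_D2[OF 2] integral_quad_le[OF e m r(3), of A a b] by linarith
qed

section \<open>Gaussian smoothing\<close>

lemma gauss_dens_diff:
  "gauss_dens 1 (v - h) = gauss_dens 1 v * exp (2 * inner h v - (norm h)\<^sup>2)"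
proof -
  have "- 1 * (norm (v - h))\<^sup>2 = - 1 * (norm v)\<^sup>2 + (2 * inner h v - (norm h)\<^sup>2)"
    by (simp add: power2_norm_eq_inner inner_diff_left inner_diff_right inner_commute)
  then show ?thesis unfolding gauss_dens_def by (simp only: exp_add mult.assoc)
qed

text \<open>The translation is moved from \<open>V\<close> to the density, so that regularity in
  \<open>h\<close> can be had without regularity of \<open>V\<close>.\<close>

lemma gauss_shift:
  fixes V :: "complex ^ 'n \<Rightarrow> complex"
  assumes [measurable]: "V \<in> borel_measurable borel"
  shows "(\<integral>v. V (v + h) \<partial>gauss 1) = (\<integral>v. V v * of_real (exp (2 * inner h v - (norm h)\<^sup>2)) \<partial>gauss 1)"
proof -
  have "(\<integral>v. V (v + h) \<partial>gauss 1) = (\<integral>v. gauss_dens 1 v *\<^sub>R V (v + h) \<partial>lborel)"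
    by (rule integral_gauss) auto
  also have "\<dots> = (\<integral>v. gauss_dens 1 (h + v - h) *\<^sub>R V (h + v) \<partial>lborel)"
    by (simp add: add.commute)
  also have "\<dots> = (\<integral>v. gauss_dens 1 (v - h) *\<^sub>R V v \<partial>distr lborel borel ((+) h))"
    by (rule integral_distr[symmetric]) auto
  also have "\<dots> = (\<integral>v. gauss_dens 1 v *\<^sub>R (V v * of_real (exp (2 * inner h v - (norm h)\<^sup>2))) \<partial>lborel)"
    unfolding lborel_distr_plus gauss_dens_diff by (simp add: scaleR_conv_of_real mult_ac)
  also have "\<dots> = (\<integral>v. V v * of_real (exp (2 * inner h v - (norm h)\<^sup>2)) \<partial>gauss 1)"
    by (rule integral_gauss[symmetric]) auto
  finally show ?thesis .
qed

lemma integrable_dominated: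
  fixes f :: "'a \<Rightarrow> 'b::{banach, second_countable_topology}"
  assumes "integrable M g" "f \<in> borel_measurable M" "\<And>x. norm (f x) \<le> g x"
  shows "integrable M f"
  by (rule Bochner_Integration.integrable_bound[OF assms(1,2)])
     (auto intro!: AE_I2 order_trans[OF assms(3)])

lemma norm_le_exp: "norm y \<le> 2 * exp (1/16 * (norm y)\<^sup>2)"
  using le_exp_square[of "norm y / 2"] by (simp add: power_divide)

lemma integrable_norm_gauss: "integrable (gauss 1) (\<lambda>y :: complex ^ 'n. norm y)"
  by (rule integrable_gauss_bound[where C = 2 and c = "1/16"]) (use norm_le_exp in auto)

lemma integrable_exp_norm: "integrable (gauss 1) (\<lambda>y :: complex ^ 'n. exp (K * norm y))"
proof (rule integrable_gauss_bound)
  fix y :: "complex ^ 'n"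
  show "norm (exp (K * norm y)) \<le> exp (K\<^sup>2 / (4 * (1/2))) * exp (1/2 * (norm y)\<^sup>2)"
    using exp_mult_le[of "1/2" K "norm y"] by simp
qed auto

text \<open>The summand \<open>1\<close> on the right accounts for the
  \<open>(norm h)\<^sup>2\<close> in the exponent, itself of second order. The rest is the Taylor
  remainder of \<open>exp\<close>, whose polynomial factor is absorbed into a second
  exponential.\<close>

lemma exp_remainder:
  fixes h v :: "complex ^ 'n"
  assumes h: "norm h \<le> 1"
  shows "\<bar>exp (2 * inner h v - (norm h)\<^sup>2) - 1 - 2 * inner h v\<bar> \<le> (norm h)\<^sup>2 * (1 + exp (4 * norm v + 2) * 2)"
proof -
  define X where "X = 2 * inner h v - (norm h)\<^sup>2"
  have X: "\<bar>X\<bar> \<le> norm h * (2 * norm v + 1)"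
  proof -
    have "\<bar>X\<bar> \<le> 2 * \<bar>inner h v\<bar> + (norm h)\<^sup>2" unfolding X_def using zero_le_power2[of "norm h"] by linarith
    also have "\<dots> \<le> 2 * (norm h * norm v) + norm h * 1"
      unfolding power2_eq_square using h by (intro add_mono mult_left_mono Cauchy_Schwarz_ineq2) auto
    finally show ?thesis by (simp add: algebra_simps)
  qed
  have X1: "\<bar>X\<bar> \<le> 2 * norm v + 1"
    using X mult_right_mono[OF h, of "2 * norm v + 1"] by simp
  have "\<bar>exp X - 1 - X\<bar> \<le> X\<^sup>2 * exp \<bar>X\<bar>"
    using Taylor_exp_field[of X 1] by (simp add: mult.commute power2_eq_square diff_diff_eq)
  also have "\<dots> \<le> (norm h * (2 * norm v + 1))\<^sup>2 * exp (2 * norm v + 1)"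
    using power_mono[OF X, of 2] X1 by (intro mult_mono) auto
  also have "\<dots> = (norm h)\<^sup>2 * ((2 * norm v + 1)\<^sup>2 * exp (2 * norm v + 1))"
    by (simp add: power_mult_distrib)
  also have "\<dots> \<le> (norm h)\<^sup>2 * (2 * exp (2 * norm v + 1) * exp (2 * norm v + 1))"
  proof (intro mult_left_mono mult_right_mono)
    show "(2 * norm v + 1)\<^sup>2 \<le> 2 * exp (2 * norm v + 1)"
      using exp_lower_Taylor_quadratic[of "2 * norm v + 1"] norm_ge_zero[of v] by linarith
  qed auto
  also have "2 * exp (2 * norm v + 1) * exp (2 * norm v + 1) = exp (4 * norm v + 2) * 2"
    by (simp add: mult_exp_exp)
  finally have "\<bar>exp X - 1 - X\<bar> \<le> (norm h)\<^sup>2 * (exp (4 * norm v + 2) * 2)" .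
  moreover have "exp X - 1 - 2 * inner h v = (exp X - 1 - X) - (norm h)\<^sup>2" by (simp add: X_def)
  ultimately show ?thesis unfolding X_def[symmetric] distrib_left using zero_le_power2[of "norm h"] by linarith
qed

text \<open>Gaussian averages of a merely bounded function have a first-order expansion, because the
  derivatives fall on the density. The constant \<open>c\<close> depends on the dimension alone;
  without this uniformity the errors of many steps could not be summed.\<close>

lemma gauss_taylor:
  obtains c :: real where "1 \<le> c"
    "\<And>V M. V \<in> borel_measurable borel \<Longrightarrow> (\<And>v :: complex ^ 'n. cmod (V v) \<le> M) \<Longrightarrow>
      \<exists>a b. norm a \<le> c * M \<and> norm b \<le> c * M \<and>
        (\<forall>h. cmod ((\<integral>v. V (v + h) \<partial>gauss 1) - (\<integral>v. V v \<partial>gauss 1) - cip h a - cnj (cip h b)) \<le> c * M * (norm h)\<^sup>2)"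
proof
  interpret prob_space "gauss 1 :: (complex ^ 'n) measure" by (rule prob_space_gauss) simp
  define c1 where "c1 = (\<integral>y. norm (y :: complex ^ 'n) \<partial>gauss 1)"
  define c2 where "c2 = (\<integral>y. 1 + exp (4 * norm (y :: complex ^ 'n) + 2) * 2 \<partial>gauss 1)"
  have c0: "0 \<le> c1" "0 \<le> c2" by (auto simp: c1_def c2_def intro!: integral_nonneg_AE add_nonneg_nonneg)
  define c where "c = 2 + 2 * c1 + c2"
  show "1 \<le> c" using c0 by (simp add: c_def)
  fix V :: "complex ^ 'n \<Rightarrow> complex" and M
  assume V[measurable]: "V \<in> borel_measurable borel" and le: "\<And>v. cmod (V v) \<le> M"
  have M0: "0 \<le> M" using le[of 0] norm_ge_zero order_trans by blast
  \<comment> \<open>The linear term \<open>2 * inner h v\<close> of the shifted density is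
    \<open>cip h v + cnj (cip h v)\<close>; its two halves yield the holomorphic gradient
    \<open>a\<close> and the antiholomorphic gradient \<open>b\<close>. The conjugate on
    \<open>V\<close> compensates for conjugate-linearity in the second slot of
    \<open>cip\<close>.\<close>
  define a where "a = (\<integral>v. cnj (V v) *s v \<partial>gauss 1)"
  define b where "b = (\<integral>v. V v *s v \<partial>gauss 1)"
  have vsm[measurable (raw)]: "(\<lambda>v. U v *s v) \<in> borel_measurable borel" if [measurable]: "U \<in> borel_measurable borel" for U :: "complex ^ 'n \<Rightarrow> complex"
    by (rule borel_measurable_continuous_Pair[of U _ "\<lambda>v. v"]) (auto intro!: continuous_intros that)
  have iM: "integrable (gauss 1) (\<lambda>v :: complex ^ 'n. M * norm v)"
    by (rule integrable_mult_right, rule integrable_norm_gauss)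
  have int: "integrable (gauss 1) (\<lambda>v. U v *s v)" "norm (\<integral>v. U v *s v \<partial>gauss 1) \<le> M * c1"
    if [measurable]: "U \<in> borel_measurable borel" and "\<And>v. cmod (U v) \<le> M" for U :: "complex ^ 'n \<Rightarrow> complex"
  proof -
    have *: "norm (U v *s v) \<le> M * norm v" for v
      using that(2)[of v] by (simp add: norm_vector_scalar_mult mult_right_mono)
    show i: "integrable (gauss 1) (\<lambda>v. U v *s v)"
      by (rule integrable_dominated[OF iM _ *]) (use vsm[OF that(1)] in simp)
    have "norm (\<integral>v. U v *s v \<partial>gauss 1) \<le> (\<integral>v. M * norm v \<partial>(gauss 1 :: (complex ^ 'n) measure))"
      by (rule norm_integral_le_integral[OF i iM *])
    then show "norm (\<integral>v. U v *s v \<partial>gauss 1) \<le> M * c1" by (simp add: c1_def)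
  qed
  have ab: "norm a \<le> M * c1" "norm b \<le> M * c1" unfolding a_def b_def using le by (intro int; simp)+
  have "M * c1 \<le> c * M" using M0 c0 by (simp add: c_def algebra_simps)
  with ab have "norm a \<le> c * M" "norm b \<le> c * M" by auto
  moreover have "cmod ((\<integral>v. V (v + h) \<partial>gauss 1) - (\<integral>v. V v \<partial>gauss 1) - cip h a - cnj (cip h b)) \<le> c * M * (norm h)\<^sup>2" for h
  proof -
    have bl: "bounded_linear (\<lambda>w. cip h w)"
      by (rule bounded_bilinear.bounded_linear_right[OF bounded_bilinear_cip])
    have ia: "integrable (gauss 1) (\<lambda>v. V v * cip h v)" "cip h a = (\<integral>v. V v * cip h v \<partial>gauss 1)"
      using integral_bounded_linear[OF bl int(1)[of "\<lambda>v. cnj (V v)"]] integrable_bounded_linear[OF bl int(1)[of "\<lambda>v. cnj (V v)"]] le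
      by (simp_all add: a_def cip_simps)
    have ib: "integrable (gauss 1) (\<lambda>v. V v * cnj (cip h v))" "cnj (cip h b) = (\<integral>v. V v * cnj (cip h v) \<partial>gauss 1)"
    proof -
      have *: "integrable (gauss 1) (\<lambda>v. cnj (V v) * cip h v)" "cip h b = (\<integral>v. cnj (V v) * cip h v \<partial>gauss 1)"
        using integral_bounded_linear[OF bl int(1)[of "\<lambda>v. V v"]] integrable_bounded_linear[OF bl int(1)[of "\<lambda>v. V v"]] le
        by (simp_all add: b_def cip_simps)
      show "integrable (gauss 1) (\<lambda>v. V v * cnj (cip h v))"
        using integrable_cnj[OF *(1)] by simp
      show "cnj (cip h b) = (\<integral>v. V v * cnj (cip h v) \<partial>gauss 1)"
        unfolding *(2) using Bochner_Integration.integral_cnj[of "gauss 1" "\<lambda>v. cnj (V v) * cip h v"]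
        by (simp only: complex_cnj_mult complex_cnj_cnj)
    qed
    have iV: "integrable (gauss 1) V" 
      by (rule integrable_const_bound[of _ M]) (use le in auto)
    have iVh: "integrable (gauss 1) (\<lambda>v. V (v + h))"
      by (rule integrable_const_bound[of _ M]) (use le in auto)
    have lin: "cip h v + cnj (cip h v) = of_real (2 * inner h v)" for v
      by (simp add: complex_add_cnj Re_cip)
    show ?thesis
    proof (cases "norm h \<le> 1")
      case True
      have i1: "integrable (gauss 1) (\<lambda>v. V v * of_real (exp (2 * inner h v - (norm h)\<^sup>2)))"
      proof (rule Bochner_Integration.integrable_bound)
        show "integrable (gauss 1) (\<lambda>v :: complex ^ 'n. M * exp (2 * norm v))"
          by (rule integrable_mult_right, rule integrable_exp_norm)
        have "2 * inner h v - (norm h)\<^sup>2 \<le> 2 * norm v" for v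
          using norm_cauchy_schwarz[of h v] mult_left_le_one_le[OF norm_ge_zero norm_ge_zero True, of v] zero_le_power2[of "norm h"] 
          by linarith
        then have "cmod (V v * of_real (exp (2 * inner h v - (norm h)\<^sup>2))) \<le> M * exp (2 * norm v)" for v
          unfolding norm_mult using le M0 by (intro mult_mono) auto
        then show "AE v in gauss 1. cmod (V v * of_real (exp (2 * inner h v - (norm h)\<^sup>2))) \<le> norm (M * exp (2 * norm v))"
          using M0 by simp
      qed measurable
      have "(\<integral>v. V (v + h) \<partial>gauss 1) - (\<integral>v. V v \<partial>gauss 1) - cip h a - cnj (cip h b)
        = (\<integral>v. V v * of_real (exp (2 * inner h v - (norm h)\<^sup>2)) - V v - V v * cip h v - V v * cnj (cip h v) \<partial>gauss 1)"
        using i1 iV ia ib by (simp add: gauss_shift[OF V])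
      also have "\<dots> = (\<integral>v. V v * of_real (exp (2 * inner h v - (norm h)\<^sup>2) - 1 - 2 * inner h v) \<partial>gauss 1)"
        by (rule Bochner_Integration.integral_cong[OF refl])
          (simp add: lin[symmetric] right_diff_distrib distrib_left del: of_real_mult)
      finally have eq: "(\<integral>v. V (v + h) \<partial>gauss 1) - (\<integral>v. V v \<partial>gauss 1) - cip h a - cnj (cip h b)
        = (\<integral>v. V v * of_real (exp (2 * inner h v - (norm h)\<^sup>2) - 1 - 2 * inner h v) \<partial>gauss 1)" .
      have i2: "integrable (gauss 1) (\<lambda>v :: complex ^ 'n. M * ((norm h)\<^sup>2 * (1 + exp (4 * norm v + 2) * 2)))"
        unfolding exp_add using integrable_exp_norm[of 4, where 'n = 'n] by simp
      have le2: "cmod (V v * of_real (exp (2 * inner h v - (norm h)\<^sup>2) - 1 - 2 * inner h v)) \<le> M * ((norm h)\<^sup>2 * (1 + exp (4 * norm v + 2) * 2))" for v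
        unfolding norm_mult norm_of_real using le M0 by (intro mult_mono exp_remainder True) auto
      have "cmod ((\<integral>v. V (v + h) \<partial>gauss 1) - (\<integral>v. V v \<partial>gauss 1) - cip h a - cnj (cip h b))
        \<le> (\<integral>v. M * ((norm h)\<^sup>2 * (1 + exp (4 * norm v + 2) * 2)) \<partial>(gauss 1 :: (complex ^ 'n) measure))"
        unfolding eq
        by (rule norm_integral_le_integral[OF _ i2 le2])
          (rule integrable_dominated[OF i2 _ le2], simp)
      also have "\<dots> = M * (norm h)\<^sup>2 * c2"
        by (simp add: c2_def)
      also have "\<dots> \<le> c * M * (norm h)\<^sup>2"
        using M0 c0 mult_right_mono[of c2 c "M * (norm h)\<^sup>2"] by (simp add: c_def mult_ac)
      finally show ?thesis .
    next
      case False
      have b1: "cmod (\<integral>v. V v \<partial>gauss 1) \<le> M" "cmod (\<integral>v. V (v + h) \<partial>gauss 1) \<le> M"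
        using norm_integral_le_integral[OF iV, of "\<lambda>_. M"] norm_integral_le_integral[OF iVh, of "\<lambda>_. M"] le prob_space by simp_all
      have b2: "cmod (cip h a) \<le> norm h * (M * c1)" "cmod (cnj (cip h b)) \<le> norm h * (M * c1)"
        using norm_cip_le[of h a] norm_cip_le[of h b] ab mult_left_mono[OF ab(1), of "norm h"] mult_left_mono[OF ab(2), of "norm h"]
        by (simp_all)
      have "cmod (x - y - z - w) \<le> cmod x + cmod y + cmod z + cmod w" for x y z w :: complex
        using norm_triangle_ineq4[of "x - y - z" w] norm_triangle_ineq4[of "x - y" z] norm_triangle_ineq4[of x y] by linarith
      from this[of "\<integral>v. V (v + h) \<partial>gauss 1" "\<integral>v. V v \<partial>gauss 1" "cip h a" "cnj (cip h b)"]
      have "cmod ((\<integral>v. V (v + h) \<partial>gauss 1) - (\<integral>v. V v \<partial>gauss 1) - cip h a - cnj (cip h b))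
        \<le> M + M + norm h * (M * c1) + norm h * (M * c1)"
        using b1 b2 by linarith
      also have "\<dots> = 2 * M * 1 + 2 * (M * c1) * norm h" by simp
      also have "\<dots> \<le> 2 * M * (norm h)\<^sup>2 + 2 * (M * c1) * (norm h)\<^sup>2"
        using False M0 c0 self_le_power[of "norm h" 2] one_le_power[of "norm h" 2] by (intro add_mono mult_left_mono) auto
      also have "\<dots> \<le> c * M * (norm h)\<^sup>2"
        using M0 c0 by (simp add: c_def algebra_simps)
      finally show ?thesis .
    qed
  qed
  ultimately show "\<exists>a b. norm a \<le> c * M \<and> norm b \<le> c * M \<and>
        (\<forall>h. cmod ((\<integral>v. V (v + h) \<partial>gauss 1) - (\<integral>v. V v \<partial>gauss 1) - cip h a - cnj (cip h b)) \<le> c * M * (norm h)\<^sup>2)"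
    by blast
qed

section \<open>Products of Gaussians and rotations\<close>

lemma pair_sigma_finite_gauss: "pair_sigma_finite (gauss 1 :: (complex ^ 'n) measure) (gauss 1 :: (complex ^ 'n) measure)"
proof -
  interpret prob_space "gauss 1 :: (complex ^ 'n) measure" by (rule prob_space_gauss) simp
  show ?thesis ..
qed

lemma borel_measurable_gauss_integral[measurable (raw)]:
  fixes f :: "'a \<Rightarrow> complex ^ 'n \<Rightarrow> 'b::{banach, second_countable_topology}"
  assumes "case_prod f \<in> borel_measurable (N \<Otimes>\<^sub>M borel)"
  shows "(\<lambda>x. \<integral>y. f x y \<partial>gauss 1) \<in> borel_measurable N"
proof -
  interpret prob_space "gauss 1 :: (complex ^ 'n) measure" by (rule prob_space_gauss) simp
  show ?thesis
    by (rule borel_measurable_lebesgue_integral) (use assms in \<open>simp cong: measurable_cong_sets sets_pair_measure_cong\<close>)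
qed

lemma borel_measurable_gauss_nn_integral[measurable (raw)]:
  fixes f :: "'a \<Rightarrow> complex ^ 'n \<Rightarrow> ennreal"
  assumes "case_prod f \<in> borel_measurable (N \<Otimes>\<^sub>M borel)"
  shows "(\<lambda>x. \<integral>\<^sup>+y. f x y \<partial>gauss 1) \<in> borel_measurable N"
proof -
  interpret prob_space "gauss 1 :: (complex ^ 'n) measure" by (rule prob_space_gauss) simp
  show ?thesis
    by (rule borel_measurable_nn_integral) (use assms in \<open>simp cong: measurable_cong_sets sets_pair_measure_cong\<close>)
qed

lemma integrable_pair_gauss_bound:
  fixes f :: "(complex ^ 'n) \<times> (complex ^ 'n) \<Rightarrow> 'b::{banach, second_countable_topology}"
  assumes f[measurable]: "f \<in> borel_measurable (borel \<Otimes>\<^sub>M borel)" and c: "c < 1" "c' < 1"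
    and le: "\<And>x y. norm (f (x, y)) \<le> C * exp (c * (norm x)\<^sup>2) * exp (c' * (norm y)\<^sup>2)"
  shows "integrable (gauss 1 \<Otimes>\<^sub>M gauss 1) f"
proof -
  interpret pair_sigma_finite "gauss 1 :: (complex ^ 'n) measure" "gauss 1 :: (complex ^ 'n) measure"
    by (rule pair_sigma_finite_gauss)
  have m: "(\<lambda>y. f (x, y)) \<in> borel_measurable borel" for x by measurable
  have i: "integrable (gauss 1) (\<lambda>y. f (x, y))" for x
    by (rule integrable_gauss_bound[OF m _ c(2) le]) simp
  show ?thesis
  proof (rule Fubini_integrable)
    show "integrable (gauss 1) (\<lambda>x. \<integral>y. norm (f (x, y)) \<partial>gauss 1)"
    proof (rule integrable_gauss_bound[OF _ _ c(1)])
      fix x :: "complex ^ 'n"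
      have "(\<integral>y. norm (f (x, y)) \<partial>gauss 1) \<le> (\<integral>y. C * exp (c * (norm x)\<^sup>2) * exp (c' * (norm (y :: complex ^ 'n))\<^sup>2) \<partial>gauss 1)"
      proof (rule integral_mono)
        show "integrable (gauss 1) (\<lambda>y :: complex ^ 'n. C * exp (c * (norm x)\<^sup>2) * exp (c' * (norm y)\<^sup>2))"
          by (rule integrable_mult_right, rule integrable_exp_norm_square) (use c in simp_all)
      qed (use i le in auto)
      then show "norm (\<integral>y. norm (f (x, y)) \<partial>gauss 1) \<le> C * (\<integral>y. exp (c' * (norm (y :: complex ^ 'n))\<^sup>2) \<partial>gauss 1) * exp (c * (norm x)\<^sup>2)"
        by (simp add: mult_ac)
    qed simp_all
  qed (use i in \<open>simp_all cong: measurable_cong_sets sets_pair_measure_cong\<close>)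
qed

text \<open>A rotation mixing two copies of the space, with \<open>a\<close> and \<open>b\<close> in
  the roles of cosine and sine.\<close>

definition rot :: "real \<Rightarrow> real \<Rightarrow> ('a::real_vector) \<times> 'a \<Rightarrow> 'a \<times> 'a" where
  "rot a b p = (a *\<^sub>R fst p + b *\<^sub>R snd p, - b *\<^sub>R fst p + a *\<^sub>R snd p)"

lemma linear_rot: "linear (rot a b)"
  by (rule linearI) (auto simp: rot_def algebra_simps)

lemma norm_rot:
  fixes p :: "'a::real_inner \<times> 'a"
  assumes "a\<^sup>2 + b\<^sup>2 = 1"
  shows "norm (rot a b p) = norm p"
proof -
  have "(norm (a *\<^sub>R x + b *\<^sub>R y))\<^sup>2 + (norm (- b *\<^sub>R x + a *\<^sub>R y))\<^sup>2 = (a\<^sup>2 + b\<^sup>2) * ((norm x)\<^sup>2 + (norm y)\<^sup>2)" for x y :: 'a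
    unfolding power2_norm_eq_inner
    by (simp add: inner_add_left inner_add_right inner_commute power2_eq_square algebra_simps)
  then show ?thesis using assms by (simp add: rot_def norm_prod_def)
qed

lemma distr_gauss_rot:
  assumes "a\<^sup>2 + b\<^sup>2 = 1"
  shows "distr (gauss 1 \<Otimes>\<^sub>M gauss 1) borel (rot a b) = (gauss 1 \<Otimes>\<^sub>M gauss 1 :: ((complex ^ 'n) \<times> (complex ^ 'n)) measure)"
  by (rule distr_gauss_pair_isometry) (auto simp: linear_rot norm_rot assms)

lemma borel_measurable_rot: "rot a b \<in> borel_measurable (gauss 1 \<Otimes>\<^sub>M (gauss 1 :: (complex ^ 'n) measure))"
proof -
  have "rot a b \<in> borel_measurable (borel :: ((complex ^ 'n) \<times> (complex ^ 'n)) measure)"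
    unfolding rot_def[abs_def] by (intro borel_measurable_continuous_onI continuous_intros)
  then show ?thesis
    unfolding borel_prod[symmetric] by (simp cong: measurable_cong_sets sets_pair_measure_cong)
qed

text \<open>The rotation with coefficients \<open>a / c\<close> and \<open>b / c\<close> turns the
  combination into \<open>c\<close> times the first coordinate, and the product measure does not
  notice.\<close>

lemma nn_integral_gauss_sum:
  fixes f :: "complex ^ 'n \<Rightarrow> ennreal"
  assumes [measurable]: "f \<in> borel_measurable borel" and abc: "a\<^sup>2 + b\<^sup>2 = c\<^sup>2"
  shows "(\<integral>\<^sup>+w. \<integral>\<^sup>+y. f (a *\<^sub>R w + b *\<^sub>R y) \<partial>gauss 1 \<partial>gauss 1) = (\<integral>\<^sup>+z. f (c *\<^sub>R z) \<partial>gauss 1)"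
proof -
  interpret prob_space "gauss 1 :: (complex ^ 'n) measure" by (rule prob_space_gauss) simp
  have one: "emeasure (gauss 1 :: (complex ^ 'n) measure) UNIV = 1" using emeasure_space_1 by simp
  show ?thesis
  proof (cases "c = 0")
    case True
    then have "a = 0" "b = 0" using abc by (simp_all add: sum_power2_eq_zero_iff)
    then show ?thesis using True one by simp
  next
    case False
    have ab: "(a / c)\<^sup>2 + (b / c)\<^sup>2 = 1" using abc False by (simp add: power_divide flip: add_divide_distrib)
    have meas: "(\<lambda>p. f (c *\<^sub>R fst p)) \<in> borel_measurable (borel :: ((complex ^ 'n) \<times> (complex ^ 'n)) measure)"
      unfolding borel_prod[symmetric] by measurable
    have "(\<integral>\<^sup>+w. \<integral>\<^sup>+y. f (a *\<^sub>R w + b *\<^sub>R y) \<partial>gauss 1 \<partial>gauss 1)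
      = (\<integral>\<^sup>+p. f (c *\<^sub>R fst (rot (a / c) (b / c) p)) \<partial>(gauss 1 \<Otimes>\<^sub>M gauss 1))"
      using False by (subst nn_integral_fst[symmetric]) (simp_all add: rot_def scaleR_add_right cong: measurable_cong_sets sets_pair_measure_cong)
    also have "\<dots> = (\<integral>\<^sup>+p. f (c *\<^sub>R fst p) \<partial>distr (gauss 1 \<Otimes>\<^sub>M gauss 1) borel (rot (a / c) (b / c)))"
      by (rule nn_integral_distr[symmetric, OF borel_measurable_rot]) (simp add: meas)
    also have "\<dots> = (\<integral>\<^sup>+w. \<integral>\<^sup>+y. f (c *\<^sub>R w) \<partial>(gauss 1 :: (complex ^ 'n) measure) \<partial>gauss 1)"
      unfolding distr_gauss_rot[OF ab]
      by (subst nn_integral_fst[symmetric]) (simp_all cong: measurable_cong_sets sets_pair_measure_cong)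
    finally show ?thesis using one by simp
  qed
qed

lemma le_mult_exp: "0 \<le> M \<Longrightarrow> 0 \<le> c \<Longrightarrow> M \<le> M * exp (c * x\<^sup>2)" for M c x :: real
  using mult_left_mono[of 1 "exp (c * x\<^sup>2)" M] by simp

section \<open>Action of the kernel on constants and linear forms\<close>

text \<open>\<open>ker r x y\<close> is the reproducing kernel at the point
  \<open>r *\<^sub>R x\<close>, so an integrable entire \<open>f\<close> is mapped to
  \<open>f (r *\<^sub>R x)\<close>; here \<open>f\<close> is constant.\<close>

lemma integral_ker_right: "(\<integral>y. ker r x y \<partial>gauss 1) = 1" if "0 \<le> r" "r \<le> 1" for x :: "complex ^ 'n"
  using reproducing[of "\<lambda>_. 1" 1 "r *\<^sub>R x"] integrable_ker[OF _ that, of "\<lambda>_. 1" 1 x]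
  by (simp add: entire_const ker_def cip_simps)

lemma integral_ker_cip: "(\<integral>y. cip y a * ker r x y \<partial>gauss 1) = of_real r * cip x a" 
  "integrable (gauss 1) (\<lambda>y. cip y a * ker r x y)" if r: "0 \<le> r" "r \<le> 1" for x :: "complex ^ 'n"
proof -
  show i: "integrable (gauss 1) (\<lambda>y. cip y a * ker r x y)"
  proof (rule integrable_ker[OF _ r])
    show "cmod (cip y a) \<le> (2 * norm a) * exp (1/16 * (norm y)\<^sup>2)" for y
      using norm_cip_le[of y a] mult_right_mono[OF norm_le_exp[of y], of "norm a"] by (simp add: mult_ac)
  qed auto
  then show "(\<integral>y. cip y a * ker r x y \<partial>gauss 1) = of_real r * cip x a"
    using reproducing[of "\<lambda>y. cip y a" 1 "r *\<^sub>R x"]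
    by (simp add: entire_cip ker_def cip_simps)
qed

lemma cnj_ker: "cnj (ker r x y) = ker r y x"
  by (simp add: ker_def exp_cnj cnj_cip)

lemma entire_ker: "entire (\<lambda>x. ker r x y)"
  unfolding ker_def by (rule entire_exp[OF entire_mult[OF entire_const entire_cip]])

text \<open>The conjugate of the integrand is holomorphic in \<open>y\<close> and vanishes at the
  origin. This is the source of the gradient \<open>0\<close> in the quadratic comparison.\<close>

lemma integral_ker_cnj_cip: "(\<integral>y. cnj (cip y b) * ker r x y \<partial>gauss 1) = 0" 
  "integrable (gauss 1) (\<lambda>y. cnj (cip y b) * ker r x y)" if r: "0 \<le> r" "r \<le> 1" for x :: "complex ^ 'n"
proof -
  show i: "integrable (gauss 1) (\<lambda>y. cnj (cip y b) * ker r x y)"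
  proof (rule integrable_ker[OF _ r])
    show "cmod (cnj (cip y b)) \<le> (2 * norm b) * exp (1/16 * (norm y)\<^sup>2)" for y
      using norm_cip_le[of y b] mult_right_mono[OF norm_le_exp[of y], of "norm b"] by (simp add: mult_ac)
  qed auto
  have eq: "cnj (cnj (cip y b) * ker r x y) = cip y b * ker r y x" for y by (simp add: cnj_ker)
  have "integrable (gauss 1) (\<lambda>y. cip y b * ker r y x)"
    using integrable_cnj[OF i] unfolding eq .
  then have "(\<integral>y. cip y b * ker r y x \<partial>gauss 1) = cip 0 b * ker r 0 x"
    by (rule gauss_mean_value[rotated]) (auto intro: entire_mult entire_cip entire_ker)
  then have "(\<integral>y. cnj (cnj (cip y b) * ker r x y) \<partial>gauss 1) = 0"
    unfolding eq by (simp add: cip_simps)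
  then show "(\<integral>y. cnj (cip y b) * ker r x y \<partial>gauss 1) = 0"
    unfolding Bochner_Integration.integral_cnj by simp
qed

text \<open>Follows from the Hermitian symmetry of the kernel. It is used to show that the operator
  preserves the Gaussian mean.\<close>

lemma integral_ker_left: "(\<integral>x. ker r x y \<partial>gauss 1) = 1" if "0 \<le> r" "r \<le> 1" for y :: "complex ^ 'n"
proof -
  have "(\<integral>x. cnj (ker r y x) \<partial>gauss 1) = 1"
    unfolding Bochner_Integration.integral_cnj integral_ker_right[OF that] by simp
  then show ?thesis by (simp only: cnj_ker)
qed

text \<open>By \<open>gauss_taylor\<close>, the averaged function is
  \<open>A + cip y a + cnj (cip y b) + G y\<close> with gradients of size \<open>sqrt d\<close> and
  \<open>G\<close> of size \<open>d\<close>; the kernel turns it into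
  \<open>A + r * cip x a + H x\<close>. These are the data of \<open>one_step\<close>. The constant
  \<open>K\<close> is fixed before \<open>V\<close>, \<open>M\<close> and \<open>d\<close>.\<close>

lemma mollified_step:
  assumes e: "0 < e" and m: "1 / 2 < m" "m \<le> 1" and r: "0 \<le> r" "r \<le> 1" "r\<^sup>2 = (2 * m - 1) / m\<^sup>2"
  obtains K :: real where "0 \<le> K"
    "\<And>V M d. V \<in> borel_measurable borel \<Longrightarrow> (\<And>v :: complex ^ 'n. cmod (V v) \<le> M) \<Longrightarrow> 1 \<le> M \<Longrightarrow> 0 \<le> d \<Longrightarrow> d \<le> 1 \<Longrightarrow>
      (\<integral>\<^sup>+x. ennreal ((e + (cmod (\<integral>y. (\<integral>v. V (v + sqrt d *\<^sub>R y) \<partial>gauss 1) * ker r x y \<partial>gauss 1))\<^sup>2) powr m) \<partial>gauss 1)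
      \<le> (\<integral>\<^sup>+y. ennreal ((e + (cmod (\<integral>v. V (v + sqrt d *\<^sub>R y) \<partial>gauss 1))\<^sup>2) powr m) \<partial>gauss 1) + ennreal (K * (d * sqrt d * M^3))"
proof -
  interpret prob_space "gauss 1 :: (complex ^ 'n) measure" by (rule prob_space_gauss) simp
  have m0: "0 < m" using m by simp
  obtain c where c: "1 \<le> c" and taylor: "\<And>V M. V \<in> borel_measurable borel \<Longrightarrow> (\<And>v :: complex ^ 'n. cmod (V v) \<le> M) \<Longrightarrow>
      \<exists>a b. norm a \<le> c * M \<and> norm b \<le> c * M \<and>
        (\<forall>h. cmod ((\<integral>v. V (v + h) \<partial>gauss 1) - (\<integral>v. V v \<partial>gauss 1) - cip h a - cnj (cip h b)) \<le> c * M * (norm h)\<^sup>2)"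
    by (rule gauss_taylor) blast
  \<comment> \<open>The factor \<open>16\<close> comes from bounding \<open>(norm y)\<^sup>2\<close>
    by \<open>16 * exp (1/16 * (norm y)\<^sup>2)\<close>, and \<open>cker\<close> from integrating
    such a bound against the kernel.\<close>
  define c' where "c' = c * 16 * cker TYPE('n)"
  have ck: "1 \<le> cker TYPE('n)" by (rule cker_ge_1)
  have cc': "c \<le> c'" "c * 16 \<le> c'"
    using mult_mono[OF order_refl ck, of "c * 16"] c by (auto simp: c'_def)
  with c have c'1: "1 \<le> c'" by simp
  define K where "K = 2 * ((54 * e powr (m - 3/2) + 15 * e powr (m - 1)) * c'^3
        * (\<integral>y. exp (6/7 * (norm (y :: complex ^ 'n))\<^sup>2) \<partial>gauss 1))"
  show ?thesis
  proof (rule that[of K])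
    show K0: "0 \<le> K" using c'1 by (auto simp: K_def intro!: mult_nonneg_nonneg integral_nonneg_AE)
    fix V :: "complex ^ 'n \<Rightarrow> complex" and M d :: real
    assume V[measurable]: "V \<in> borel_measurable borel" and Vle: "\<And>v. cmod (V v) \<le> M" and M: "1 \<le> M" and d: "0 \<le> d" "d \<le> 1"
    obtain a0 b0 where ab0: "norm a0 \<le> c * M" "norm b0 \<le> c * M"
      and rem: "\<And>h. cmod ((\<integral>v. V (v + h) \<partial>gauss 1) - (\<integral>v. V v \<partial>gauss 1) - cip h a0 - cnj (cip h b0)) \<le> c * M * (norm h)\<^sup>2"
      using taylor[OF V Vle] by blast
    define a where "a = sqrt d *\<^sub>R a0"
    define b where "b = sqrt d *\<^sub>R b0"
    define A where "A = (\<integral>v. V v \<partial>gauss 1)"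
    define F where "F y = (\<integral>v. V (v + sqrt d *\<^sub>R y) \<partial>gauss 1)" for y
    define G where "G y = F y - A - cip y a - cnj (cip y b)" for y
    define H where "H x = (\<integral>y. G y * ker r x y \<partial>gauss 1)" for x
    have F_meas[measurable]: "F \<in> borel_measurable borel" unfolding F_def[abs_def] by measurable
    have G_meas[measurable]: "G \<in> borel_measurable borel" unfolding G_def[abs_def] by measurable
    have H_meas[measurable]: "H \<in> borel_measurable borel" unfolding H_def[abs_def] by measurable
    have "c * M \<le> c' * M" using M cc' by (intro mult_right_mono) auto
    with ab0 have a: "norm a \<le> sqrt d * (c' * M)" and b: "norm b \<le> sqrt d * (c' * M)"
      using d by (auto simp: a_def b_def intro!: mult_left_mono)
    have Gsq: "cmod (G y) \<le> d * (c * M) * (norm y)\<^sup>2" for y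
      using rem[of "sqrt d *\<^sub>R y"] d by (simp add: G_def F_def A_def a_def b_def cip_simps power_mult_distrib mult_ac)
    have Gexp: "cmod (G y) \<le> (d * (c * 16 * M)) * exp (1/16 * (norm y)\<^sup>2)" for y
    proof -
      have "d * (c * M) * (norm y)\<^sup>2 \<le> d * (c * M) * (1 / (1/16) * exp (1/16 * (norm y)\<^sup>2))"
        using d c M by (intro mult_left_mono square_le_exp) auto
      with Gsq[of y] show ?thesis by (simp add: mult_ac)
    qed
    have dcM: "0 \<le> d * (c * 16 * M)" using d c M by simp
    have Gle: "cmod (G y) \<le> d * (c' * M) * exp (2/7 * (norm y)\<^sup>2)" for y
    proof -
      have "(d * (c * 16 * M)) * exp (1/16 * (norm y)\<^sup>2) \<le> (d * (c' * M)) * exp (2/7 * (norm y)\<^sup>2)"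
        using d c M cc' c'1 by (intro mult_mono mult_left_mono mult_right_mono) auto
      with Gexp[of y] show ?thesis by simp
    qed
    have Hle: "cmod (H x) \<le> d * (c' * M) * exp (2/7 * (norm x)\<^sup>2)" for x
      using norm_integral_ker_le[OF G_meas r(1,2) dcM Gexp, of x] by (simp add: H_def c'_def mult_ac)
    have iG: "integrable (gauss 1) (\<lambda>y. G y * ker r x y)" for x
      by (rule integrable_ker[OF G_meas r(1,2) dcM Gexp])
    \<comment> \<open>\<open>H\<close> is the transform of \<open>G\<close>, so this is preservation
      of the mean, by Fubini.\<close>
    have mean: "(\<integral>x. H x \<partial>gauss 1) = (\<integral>y. G y \<partial>gauss 1)"
    proof -
      interpret pair_sigma_finite "gauss 1 :: (complex ^ 'n) measure" "gauss 1 :: (complex ^ 'n) measure"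
        by (rule pair_sigma_finite_gauss)
      have "integrable (gauss 1 \<Otimes>\<^sub>M gauss 1) (\<lambda>(x, y). G y * ker r x y)"
      proof (rule integrable_pair_gauss_bound)
        fix x y :: "complex ^ 'n"
        have "cmod (G y * ker r x y) \<le> ((d * (c * 16 * M)) * exp (1/16 * (norm y)\<^sup>2)) * (exp (2/7 * (norm x)\<^sup>2) * exp (7/8 * (norm y)\<^sup>2))"
          unfolding norm_mult using dcM by (intro mult_mono Gexp norm_ker_le r) auto
        also have "\<dots> = (d * (c * 16 * M)) * exp (2/7 * (norm x)\<^sup>2) * (exp (1/16 * (norm y)\<^sup>2) * exp (7/8 * (norm y)\<^sup>2))"
          by simp
        also have "\<dots> = (d * (c * 16 * M)) * exp (2/7 * (norm x)\<^sup>2) * exp (15/16 * (norm y)\<^sup>2)"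
          unfolding mult_exp_exp by (simp add: field_simps)
        finally show "norm (case (x, y) of (x, y) \<Rightarrow> G y * ker r x y) \<le> (d * (c * 16 * M)) * exp (2/7 * (norm x)\<^sup>2) * exp (15/16 * (norm y)\<^sup>2)"
          by simp
      qed (simp_all add: split_beta')
      from Fubini_integral[OF this] show ?thesis
        by (simp add: H_def integral_ker_left r)
    qed
    have F_eq: "F y = A + (cip y a + cnj (cip y b) + G y)" for y by (simp add: G_def)
    have QF_eq: "(\<integral>y. F y * ker r x y \<partial>gauss 1) = A + (of_real r * cip x a + H x)" for x
    proof -
      have "(\<integral>y. F y * ker r x y \<partial>gauss 1) = (\<integral>y. A * ker r x y + (cip y a * ker r x y + cnj (cip y b) * ker r x y + G y * ker r x y) \<partial>gauss 1)"
        by (simp only: F_eq distrib_right)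
      moreover have "integrable (gauss 1) (\<lambda>y. A * ker r x y)"
        using integrable_ker[OF _ r(1,2), of "\<lambda>_. A" "cmod A" x] mult_left_mono[of 1 _ "cmod A"] by simp
      ultimately show ?thesis
        by (simp add: integral_ker_cip r integral_ker_cnj_cip iG H_def integral_ker_right)
    qed
    have c'M: "1 \<le> c' * M" using mult_mono[of 1 c' 1 M] c'1 M by simp
    note step = one_step[OF e m r d c'M a b G_meas Gle H_meas Hle mean, of A, folded F_eq QF_eq]
    have Fle: "cmod (F y) \<le> M" for y
    proof -
      have "integrable (gauss 1) (\<lambda>v. V (v + sqrt d *\<^sub>R y))"
        by (rule integrable_const_bound[of _ M]) (use Vle in auto)
      from norm_integral_le_integral[OF this, of "\<lambda>_. M"] show ?thesis
        using Vle prob_space by (simp add: F_def)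
    qed
    have i1: "integrable (gauss 1) (\<lambda>y. (e + (cmod (F y))\<^sup>2) powr m)"
    proof (rule integrable_power_gauss[OF F_meas e m0 m(2)])
      show "cmod (F y) \<le> M * exp (2/7 * (norm y)\<^sup>2)" for y
        using M by (intro order_trans[OF Fle le_mult_exp]) auto
    qed
    have i2: "integrable (gauss 1) (\<lambda>x. (e + (cmod (\<integral>y. F y * ker r x y \<partial>gauss 1))\<^sup>2) powr m)"
    proof (rule integrable_power_gauss[OF _ e m0 m(2)])
      show "cmod (\<integral>y. F y * ker r x y \<partial>gauss 1) \<le> (M * cker TYPE('n)) * exp (2/7 * (norm x)\<^sup>2)" for x
      proof (rule norm_integral_ker_le[OF F_meas r(1,2)])
        show "cmod (F y) \<le> M * exp (1/16 * (norm y)\<^sup>2)" for y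
          using M by (intro order_trans[OF Fle le_mult_exp]) auto
      qed (use M in simp)
    qed measurable
    have "2 * ((54 * e powr (m - 3/2) + 15 * e powr (m - 1)) * (d * sqrt d * (c' * M)^3) 
        * (\<integral>y. exp (6/7 * (norm (y :: complex ^ 'n))\<^sup>2) \<partial>gauss 1)) = K * (d * sqrt d * M^3)"
      by (simp add: K_def power_mult_distrib mult_ac)
    with step have step': "(\<integral>x. (e + (cmod (\<integral>y. F y * ker r x y \<partial>gauss 1))\<^sup>2) powr m \<partial>gauss 1)
      \<le> (\<integral>y. (e + (cmod (F y))\<^sup>2) powr m \<partial>gauss 1) + K * (d * sqrt d * M^3)"
      by (simp only:)
    have "(\<integral>\<^sup>+x. ennreal ((e + (cmod (\<integral>y. F y * ker r x y \<partial>gauss 1))\<^sup>2) powr m) \<partial>gauss 1)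
      \<le> (\<integral>\<^sup>+y. ennreal ((e + (cmod (F y))\<^sup>2) powr m) \<partial>gauss 1) + ennreal (K * (d * sqrt d * M^3))"
      unfolding nn_integral_eq_integral[OF i1 AE_I2[OF powr_ge_zero]] nn_integral_eq_integral[OF i2 AE_I2[OF powr_ge_zero]]
      using step' K0 d M by (simp flip: ennreal_plus)
    then show "(\<integral>\<^sup>+x. ennreal ((e + (cmod (\<integral>y. (\<integral>v. V (v + sqrt d *\<^sub>R y) \<partial>gauss 1) * ker r x y \<partial>gauss 1))\<^sup>2) powr m) \<partial>gauss 1)
      \<le> (\<integral>\<^sup>+y. ennreal ((e + (cmod (\<integral>v. V (v + sqrt d *\<^sub>R y) \<partial>gauss 1))\<^sup>2) powr m) \<partial>gauss 1) + ennreal (K * (d * sqrt d * M^3))"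
      unfolding F_def .
  qed
qed

section \<open>The flow\<close>

text \<open>\<open>sg\<close> scales the variance of the mollifier, so \<open>sqrt sg\<close> is its
  length scale.\<close>

definition smooth :: "real \<Rightarrow> (complex ^ 'n \<Rightarrow> complex) \<Rightarrow> complex ^ 'n \<Rightarrow> complex" where
  "smooth sg u s = (\<integral>v. u (s + sqrt sg *\<^sub>R v) \<partial>gauss 1)"

lemma borel_measurable_smooth[measurable]:
  assumes [measurable]: "u \<in> borel_measurable borel"
  shows "smooth sg u \<in> borel_measurable borel"
  unfolding smooth_def[abs_def] by measurable

lemma norm_smooth_le:
  fixes u :: "complex ^ 'n \<Rightarrow> complex"
  assumes [measurable]: "u \<in> borel_measurable borel" and le: "\<And>s. cmod (u s) \<le> U"
  shows "cmod (smooth sg u s) \<le> U"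
proof -
  interpret prob_space "gauss 1 :: (complex ^ 'n) measure" by (rule prob_space_gauss) simp
  have "integrable (gauss 1) (\<lambda>v. u (s + sqrt sg *\<^sub>R v))"
    by (rule integrable_const_bound[of _ U]) (use le in auto)
  from norm_integral_le_integral[OF this, of "\<lambda>_. U"] show ?thesis
    using le prob_space by (simp add: smooth_def)
qed

lemma bounded_mult_exp:
  assumes "cmod z \<le> U" "0 \<le> c" shows "cmod z \<le> U * exp (c * (norm y)\<^sup>2)"
  using assms by (intro order_trans[OF assms(1) le_mult_exp] order_trans[OF norm_ge_zero assms(1)]) auto

text \<open>The sum of the two Hermitian products is unchanged when both pairs undergo the same real
  rotation. In operator terms, the tensor square of \<open>Q\<close> commutes with
  rotations.\<close>

lemma ker_rot:
  assumes ab: "a\<^sup>2 + b\<^sup>2 = (1::real)"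
  shows "ker r (a *\<^sub>R x1 + b *\<^sub>R x2) (a *\<^sub>R y1 + b *\<^sub>R y2) * ker r (- b *\<^sub>R x1 + a *\<^sub>R x2) (- b *\<^sub>R y1 + a *\<^sub>R y2)
     = ker r x1 y1 * ker r x2 y2"
proof -
  have "cip (a *\<^sub>R x1 + b *\<^sub>R x2) (a *\<^sub>R y1 + b *\<^sub>R y2) + cip (- b *\<^sub>R x1 + a *\<^sub>R x2) (- b *\<^sub>R y1 + a *\<^sub>R y2)
    = of_real (a\<^sup>2 + b\<^sup>2) * (cip x1 y1 + cip x2 y2)"
    by (simp add: cip_simps power2_eq_square algebra_simps)
  then show ?thesis unfolding ker_def mult_exp_exp distrib_left[symmetric] ab by simp
qed

text \<open>A dummy second variable is added, whose kernel integrates to one, and the pair is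
  rotated. The transform in a combined Gaussian variable thus becomes two successive transforms in
  its independent parts.\<close>

lemma integral_ker_rot:
  fixes g :: "complex ^ 'n \<Rightarrow> complex"
  assumes [measurable]: "g \<in> borel_measurable borel" and le: "\<And>s. cmod (g s) \<le> U"
    and r: "0 \<le> r" "r \<le> 1" and ab: "a\<^sup>2 + b\<^sup>2 = (1::real)"
  shows "(\<integral>y. g y * ker r (a *\<^sub>R x1 + b *\<^sub>R x2) y \<partial>gauss 1)
    = (\<integral>y2. (\<integral>y1. g (a *\<^sub>R y1 + b *\<^sub>R y2) * ker r x1 y1 \<partial>gauss 1) * ker r x2 y2 \<partial>gauss 1)"
proof -
  interpret pair_sigma_finite "gauss 1 :: (complex ^ 'n) measure" "gauss 1 :: (complex ^ 'n) measure"
    by (rule pair_sigma_finite_gauss)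
  define x where "x = a *\<^sub>R x1 + b *\<^sub>R x2"
  define x' where "x' = - b *\<^sub>R x1 + a *\<^sub>R x2"
  define h where "h = (\<lambda>(y, y'). g y * ker r x y * ker r x' y')"
  have h_meas[measurable]: "h \<in> borel_measurable (borel \<Otimes>\<^sub>M borel)"
    unfolding h_def split_beta' by measurable
  have U0: "0 \<le> U" using le[of 0] norm_ge_zero order_trans by blast
  have bnd: "norm (g z * ker r p y * ker r p' y') 
    \<le> (U * exp (2/7 * (norm p)\<^sup>2) * exp (2/7 * (norm p')\<^sup>2)) * exp (7/8 * (norm y)\<^sup>2) * exp (7/8 * (norm y')\<^sup>2)" for z p p' y y' :: "complex ^ 'n"
  proof -
    have "norm (g z * ker r p y * ker r p' y') \<le> U * (exp (2/7 * (norm p)\<^sup>2) * exp (7/8 * (norm y)\<^sup>2)) * (exp (2/7 * (norm p')\<^sup>2) * exp (7/8 * (norm y')\<^sup>2))"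
      unfolding norm_mult using U0 by (intro mult_mono le norm_ker_le r) auto
    then show ?thesis by (simp add: mult_ac)
  qed
  have ih: "integrable (gauss 1 \<Otimes>\<^sub>M gauss 1) h"
    by (rule integrable_pair_gauss_bound[OF h_meas, where c = "7/8" and c' = "7/8"]) (use bnd in \<open>simp_all only: h_def split_conv, simp_all\<close>)
  have rot: "h (rot a b (y1, y2)) = g (a *\<^sub>R y1 + b *\<^sub>R y2) * ker r x1 y1 * ker r x2 y2" for y1 y2
    using ker_rot[OF ab, of r x1 x2 y1 y2] by (simp add: h_def rot_def x_def x'_def mult.assoc)
  have h_borel: "h \<in> borel_measurable borel" using h_meas unfolding borel_prod .
  have irot: "integrable (gauss 1 \<Otimes>\<^sub>M gauss 1) (\<lambda>(y1, y2). g (a *\<^sub>R y1 + b *\<^sub>R y2) * ker r x1 y1 * ker r x2 y2)"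
    by (rule integrable_pair_gauss_bound[where c = "7/8" and c' = "7/8"]) (use bnd in \<open>simp_all only: split_conv, simp_all add: split_beta'\<close>)
  have "(\<integral>y. g y * ker r x y \<partial>gauss 1) = (\<integral>y. \<integral>y'. h (y, y') \<partial>gauss 1 \<partial>gauss 1)"
    by (simp add: h_def integral_ker_right r)
  also have "\<dots> = (\<integral>q. h q \<partial>(gauss 1 \<Otimes>\<^sub>M gauss 1))"
    by (rule integral_fst'[OF ih])
  also have "\<dots> = (\<integral>q. h q \<partial>distr (gauss 1 \<Otimes>\<^sub>M gauss 1) borel (rot a b))"
    by (simp only: distr_gauss_rot[OF ab])
  also have "\<dots> = (\<integral>q. h (rot a b q) \<partial>(gauss 1 \<Otimes>\<^sub>M gauss 1))"
    by (rule integral_distr[OF borel_measurable_rot h_borel])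
  also have "(\<lambda>q. h (rot a b q)) = (\<lambda>(y1, y2). g (a *\<^sub>R y1 + b *\<^sub>R y2) * ker r x1 y1 * ker r x2 y2)"
    using rot by (auto simp: fun_eq_iff)
  also have "integral\<^sup>L (gauss 1 \<Otimes>\<^sub>M gauss 1) \<dots> = (\<integral>y2. \<integral>y1. g (a *\<^sub>R y1 + b *\<^sub>R y2) * ker r x1 y1 * ker r x2 y2 \<partial>gauss 1 \<partial>gauss 1)"
    by (rule integral_snd[OF irot, symmetric])
  finally show ?thesis by (simp add: x_def)
qed

text \<open>Mollification commutes with the transform in another variable. A partially transformed
  function is therefore still a Gaussian average of a bounded function, and
  \<open>mollified_step\<close> applies at every time of the flow.\<close>

lemma integral_smooth_ker:
  fixes u :: "complex ^ 'n \<Rightarrow> complex"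
  assumes [measurable]: "u \<in> borel_measurable borel" and le: "\<And>s. cmod (u s) \<le> U"
    and r: "0 \<le> r" "r \<le> 1"
  shows "(\<integral>y1. smooth sg u (z + s *\<^sub>R y1) * ker r x1 y1 \<partial>gauss 1)
    = (\<integral>v. (\<integral>y1. u (z + s *\<^sub>R y1 + sqrt sg *\<^sub>R v) * ker r x1 y1 \<partial>gauss 1) \<partial>gauss 1)"
proof -
  interpret pair_sigma_finite "gauss 1 :: (complex ^ 'n) measure" "gauss 1 :: (complex ^ 'n) measure"
    by (rule pair_sigma_finite_gauss)
  have U0: "0 \<le> U" using le[of 0] norm_ge_zero order_trans by blast
  have "integrable (gauss 1 \<Otimes>\<^sub>M gauss 1) (\<lambda>(y1, v). u (z + s *\<^sub>R y1 + sqrt sg *\<^sub>R v) * ker r x1 y1)"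
  proof (rule integrable_pair_gauss_bound)
    fix y1 v :: "complex ^ 'n"
    have "norm (u (z + s *\<^sub>R y1 + sqrt sg *\<^sub>R v) * ker r x1 y1) \<le> U * (exp (2/7 * (norm x1)\<^sup>2) * exp (7/8 * (norm y1)\<^sup>2))"
      unfolding norm_mult using U0 by (intro mult_mono le norm_ker_le r) auto
    then show "norm (case (y1, v) of (y1, v) \<Rightarrow> u (z + s *\<^sub>R y1 + sqrt sg *\<^sub>R v) * ker r x1 y1)
      \<le> (U * exp (2/7 * (norm x1)\<^sup>2)) * exp (7/8 * (norm y1)\<^sup>2) * exp (0 * (norm v)\<^sup>2)"
      by (simp add: mult_ac)
  qed (simp_all add: split_beta')
  from Fubini_integral[OF this] show ?thesis
    by (simp add: smooth_def)
qed

text \<open>At \<open>t = 0\<close> the inner integral is \<open>u w\<close>, since the kernel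
  integrates to one; at \<open>t = 1\<close> it is the full transform at \<open>x\<close>. The
  endpoints are thus the two sides of the contraction. Values in \<open>ennreal\<close> allow
  variables to be exchanged without integrability conditions.\<close>

definition flow :: "real \<Rightarrow> real \<Rightarrow> real \<Rightarrow> (complex ^ 'n \<Rightarrow> complex) \<Rightarrow> real \<Rightarrow> ennreal" where
  "flow e m r u t = (\<integral>\<^sup>+w. \<integral>\<^sup>+x. ennreal ((e + (cmod (\<integral>y. u (sqrt (1 - t) *\<^sub>R w + sqrt t *\<^sub>R y) * ker r x y \<partial>gauss 1))\<^sup>2) powr m) 
     \<partial>gauss 1 \<partial>gauss 1)"

text \<open>Three independent Gaussian vectors \<open>w\<close>, \<open>y1\<close>,
  \<open>y2\<close> with squared weights \<open>1 - t - d\<close>, \<open>t\<close>,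
  \<open>d\<close> serve both times: at \<open>t\<close> the kernel acts in \<open>y1\<close> only,
  at \<open>t + d\<close> also in \<open>y2\<close>. With \<open>w\<close> and \<open>x1\<close>
  frozen, the comparison is \<open>mollified_step\<close> in \<open>y2\<close>, with
  \<open>d / sg\<close> in the role of the step.\<close>

lemma flow_step:
  fixes u :: "complex ^ 'n \<Rightarrow> complex"
  assumes e: "0 < e" and m: "1 / 2 < m" "m \<le> 1" and r: "0 \<le> r" "r \<le> 1" "r\<^sup>2 = (2 * m - 1) / m\<^sup>2"
    and u[measurable]: "u \<in> borel_measurable borel" and le: "\<And>s. cmod (u s) \<le> U" and U: "1 \<le> U" and sg: "0 < sg"
  obtains K :: real where "0 \<le> K"
    "\<And>t d. 0 \<le> t \<Longrightarrow> 0 < d \<Longrightarrow> t + d \<le> 1 \<Longrightarrow> d \<le> sg \<Longrightarrow> flow e m r (smooth sg u) (t + d) \<le> flow e m r (smooth sg u) t + ennreal (K * (d / sg * sqrt (d / sg)))"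
proof -
  interpret prob_space "gauss 1 :: (complex ^ 'n) measure" by (rule prob_space_gauss) simp
  interpret pair_sigma_finite "gauss 1 :: (complex ^ 'n) measure" "gauss 1 :: (complex ^ 'n) measure"
    by (rule pair_sigma_finite_gauss)
  define Phi where "Phi z = ennreal ((e + (cmod z)\<^sup>2) powr m)" for z
  have [measurable]: "Phi \<in> borel_measurable borel" unfolding Phi_def[abs_def] by measurable
  obtain K0 :: real where K0: "0 \<le> K0" and step: 
    "\<And>V M d. V \<in> borel_measurable borel \<Longrightarrow> (\<And>v :: complex ^ 'n. cmod (V v) \<le> M) \<Longrightarrow> 1 \<le> M \<Longrightarrow> 0 \<le> d \<Longrightarrow> d \<le> 1 \<Longrightarrow>
      (\<integral>\<^sup>+x. Phi (\<integral>y. (\<integral>v. V (v + sqrt d *\<^sub>R y) \<partial>gauss 1) * ker r x y \<partial>gauss 1) \<partial>gauss 1)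
      \<le> (\<integral>\<^sup>+y. Phi (\<integral>v. V (v + sqrt d *\<^sub>R y) \<partial>gauss 1) \<partial>gauss 1) + ennreal (K0 * (d * sqrt d * M^3))"
  proof (rule mollified_step[OF e m r, where 'n = 'n, folded Phi_def], goal_cases)
    case (1 K)
    from 1(2,3) show ?case by (rule 1(1))
  qed
  define I where "I = (\<integral>x. exp (6/7 * (norm (x :: complex ^ 'n))\<^sup>2) \<partial>gauss 1)"
  have I: "(\<integral>\<^sup>+x. ennreal (c * exp (6/7 * (norm (x :: complex ^ 'n))\<^sup>2)) \<partial>gauss 1) = ennreal (c * I)" if "0 \<le> c" for c
    using that integrable_exp_norm_square[of "6/7" 1, where 'n = 'n] by (subst nn_integral_eq_integral) (auto simp: I_def)
  have I0: "0 \<le> I" unfolding I_def by (intro integral_nonneg_AE) auto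
  define C where "C = U * cker TYPE('n)"
  have C: "1 \<le> C" using mult_mono[OF U cker_ge_1[where 'n = 'n]] U by (simp add: C_def)
  define K where "K = K0 * C^3 * I"
  have us[measurable]: "smooth sg u \<in> borel_measurable borel" by (rule borel_measurable_smooth[OF u])
  have us_le: "cmod (smooth sg u s) \<le> U" for s by (rule norm_smooth_le[OF u le])
  show ?thesis
  proof (rule that[of K])
    show "0 \<le> K" using K0 I0 C by (simp add: K_def)
    fix t d :: real assume t: "0 \<le> t" and d: "0 < d" and td: "t + d \<le> 1" and dsg: "d \<le> sg"
    define P where "P x1 w y2 = (\<integral>y1. smooth sg u (sqrt (1 - t - d) *\<^sub>R w + sqrt t *\<^sub>R y1 + sqrt d *\<^sub>R y2) * ker r x1 y1 \<partial>gauss 1)" for x1 w y2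
    have A: "flow e m r (smooth sg u) t = (\<integral>\<^sup>+w. \<integral>\<^sup>+x1. \<integral>\<^sup>+y2. Phi (P x1 w y2) \<partial>gauss 1 \<partial>gauss 1 \<partial>gauss 1)"
    proof -
      define f where "f z = (\<integral>\<^sup>+x. Phi (\<integral>y. smooth sg u (z + sqrt t *\<^sub>R y) * ker r x y \<partial>gauss 1) \<partial>gauss 1)" for z
      have [measurable]: "f \<in> borel_measurable borel" unfolding f_def[abs_def] by measurable
      have "flow e m r (smooth sg u) t = (\<integral>\<^sup>+w. f (sqrt (1 - t) *\<^sub>R w) \<partial>gauss 1)"
        by (simp add: flow_def f_def Phi_def)
      also have "\<dots> = (\<integral>\<^sup>+w. \<integral>\<^sup>+y2. f (sqrt (1 - t - d) *\<^sub>R w + sqrt d *\<^sub>R y2) \<partial>gauss 1 \<partial>gauss 1)"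
        by (rule nn_integral_gauss_sum[symmetric]) (use t d td in auto)
      also have "\<dots> = (\<integral>\<^sup>+w. \<integral>\<^sup>+y2. \<integral>\<^sup>+x1. Phi (P x1 w y2) \<partial>gauss 1 \<partial>gauss 1 \<partial>gauss 1)"
        by (simp add: f_def P_def add_ac)
      also have "\<dots> = (\<integral>\<^sup>+w. \<integral>\<^sup>+x1. \<integral>\<^sup>+y2. Phi (P x1 w y2) \<partial>gauss 1 \<partial>gauss 1 \<partial>gauss 1)"
        by (intro nn_integral_cong Fubini') (simp add: P_def cong: measurable_cong_sets sets_pair_measure_cong)
      finally show ?thesis .
    qed
    have B: "flow e m r (smooth sg u) (t + d) = (\<integral>\<^sup>+w. \<integral>\<^sup>+x1. \<integral>\<^sup>+x2. Phi (\<integral>y2. P x1 w y2 * ker r x2 y2 \<partial>gauss 1) \<partial>gauss 1 \<partial>gauss 1 \<partial>gauss 1)"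
    proof -
      \<comment> \<open>The vector of squared weight \<open>t + d\<close> is split into parts of
        squared weight \<open>t\<close> and \<open>d\<close>, for input and output
        simultaneously.\<close>
      define a where "a = sqrt t / sqrt (t + d)"
      define b where "b = sqrt d / sqrt (t + d)"
      have ab: "a\<^sup>2 + b\<^sup>2 = 1" using t d by (simp add: a_def b_def power_divide flip: add_divide_distrib)
      have ab': "sqrt (t + d) *\<^sub>R (a *\<^sub>R y1 + b *\<^sub>R y2) = sqrt t *\<^sub>R y1 + sqrt d *\<^sub>R y2" for y1 y2 :: "complex ^ 'n"
        using t d by (simp add: a_def b_def scaleR_add_right)
      have "flow e m r (smooth sg u) (t + d) = 
        (\<integral>\<^sup>+w. \<integral>\<^sup>+x. Phi (\<integral>y. smooth sg u (sqrt (1 - t - d) *\<^sub>R w + sqrt (t + d) *\<^sub>R y) * ker r (1 *\<^sub>R x) y \<partial>gauss 1) \<partial>gauss 1 \<partial>gauss 1)"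
        by (simp add: flow_def Phi_def diff_diff_eq)
      also have "\<dots> = (\<integral>\<^sup>+w. \<integral>\<^sup>+x1. \<integral>\<^sup>+x2. Phi (\<integral>y. smooth sg u (sqrt (1 - t - d) *\<^sub>R w + sqrt (t + d) *\<^sub>R y) * ker r (a *\<^sub>R x1 + b *\<^sub>R x2) y \<partial>gauss 1) 
         \<partial>gauss 1 \<partial>gauss 1 \<partial>gauss 1)"
        by (rule nn_integral_cong, rule nn_integral_gauss_sum[symmetric]) (use ab in simp_all)
      also have "\<dots> = (\<integral>\<^sup>+w. \<integral>\<^sup>+x1. \<integral>\<^sup>+x2. Phi (\<integral>y2. P x1 w y2 * ker r x2 y2 \<partial>gauss 1) \<partial>gauss 1 \<partial>gauss 1 \<partial>gauss 1)"
      proof (intro nn_integral_cong)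
        fix w x1 x2 :: "complex ^ 'n"
        define g where "g y = smooth sg u (sqrt (1 - t - d) *\<^sub>R w + sqrt (t + d) *\<^sub>R y)" for y
        have g: "g \<in> borel_measurable borel" "\<And>y. cmod (g y) \<le> U" unfolding g_def[abs_def] using us_le by auto
        have "(\<integral>y1. g (a *\<^sub>R y1 + b *\<^sub>R y2) * ker r x1 y1 \<partial>gauss 1) = P x1 w y2" for y2
          unfolding g_def ab' P_def by (simp add: add.assoc)
        then have "(\<integral>y. g y * ker r (a *\<^sub>R x1 + b *\<^sub>R x2) y \<partial>gauss 1) = (\<integral>y2. P x1 w y2 * ker r x2 y2 \<partial>gauss 1)"
          using integral_ker_rot[OF g r(1,2) ab, of x1 x2] by simp
        then show "Phi (\<integral>y. smooth sg u (sqrt (1 - t - d) *\<^sub>R w + sqrt (t + d) *\<^sub>R y) * ker r (a *\<^sub>R x1 + b *\<^sub>R x2) y \<partial>gauss 1)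
          = Phi (\<integral>y2. P x1 w y2 * ker r x2 y2 \<partial>gauss 1)"
          by (simp add: g_def)
      qed
      finally show ?thesis .
    qed
    have P_step: "(\<integral>\<^sup>+x2. Phi (\<integral>y2. P x1 w y2 * ker r x2 y2 \<partial>gauss 1) \<partial>gauss 1)
      \<le> (\<integral>\<^sup>+y2. Phi (P x1 w y2) \<partial>gauss 1) + ennreal (K0 * (d / sg * sqrt (d / sg)) * C^3 * exp (6/7 * (norm x1)\<^sup>2))" for x1 w
    proof -
      \<comment> \<open>The mollifying variable \<open>v\<close> is kept outside: a shift by
        \<open>sqrt d *\<^sub>R y2\<close> is then a shift of \<open>v\<close> by
        \<open>sqrt (d / sg) *\<^sub>R y2\<close>.\<close>
      define V where "V v = (\<integral>y1. u (sqrt (1 - t - d) *\<^sub>R w + sqrt t *\<^sub>R y1 + sqrt sg *\<^sub>R v) * ker r x1 y1 \<partial>gauss 1)" for v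
      have V_meas: "V \<in> borel_measurable borel" unfolding V_def[abs_def] by measurable
      have V_le: "cmod (V v) \<le> C * exp (2/7 * (norm x1)\<^sup>2)" for v
        unfolding V_def C_def by (rule norm_integral_ker_le[OF _ r(1,2) _ bounded_mult_exp[OF le]]) (use U in simp_all)
      \<comment> \<open>This bound on \<open>V\<close> grows with \<open>x1\<close> and enters the
        error with its third power, which is integrable in \<open>x1\<close> because
        \<open>3 * 2/7 < 1\<close>.\<close>
      have M: "1 \<le> C * exp (2/7 * (norm x1)\<^sup>2)" using mult_mono[OF C, of 1 "exp (2/7 * (norm x1)\<^sup>2)"] C by simp
      have sq: "sqrt d *\<^sub>R y = sqrt sg *\<^sub>R (sqrt (d / sg) *\<^sub>R y)" for y :: "complex ^ 'n"
        using sg d by (simp add: real_sqrt_divide)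
      have P_eq: "P x1 w y2 = (\<integral>v. V (v + sqrt (d / sg) *\<^sub>R y2) \<partial>gauss 1)" for y2
      proof -
        have "P x1 w y2 = (\<integral>y1. smooth sg u ((sqrt (1 - t - d) *\<^sub>R w + sqrt d *\<^sub>R y2) + sqrt t *\<^sub>R y1) * ker r x1 y1 \<partial>gauss 1)"
          by (simp add: P_def add_ac)
        also have "\<dots> = (\<integral>v. V (v + sqrt (d / sg) *\<^sub>R y2) \<partial>gauss 1)"
          unfolding integral_smooth_ker[OF u le r(1,2)] V_def scaleR_add_right sq[symmetric] by (simp add: add_ac)
        finally show ?thesis .
      qed
      have "(\<integral>\<^sup>+x2. Phi (\<integral>y2. P x1 w y2 * ker r x2 y2 \<partial>gauss 1) \<partial>gauss 1)
        \<le> (\<integral>\<^sup>+y2. Phi (P x1 w y2) \<partial>gauss 1) + ennreal (K0 * (d / sg * sqrt (d / sg) * (C * exp (2/7 * (norm x1)\<^sup>2))^3))"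
        unfolding P_eq by (rule step[OF V_meas V_le M]) (use d sg dsg in auto)
      also have "(C * exp (2/7 * (norm x1)\<^sup>2))^3 = C^3 * exp (6/7 * (norm x1)\<^sup>2)"
        unfolding power_mult_distrib exp_power by simp
      finally show ?thesis by (simp only: mult.assoc)
    qed
    have P_meas[measurable]: "(\<lambda>x. P (f x) (g x) (h x)) \<in> borel_measurable N" 
      if [measurable]: "f \<in> borel_measurable N" "g \<in> borel_measurable N" "h \<in> borel_measurable N" for f g h N
      unfolding P_def by measurable
    have K1: "0 \<le> K0 * (d / sg * sqrt (d / sg)) * C^3" using K0 d sg C by simp
    have "flow e m r (smooth sg u) (t + d) \<le> (\<integral>\<^sup>+w. \<integral>\<^sup>+x1. ((\<integral>\<^sup>+y2. Phi (P x1 w y2) \<partial>gauss 1) + ennreal (K0 * (d / sg * sqrt (d / sg)) * C^3 * exp (6/7 * (norm x1)\<^sup>2))) \<partial>gauss 1 \<partial>gauss 1)"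
      unfolding B by (intro nn_integral_mono P_step)
    also have "\<dots> = (\<integral>\<^sup>+w. (\<integral>\<^sup>+x1. \<integral>\<^sup>+y2. Phi (P x1 w y2) \<partial>gauss 1 \<partial>gauss 1) + ennreal (K0 * (d / sg * sqrt (d / sg)) * C^3 * I) \<partial>(gauss 1 :: (complex ^ 'n) measure))"
      unfolding I[OF K1, symmetric] by (intro nn_integral_cong nn_integral_add) (simp_all add: P_def)
    also have "\<dots> = flow e m r (smooth sg u) t + ennreal (K0 * (d / sg * sqrt (d / sg)) * C^3 * I)"
      unfolding A using emeasure_space_1 by (subst nn_integral_add) (simp_all add: P_def)
    also have "K0 * (d / sg * sqrt (d / sg)) * C^3 * I = K * (d / sg * sqrt (d / sg))"
      by (simp add: K_def)
    finally show "flow e m r (smooth sg u) (t + d) \<le> flow e m r (smooth sg u) t + ennreal (K * (d / sg * sqrt (d / sg)))" .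
  qed
qed

text \<open>\<open>Suc N\<close> steps of length \<open>1 / Suc N\<close> cost an error of order
  \<open>N powr (- 3/2)\<close> each, hence of order \<open>N powr (- 1/2)\<close> altogether, which
  vanishes as \<open>N\<close> grows.\<close>

lemma contraction_smooth:
  fixes u :: "complex ^ 'n \<Rightarrow> complex"
  assumes e: "0 < e" and m: "1 / 2 < m" "m \<le> 1" and r: "0 \<le> r" "r \<le> 1" "r\<^sup>2 = (2 * m - 1) / m\<^sup>2"
    and u[measurable]: "u \<in> borel_measurable borel" and le: "\<And>s. cmod (u s) \<le> U" and U: "1 \<le> U" and sg: "0 < sg"
  shows "(\<integral>\<^sup>+x. ennreal ((e + (cmod (\<integral>y. smooth sg u y * ker r x y \<partial>gauss 1))\<^sup>2) powr m) \<partial>gauss 1)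
    \<le> (\<integral>\<^sup>+w. ennreal ((e + (cmod (smooth sg u w))\<^sup>2) powr m) \<partial>gauss 1)"
proof -
  interpret prob_space "gauss 1 :: (complex ^ 'n) measure" by (rule prob_space_gauss) simp
  have one: "emeasure (gauss 1 :: (complex ^ 'n) measure) UNIV = 1" using emeasure_space_1 by simp
  let ?f = "flow e m r (smooth sg u)"
  obtain K where K: "0 \<le> K" and step: "\<And>t d. 0 \<le> t \<Longrightarrow> 0 < d \<Longrightarrow> t + d \<le> 1 \<Longrightarrow> d \<le> sg \<Longrightarrow> ?f (t + d) \<le> ?f t + ennreal (K * (d / sg * sqrt (d / sg)))"
  proof (rule flow_step[OF e m r u le U sg], goal_cases)
    case (1 K)
    from 1(2,3) show ?case by (rule 1(1))
  qed
  have bound: "?f 1 \<le> ?f 0 + ennreal (K / sg * sqrt (1 / (real (Suc N) * sg)))" if N: "1 / sg \<le> real (Suc N)" for N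
  proof -
    define d where "d = 1 / real (Suc N)"
    have d: "0 < d" "d \<le> sg" using N sg by (auto simp: d_def field_simps)
    define b where "b = K * (d / sg * sqrt (d / sg))"
    have b0: "0 \<le> b" using K d sg by (simp add: b_def)
    have "k \<le> Suc N \<Longrightarrow> ?f (real k * d) \<le> ?f 0 + ennreal (real k * b)" for k
    proof (induction k)
      case (Suc k)
      have "real (Suc k) * d \<le> real (Suc N) * d" using Suc.prems d by (intro mult_right_mono) auto
      then have kd: "real k * d + d \<le> 1" by (simp add: d_def field_simps)
      have "?f (real (Suc k) * d) = ?f (real k * d + d)" by (simp add: algebra_simps)
      also have "\<dots> \<le> ?f (real k * d) + ennreal b" unfolding b_def by (rule step) (use d kd in auto)
      also have "\<dots> \<le> (?f 0 + ennreal (real k * b)) + ennreal b" using Suc by (intro add_right_mono) auto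
      also have "\<dots> = ?f 0 + ennreal (real (Suc k) * b)"
        using b0 by (simp add: algebra_simps ennreal_plus add.assoc)
      finally show ?case .
    qed simp
    from this[of "Suc N"] have "?f 1 \<le> ?f 0 + ennreal (real (Suc N) * b)" by (simp add: d_def)
    also have "real (Suc N) * b = K / sg * sqrt (1 / (real (Suc N) * sg))" by (simp add: b_def d_def)
    finally show ?thesis .
  qed
  have lim: "(\<lambda>N. ?f 0 + ennreal (K / sg * sqrt (1 / (real (Suc N) * sg)))) \<longlonglongrightarrow> ?f 0 + ennreal 0"
  proof (intro tendsto_add tendsto_const tendsto_ennrealI)
    have "(\<lambda>N. inverse (real (Suc N)) / sg) \<longlonglongrightarrow> 0 / sg" by (intro tendsto_divide LIMSEQ_inverse_real_of_nat tendsto_const) (use sg in auto)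
    from tendsto_mult[OF tendsto_const tendsto_real_sqrt[OF this], of "K / sg"]
    have "(\<lambda>N. K / sg * sqrt (inverse (real (Suc N)) / sg)) \<longlonglongrightarrow> K / sg * sqrt (0 / sg)" .
    then show "(\<lambda>N. K / sg * sqrt (1 / (real (Suc N) * sg))) \<longlonglongrightarrow> 0" by (simp add: divide_inverse)
  qed
  have "?f 1 \<le> ?f 0 + ennreal 0"
  proof (rule LIMSEQ_le_const[OF lim])
    obtain N0 :: nat where N0: "1 / sg \<le> real N0" using real_arch_simple by blast
    show "\<exists>N0. \<forall>N\<ge>N0. ?f 1 \<le> ?f 0 + ennreal (K / sg * sqrt (1 / (real (Suc N) * sg)))"
      by (intro exI[of _ N0] allI impI bound) (use N0 in auto)
  qed
  then show ?thesis
    by (simp add: flow_def one integral_ker_right r)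
qed

section \<open>The contraction theorem\<close>

lemma Hoelder_integral:
  fixes f g :: "'a \<Rightarrow> complex"
  assumes p: "1 < p" "1 < q" "1 / p + 1 / q = 1"
    and [measurable]: "f \<in> borel_measurable M" "g \<in> borel_measurable M"
    and f: "integrable M (\<lambda>x. cmod (f x) powr p)" and g: "integrable M (\<lambda>x. cmod (g x) powr q)"
  shows "integrable M (\<lambda>x. f x * g x)"
    "(\<integral>x. cmod (f x * g x) \<partial>M) \<le> (\<integral>x. cmod (f x) powr p \<partial>M) powr (1 / p) * (\<integral>x. cmod (g x) powr q \<partial>M) powr (1 / q)"
proof -
  have young: "cmod (f x * g x) \<le> cmod (f x) powr p / p + cmod (g x) powr q / q" for x
    unfolding norm_mult by (rule Youngs_inequality[OF p]) auto
  show int: "integrable M (\<lambda>x. f x * g x)"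
    by (rule integrable_dominated[OF _ _ young]) (use f g in auto)
  define A where "A = (\<integral>x. cmod (f x) powr p \<partial>M)"
  define B where "B = (\<integral>x. cmod (g x) powr q \<partial>M)"
  have AB: "0 \<le> A" "0 \<le> B" by (auto simp: A_def B_def intro!: integral_nonneg_AE)
  show "(\<integral>x. cmod (f x * g x) \<partial>M) \<le> A powr (1 / p) * B powr (1 / q)"
  proof (cases "A = 0 \<or> B = 0")
    case True
    have "AE x in M. cmod (f x * g x) = 0"
      using True
    proof
      assume "A = 0"
      then have "AE x in M. cmod (f x) powr p = 0"
        using integral_nonneg_eq_0_iff_AE[OF f] by (simp add: A_def)
      then show ?thesis by eventually_elim auto
    next
      assume "B = 0"
      then have "AE x in M. cmod (g x) powr q = 0"
        using integral_nonneg_eq_0_iff_AE[OF g] by (simp add: B_def)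
      then show ?thesis by eventually_elim auto
    qed
    then have "(\<integral>x. cmod (f x * g x) \<partial>M) = 0" by (simp add: integral_eq_zero_AE)
    then show ?thesis by simp
  next
    case False
    then have AB: "0 < A" "0 < B" using AB by auto
    define a where "a = A powr (1 / p)"
    define b where "b = B powr (1 / q)"
    have ab: "0 < a" "0 < b" using AB by (auto simp: a_def b_def)
    have abp: "a powr p = A" "b powr q = B" using AB p by (auto simp: a_def b_def powr_powr)
    have "cmod (f x * g x) / (a * b) \<le> cmod (f x) powr p / (A * p) + cmod (g x) powr q / (B * q)" for x
    proof -
      have "(cmod (f x) / a) * (cmod (g x) / b) \<le> (cmod (f x) / a) powr p / p + (cmod (g x) / b) powr q / q"
        using ab by (intro Youngs_inequality[OF p]) auto
      then show ?thesis using ab by (simp add: norm_mult powr_divide abp)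
    qed
    then have "(\<integral>x. cmod (f x * g x) / (a * b) \<partial>M) \<le> (\<integral>x. cmod (f x) powr p / (A * p) + cmod (g x) powr q / (B * q) \<partial>M)"
      by (intro integral_mono) (use int f g in auto)
    also have "\<dots> = 1"
      using f g AB p by (simp flip: A_def B_def)
    finally have "(\<integral>x. cmod (f x * g x) \<partial>M) / (a * b) \<le> 1" by simp
    then show ?thesis using ab by (simp add: divide_le_eq flip: a_def b_def)
  qed
qed

lemma has_derivative_quadratic:
  fixes f :: "'a::real_normed_vector \<Rightarrow> 'b::real_normed_vector"
  assumes L: "bounded_linear L" and le: "\<And>h. norm h \<le> 1 \<Longrightarrow> norm (f (x + h) - f x - L h) \<le> C * (norm h)\<^sup>2"
  shows "(f has_derivative L) (at x)"
  unfolding has_derivative_at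
proof
  show "bounded_linear L" by (rule L)
  show "(\<lambda>h. norm (f (x + h) - f x - L h) / norm h) \<midarrow>0\<rightarrow> 0"
  proof (rule Lim_null_comparison)
    have "eventually (\<lambda>h::'a. norm h \<le> 1) (at 0)"
      unfolding eventually_at by (intro exI[of _ 1]) auto
    then show "\<forall>\<^sub>F h in at 0. norm (norm (f (x + h) - f x - L h) / norm h) \<le> C * norm h"
    proof eventually_elim
      case (elim h)
      then show ?case using le[OF elim] by (cases "h = 0") (auto simp: divide_le_eq power2_eq_square mult.assoc)
    qed
    show "((\<lambda>h. C * norm h) \<longlongrightarrow> 0) (at 0)"
      by (rule tendsto_eq_intros refl)+ simp
  qed
qed

lemma exp_cip_remainder:
  assumes h: "norm h \<le> 1" and r: "0 \<le> r" "r \<le> 1"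
  shows "cmod (ker r (x + h) y - ker r x y - of_real r * cip h y * ker r x y) 
    \<le> (norm h)\<^sup>2 * ((norm y)\<^sup>2 * exp (norm y) * cmod (ker r x y))"
proof -
  define z where "z = of_real r * cip h y"
  have "ker r (x + h) y - ker r x y - z * ker r x y = ker r x y * (exp z - 1 - z)"
    by (simp add: ker_def z_def cip_simps exp_add algebra_simps)
  moreover have z: "cmod z \<le> norm h * norm y"
  proof -
    have "cmod z \<le> 1 * (norm h * norm y)"
      unfolding z_def norm_mult norm_of_real using r by (intro mult_mono norm_cip_le) auto
    then show ?thesis by simp
  qed
  moreover have "cmod (exp z - 1 - z) \<le> (norm h * norm y)\<^sup>2 * exp (norm y)"
  proof -
    have "cmod z \<le> norm y" using z mult_right_mono[OF h norm_ge_zero[of y]] by simp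
    then have "(cmod z)\<^sup>2 * exp (cmod z) \<le> (norm h * norm y)\<^sup>2 * exp (norm y)"
      using power_mono[OF z, of 2] by (intro mult_mono) auto
    then show ?thesis using norm_exp_minus_linear_le[of z] by linarith
  qed
  ultimately have "cmod (ker r (x + h) y - ker r x y - z * ker r x y) \<le> cmod (ker r x y) * ((norm h * norm y)\<^sup>2 * exp (norm y))"
    by (simp only: norm_mult mult_left_mono norm_ge_zero)
  then show ?thesis by (simp add: z_def power_mult_distrib mult_ac)
qed

text \<open>Differentiation under the integral, by the quadratic remainder of the kernel. It serves
  twice: transforms must be continuous to yield test functions in the dual argument, and entire to
  belong to the spaces.\<close>

lemma entire_integral_ker:
  fixes u :: "complex ^ 'n \<Rightarrow> complex"
  assumes [measurable]: "u \<in> borel_measurable borel" and le: "\<And>s. cmod (u s) \<le> U" and r: "0 \<le> r" "r \<le> 1"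
  shows "entire (\<lambda>x. \<integral>y. u y * ker r x y \<partial>gauss 1)"
proof (rule entireI)
  fix x :: "complex ^ 'n"
  have U0: "0 \<le> U" using le[of 0] norm_ge_zero order_trans by blast
  define L where "L h = (\<integral>y. u y * (of_real r * cip h y) * ker r x y \<partial>gauss 1)" for h
  have ile: "cmod (u y * (of_real r * cip h y)) \<le> (U * (norm h * 2)) * exp (1/16 * (norm y)\<^sup>2)" for y h
  proof -
    have "cmod (of_real r * cip h y) \<le> 1 * (norm h * norm y)"
      unfolding norm_mult norm_of_real using r by (intro mult_mono norm_cip_le) auto
    also have "\<dots> \<le> norm h * (2 * exp (1/16 * (norm y)\<^sup>2))"
      unfolding mult_1 by (intro mult_left_mono norm_le_exp) auto
    finally have "cmod (u y * (of_real r * cip h y)) \<le> U * (norm h * (2 * exp (1/16 * (norm y)\<^sup>2)))"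
      unfolding norm_mult[of "u y"] using U0 by (intro mult_mono le) auto
    then show ?thesis by (simp add: mult_ac)
  qed
  have i1: "integrable (gauss 1) (\<lambda>y. u y * (of_real r * cip h y) * ker r x y)" for h
    by (rule integrable_ker[OF _ r _ ile]) (use U0 in simp_all)
  have i0: "integrable (gauss 1) (\<lambda>y. u y * ker r x y)" for x
    by (rule integrable_ker[OF _ r U0 bounded_mult_exp[OF le]]) simp_all
  show "L (c *s v) = c * L v" for c v
  proof -
    have "L (c *s v) = (\<integral>y. c * (u y * (of_real r * cip v y) * ker r x y) \<partial>gauss 1)"
      unfolding L_def by (intro Bochner_Integration.integral_cong) (simp_all add: cip_simps)
    then show ?thesis by (simp add: L_def)
  qed
  show "((\<lambda>x. \<integral>y. u y * ker r x y \<partial>gauss 1) has_derivative L) (at x)"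
  proof (rule has_derivative_quadratic)
    have "L (v + w) = L v + L w" for v w
      unfolding L_def by (subst Bochner_Integration.integral_add[OF i1 i1, symmetric]) (simp add: cip_simps algebra_simps)
    moreover have "L (c *\<^sub>R v) = c *\<^sub>R L v" for c v
    proof -
      have "L (c *\<^sub>R v) = (\<integral>y. c *\<^sub>R (u y * (of_real r * cip v y) * ker r x y) \<partial>gauss 1)"
        unfolding L_def by (intro Bochner_Integration.integral_cong) (simp_all add: cip_simps scaleR_conv_of_real[where 'a = complex])
      then show ?thesis by (simp add: L_def)
    qed
    ultimately show "bounded_linear L" 
      by (intro linear_conv_bounded_linear[THEN iffD1] linearI)
  next
    define D where "D = U * (\<integral>y. (norm y)\<^sup>2 * exp (norm y) * cmod (ker r x y) \<partial>gauss 1)"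
    have iD: "integrable (gauss 1) (\<lambda>y. (norm y)\<^sup>2 * exp (norm y) * cmod (ker r x y))"
    proof (rule integrable_gauss_bound)
      fix y :: "complex ^ 'n"
      have "(norm y)\<^sup>2 * exp (norm y) * cmod (ker r x y) \<le> (1 / (1/32) * exp (1/32 * (norm y)\<^sup>2)) * (exp (1\<^sup>2 / (4 * (1/32))) * exp (1/32 * (norm y)\<^sup>2)) * (exp (2/7 * (norm x)\<^sup>2) * exp (7/8 * (norm y)\<^sup>2))"
        using exp_mult_le[of "1/32" 1 "norm y"] by (intro mult_mono square_le_exp norm_ker_le r) auto
      also have "\<dots> = 32 * exp 8 * exp (2/7 * (norm x)\<^sup>2) * (exp (1/32 * (norm y)\<^sup>2) * exp (1/32 * (norm y)\<^sup>2) * exp (7/8 * (norm y)\<^sup>2))"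
        by simp
      also have "exp (1/32 * (norm y)\<^sup>2) * exp (1/32 * (norm y)\<^sup>2) * exp (7/8 * (norm y)\<^sup>2) = exp (15/16 * (norm y)\<^sup>2)"
        unfolding mult_exp_exp by (simp add: field_simps)
      finally show "norm ((norm y)\<^sup>2 * exp (norm y) * cmod (ker r x y)) \<le> 32 * exp 8 * exp (2/7 * (norm x)\<^sup>2) * exp (15/16 * (norm y)\<^sup>2)"
        by simp
    qed auto
    fix h :: "complex ^ 'n" assume h: "norm h \<le> 1"
    have "(\<integral>y. u y * ker r (x + h) y \<partial>gauss 1) - (\<integral>y. u y * ker r x y \<partial>gauss 1) - L h 
      = (\<integral>y. u y * (ker r (x + h) y - ker r x y - of_real r * cip h y * ker r x y) \<partial>gauss 1)"
      unfolding L_def using i0[of x] i0[of "x + h"] i1[of h] by (simp add: algebra_simps)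
    also have "cmod \<dots> \<le> (\<integral>y. U * ((norm h)\<^sup>2 * ((norm y)\<^sup>2 * exp (norm y) * cmod (ker r x y))) \<partial>gauss 1)"
    proof (rule norm_integral_le_integral)
      show b: "cmod (u y * (ker r (x + h) y - ker r x y - of_real r * cip h y * ker r x y)) \<le> U * ((norm h)\<^sup>2 * ((norm y)\<^sup>2 * exp (norm y) * cmod (ker r x y)))" for y
        unfolding norm_mult[of "u y"] using U0 by (intro mult_mono le exp_cip_remainder[OF h r]) auto
      show i: "integrable (gauss 1) (\<lambda>y. U * ((norm h)\<^sup>2 * ((norm y)\<^sup>2 * exp (norm y) * cmod (ker r x y))))"
        using iD by simp
      show "integrable (gauss 1) (\<lambda>y. u y * (ker r (x + h) y - ker r x y - of_real r * cip h y * ker r x y))"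
        by (rule integrable_dominated[OF i _ b]) simp
    qed
    also have "\<dots> = D * (norm h)\<^sup>2" by (simp add: D_def)
    finally show "cmod ((\<integral>y. u y * ker r (x + h) y \<partial>gauss 1) - (\<integral>y. u y * ker r x y \<partial>gauss 1) - L h) \<le> D * (norm h)\<^sup>2" .
  qed
qed

text \<open>Fatou's lemma with convergent bounds, which carries norm estimates to pointwise limits
  without domination.\<close>

lemma nn_integral_le_limit:
  assumes [measurable]: "\<And>k. f k \<in> borel_measurable M"
    and lim: "\<And>x. (\<lambda>k. f k x) \<longlonglongrightarrow> (g x :: ennreal)" and le: "\<And>k. (\<integral>\<^sup>+x. f k x \<partial>M) \<le> b k" and b: "b \<longlonglongrightarrow> B"
  shows "(\<integral>\<^sup>+x. g x \<partial>M) \<le> B"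
proof -
  have "g x = liminf (\<lambda>k. f k x)" for x
    using lim_imp_Liminf[OF _ lim[of x]] by simp
  then have "(\<integral>\<^sup>+x. g x \<partial>M) = (\<integral>\<^sup>+x. liminf (\<lambda>k. f k x) \<partial>M)" by simp
  also have "\<dots> \<le> liminf (\<lambda>k. \<integral>\<^sup>+x. f k x \<partial>M)" by (rule nn_integral_liminf) simp
  also have "\<dots> \<le> liminf b" by (rule Liminf_mono) (simp add: le)
  also have "\<dots> = B" using lim_imp_Liminf[OF _ b] by simp
  finally show ?thesis .
qed

lemma powr_add_le:
  fixes x y m :: real
  assumes "0 \<le> x" "0 \<le> y" "0 < m" "m \<le> 1"
  shows "(x + y) powr m \<le> x powr m + y powr m"
proof (cases "x + y = 0")
  case False
  then have s: "0 < x + y" using assms by simp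
  have *: "z / (x + y) \<le> (z / (x + y)) powr m" if "0 \<le> z" "z \<le> x + y" for z
  proof (cases "z = 0")
    case False
    then have z: "0 < z / (x + y)" "z / (x + y) \<le> 1" using that s by auto
    then have "(z / (x + y)) powr 1 \<le> (z / (x + y)) powr m" using assms by (intro powr_mono') auto
    moreover have "(z / (x + y)) powr 1 = z / (x + y)" by (rule powr_one) (use z in simp)
    ultimately show ?thesis by (simp only:)
  qed simp
  have "1 = x / (x + y) + y / (x + y)" using s by (simp flip: add_divide_distrib)
  also have "\<dots> \<le> (x / (x + y)) powr m + (y / (x + y)) powr m" using assms by (intro add_mono *) auto
  also have "\<dots> = (x powr m + y powr m) / (x + y) powr m" using assms s by (simp add: powr_divide add_divide_distrib)
  finally show ?thesis using s by (simp add: field_simps)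
qed (use assms in auto)

lemma power2_powr: "0 \<le> x \<Longrightarrow> (x\<^sup>2) powr m = x powr (2 * m)" for x m :: real
  by (cases "x = 0") (auto simp: powr_powr simp flip: powr_numeral)

section \<open>Contraction for exponents at most two\<close>

text \<open>Removal of the two regularisations. As \<open>m \<le> 1\<close>, the power is
  subadditive, so \<open>e\<close> costs at most \<open>e powr m\<close>, which is an arbitrary
  \<open>d\<close>. Then the mollification scale tends to zero: continuity of \<open>u\<close> gives
  pointwise convergence, Fatou handles the left side and dominated convergence the right.\<close>

lemma contraction_le_2:
  fixes u :: "complex ^ 'n \<Rightarrow> complex"
  assumes p: "1 < p" "p \<le> 2" and r: "0 \<le> r" "r \<le> 1" "r\<^sup>2 = 4 * (p - 1) / p\<^sup>2"
    and u: "continuous_on UNIV u" and le: "\<And>s. cmod (u s) \<le> U"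
  shows "(\<integral>\<^sup>+x. ennreal (cmod (\<integral>y. u y * ker r x y \<partial>gauss 1) powr p) \<partial>gauss 1) \<le> (\<integral>\<^sup>+x. ennreal (cmod (u x) powr p) \<partial>gauss 1)"
proof -
  interpret prob_space "gauss 1 :: (complex ^ 'n) measure" by (rule prob_space_gauss) simp
  have one: "emeasure (gauss 1 :: (complex ^ 'n) measure) UNIV = 1" using emeasure_space_1 by simp
  define m where "m = p / 2"
  have m: "1 / 2 < m" "m \<le> 1" "2 * m = p" using p by (auto simp: m_def)
  have rm: "r\<^sup>2 = (2 * m - 1) / m\<^sup>2" using p by (simp add: r(3) m_def power_divide field_simps)
  define U' where "U' = max U 1"
  have le': "cmod (u s) \<le> U'" for s using le[of s] by (simp add: U'_def)
  have U': "1 \<le> U'" "0 \<le> U'" by (auto simp: U'_def)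
  have [measurable]: "u \<in> borel_measurable borel" by (rule borel_measurable_continuous_onI[OF u])
  have smooth_meas: "smooth sg u \<in> borel_measurable borel" for sg by measurable
  have 1: "(\<integral>\<^sup>+x. ennreal (cmod (\<integral>y. smooth sg u y * ker r x y \<partial>gauss 1) powr p) \<partial>gauss 1) \<le> (\<integral>\<^sup>+x. ennreal (cmod (smooth sg u x) powr p) \<partial>gauss 1)" (is "?L \<le> ?R")
    if sg: "0 < sg" for sg
  proof (rule ennreal_le_epsilon)
    fix d :: real assume d: "0 < d"
    define e where "e = d powr (1 / m)"
    have e: "0 < e" "e powr m = d" using d m by (auto simp: e_def powr_powr)
    have "?L \<le> (\<integral>\<^sup>+x. ennreal ((e + (cmod (\<integral>y. smooth sg u y * ker r x y \<partial>gauss 1))\<^sup>2) powr m) \<partial>gauss 1)"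
      using e m by (intro nn_integral_mono ennreal_leI) (simp add: m(3)[symmetric] power2_powr[symmetric] powr_mono2)
    also have "\<dots> \<le> (\<integral>\<^sup>+x. ennreal ((e + (cmod (smooth sg u x))\<^sup>2) powr m) \<partial>gauss 1)"
      by (rule contraction_smooth[OF e(1) m(1,2) r(1,2) rm _ le' U'(1) sg]) simp
    also have "\<dots> \<le> (\<integral>\<^sup>+x. ennreal (cmod (smooth sg u x) powr p) + ennreal d \<partial>gauss 1)"
    proof (intro nn_integral_mono)
      fix x :: "complex ^ 'n"
      have "(e + (cmod (smooth sg u x))\<^sup>2) powr m \<le> e powr m + ((cmod (smooth sg u x))\<^sup>2) powr m"
        using e m by (intro powr_add_le) auto
      then have "(e + (cmod (smooth sg u x))\<^sup>2) powr m \<le> cmod (smooth sg u x) powr p + d"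
        by (simp add: e power2_powr m(3))
      then show "ennreal ((e + (cmod (smooth sg u x))\<^sup>2) powr m) \<le> ennreal (cmod (smooth sg u x) powr p) + ennreal d"
        using d by (simp add: ennreal_leI flip: ennreal_plus)
    qed
    also have "\<dots> = ?R + ennreal d"
      using one by (subst nn_integral_add) auto
    finally show "?L \<le> ?R + ennreal d" .
  qed
  define s where "s k = inverse (real (Suc k))" for k
  have s: "0 < s k" for k by (simp add: s_def)
  have s0: "s \<longlonglongrightarrow> 0" unfolding s_def by (rule LIMSEQ_inverse_real_of_nat)
  have conv: "(\<lambda>k. smooth (s k) u x) \<longlonglongrightarrow> u x" for x
  proof -
    have "(\<lambda>k. \<integral>v. u (x + sqrt (s k) *\<^sub>R v) \<partial>gauss 1) \<longlonglongrightarrow> (\<integral>v. u x \<partial>(gauss 1 :: (complex ^ 'n) measure))"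
    proof (rule integral_dominated_convergence[where w = "\<lambda>_. U'"])
      show "AE v in gauss 1. (\<lambda>k. u (x + sqrt (s k) *\<^sub>R v)) \<longlonglongrightarrow> u x"
      proof (rule AE_I2)
        fix v :: "complex ^ 'n"
        have "(\<lambda>k. x + sqrt (s k) *\<^sub>R v) \<longlonglongrightarrow> x + sqrt 0 *\<^sub>R v"
          by (intro tendsto_add tendsto_scaleR tendsto_real_sqrt s0 tendsto_const)
        then show "(\<lambda>k. u (x + sqrt (s k) *\<^sub>R v)) \<longlonglongrightarrow> u x"
          using u by (intro continuous_on_tendsto_compose[OF u]) auto
      qed
    qed (use le' in auto)
    then show ?thesis using prob_space by (simp add: smooth_def)
  qed
  have conv2: "(\<lambda>k. \<integral>y. smooth (s k) u y * ker r x y \<partial>gauss 1) \<longlonglongrightarrow> (\<integral>y. u y * ker r x y \<partial>gauss 1)" for x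
  proof (rule integral_dominated_convergence[where w = "\<lambda>y. U' * cmod (ker r x y)"])
    have "integrable (gauss 1) (\<lambda>y. 1 * ker r x y)"
      by (rule integrable_ker[OF _ r(1,2), of _ 1]) simp_all
    then show "integrable (gauss 1) (\<lambda>y. U' * cmod (ker r x y))" by simp
    show "AE y in gauss 1. (\<lambda>k. smooth (s k) u y * ker r x y) \<longlonglongrightarrow> u y * ker r x y"
      by (intro AE_I2 tendsto_mult conv tendsto_const)
    show "AE y in gauss 1. cmod (smooth (s k) u y * ker r x y) \<le> U' * cmod (ker r x y)" for k
      unfolding norm_mult by (intro AE_I2 mult_right_mono norm_smooth_le le') auto
  qed auto
  have p0: "0 < p" using p by simp
  have powr_lim: "(\<lambda>k. ennreal (cmod (z k) powr p)) \<longlonglongrightarrow> ennreal (cmod w powr p)" if "z \<longlonglongrightarrow> w" for z w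
    using that p0 by (intro tendsto_ennrealI tendsto_powr' tendsto_norm tendsto_const) auto
  have R: "(\<lambda>k. \<integral>\<^sup>+x. ennreal (cmod (smooth (s k) u x) powr p) \<partial>gauss 1) \<longlonglongrightarrow> (\<integral>\<^sup>+x. ennreal (cmod (u x) powr p) \<partial>gauss 1)"
  proof (rule nn_integral_dominated_convergence[where w = "\<lambda>_. ennreal (U' powr p)"])
    show "AE x in gauss 1. ennreal (cmod (smooth (s k) u x) powr p) \<le> ennreal (U' powr p)" for k
      using p0 by (intro AE_I2 ennreal_leI powr_mono2 norm_smooth_le le') auto
    show "(\<integral>\<^sup>+x. ennreal (U' powr p) \<partial>(gauss 1 :: (complex ^ 'n) measure)) < \<infinity>" using one by simp
    show "AE x in gauss 1. (\<lambda>k. ennreal (cmod (smooth (s k) u x) powr p)) \<longlonglongrightarrow> ennreal (cmod (u x) powr p)"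
      by (intro AE_I2 powr_lim conv)
  qed auto
  show ?thesis
    by (rule nn_integral_le_limit[OF _ powr_lim[OF conv2] 1[OF s] R]) simp
qed

section \<open>Contraction for exponents at least two\<close>

text \<open>Continuous rather than an indicator function, because the contraction is proved for
  continuous functions.\<close>

definition cutoff :: "nat \<Rightarrow> complex ^ 'n \<Rightarrow> real" where
  "cutoff k x = max 0 (min 1 (real k + 1 - norm x))"

lemma cutoff_bounds: "0 \<le> cutoff k x" "cutoff k x \<le> 1"
  by (auto simp: cutoff_def)

lemma cutoff_eq_0: "real k + 1 \<le> norm x \<Longrightarrow> cutoff k x = 0"
  by (simp add: cutoff_def)

lemma continuous_on_cutoff[continuous_intros]:
  "continuous_on S f \<Longrightarrow> continuous_on S (\<lambda>x. cutoff k (f x))"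
  unfolding cutoff_def by (intro continuous_intros)

lemma cutoff_measurable[measurable]: "cutoff k \<in> borel_measurable borel"
  unfolding cutoff_def[abs_def] by measurable

lemma cutoff_tendsto: "(\<lambda>k. cutoff k x) \<longlonglongrightarrow> 1"
proof (rule tendsto_eventually)
  obtain k0 :: nat where k0: "norm x \<le> real k0" using real_arch_simple by blast
  show "\<forall>\<^sub>F k in sequentially. cutoff k x = 1"
    unfolding eventually_sequentially by (intro exI[of _ k0]) (use k0 in \<open>auto simp: cutoff_def\<close>)
qed

lemma cutoff_mult_bounded:
  fixes f :: "complex ^ 'n \<Rightarrow> complex"
  assumes "continuous_on UNIV f"
  obtains B where "\<And>x. cmod (of_real (cutoff k x) * f x) \<le> B"
proof -
  have "compact (f ` cball 0 (real k + 1))"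
    by (intro compact_continuous_image continuous_on_subset[OF assms]) auto
  then obtain B where B: "\<And>x. norm x \<le> real k + 1 \<Longrightarrow> cmod (f x) \<le> B"
    using compact_imp_bounded bounded_iff by (metis imageI mem_cball_0)
  have B0: "0 \<le> B" using B[of 0] norm_ge_zero order_trans by (metis add_nonneg_nonneg norm_zero of_nat_0_le_iff zero_le_one)
  show ?thesis
  proof (rule that[of B])
    fix x :: "complex ^ 'n"
    show "cmod (of_real (cutoff k x) * f x) \<le> B"
    proof (cases "norm x \<le> real k + 1")
      case True
      have "cutoff k x * cmod (f x) \<le> 1 * B"
        using cutoff_bounds[of k x] B[OF True] by (intro mult_mono) auto
      then show ?thesis using cutoff_bounds[of k x] by (simp add: norm_mult)
    next
      case False
      then show ?thesis using B0 by (simp add: cutoff_eq_0)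
    qed
  qed
qed

text \<open>The duality map: \<open>z\<close> times its conjugate is \<open>|z|^s\<close>, and its
  modulus to the exponent conjugate to \<open>s\<close> is again \<open>|z|^s\<close>. At the origin
  the factor \<open>z\<close> makes the value \<open>0\<close>.\<close>

definition sgnp :: "real \<Rightarrow> complex \<Rightarrow> complex" where
  "sgnp s z = z * of_real (cmod z powr (s - 2))"

lemma cmod_sgnp: "cmod (sgnp s z) = cmod z powr (s - 1)"
proof (cases "z = 0")
  case False
  have "s - 1 = 1 + (s - 2)" by simp
  then have "cmod z powr 1 * cmod z powr (s - 2) = cmod z powr (s - 1)"
    by (simp only: powr_add)
  then show ?thesis using False by (simp add: sgnp_def norm_mult)
qed (simp add: sgnp_def)

lemma mult_cnj_sgnp: "z * cnj (sgnp s z) = of_real (cmod z powr s)"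
proof (cases "z = 0")
  case False
  have "z * cnj (sgnp s z) = of_real ((cmod z)\<^sup>2 * cmod z powr (s - 2))"
    by (simp add: sgnp_def mult.assoc[symmetric] complex_norm_square del: of_real_power) 
  also have "(cmod z)\<^sup>2 * cmod z powr (s - 2) = cmod z powr s"
    using False by (simp add: powr_diff powr_numeral)
  finally show ?thesis .
qed (simp add: sgnp_def)

lemma continuous_on_sgnp:
  assumes "1 < s" shows "continuous_on UNIV (sgnp s)"
proof (rule continuous_at_imp_continuous_on, rule ballI)
  fix z
  show "isCont (sgnp s) z"
  proof (cases "z = 0")
    case False
    then show ?thesis unfolding sgnp_def[abs_def] by (intro continuous_intros) auto
  next
    case True
    have "((\<lambda>w. cmod w powr (s - 1)) \<longlongrightarrow> cmod 0 powr (s - 1)) (at 0)"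
      using assms by (intro tendsto_powr' tendsto_norm tendsto_ident_at tendsto_const) auto
    then have "((\<lambda>w. cmod (sgnp s w)) \<longlongrightarrow> 0) (at 0)" by (simp add: cmod_sgnp)
    then have "(sgnp s \<longlongrightarrow> 0) (at 0)" by (rule tendsto_norm_zero_cancel)
    then show ?thesis using True by (simp add: isCont_def sgnp_def)
  qed
qed

lemma integrable_if_nn_integral_le:
  fixes f :: "'a \<Rightarrow> real"
  assumes [measurable]: "f \<in> borel_measurable M" and f: "\<And>x. 0 \<le> f x" and le: "(\<integral>\<^sup>+x. ennreal (f x) \<partial>M) \<le> ennreal B" and B: "0 \<le> B"
  shows "integrable M f" "(\<integral>x. f x \<partial>M) \<le> B"
proof -
  show i: "integrable M f"
  proof (rule integrableI_bounded)
    have "(\<integral>\<^sup>+x. ennreal (norm (f x)) \<partial>M) \<le> ennreal B" using le f by simp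
    also have "\<dots> < \<infinity>" by simp
    finally show "(\<integral>\<^sup>+x. ennreal (norm (f x)) \<partial>M) < \<infinity>" .
  qed simp
  show "(\<integral>x. f x \<partial>M) \<le> B"
    using le nn_integral_eq_integral[OF i] f B by simp
qed

text \<open>The kernel is Hermitian, so the bound for the conjugate exponent
  \<open>q \<le> 2\<close> can be transposed. With \<open>g\<close> the transform of
  \<open>u\<close> and \<open>w\<close> the truncated dual function of \<open>g\<close>, the
  integral \<open>J\<close> of the truncated \<open>|g|^p\<close> is at most
  \<open>A powr (1 / p) * J powr (1 / q)\<close>. The truncation makes \<open>J\<close> finite
  before \<open>J powr (1 / q)\<close> is cancelled, since \<open>g\<close> is not yet known to be
  \<open>p\<close>-integrable.\<close>

lemma contraction_ge_2:
  fixes u :: "complex ^ 'n \<Rightarrow> complex"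
  assumes p: "2 \<le> p" and q: "1 < q" "1 / p + 1 / q = 1" and r: "0 \<le> r" "r \<le> 1" "r\<^sup>2 = 4 * (q - 1) / q\<^sup>2"
    and u: "continuous_on UNIV u" and le: "\<And>s. cmod (u s) \<le> U"
  shows "(\<integral>\<^sup>+x. ennreal (cmod (\<integral>y. u y * ker r x y \<partial>gauss 1) powr p) \<partial>gauss 1) \<le> (\<integral>\<^sup>+x. ennreal (cmod (u x) powr p) \<partial>gauss 1)"
proof -
  interpret prob_space "gauss 1 :: (complex ^ 'n) measure" by (rule prob_space_gauss) simp
  interpret P: pair_sigma_finite "gauss 1 :: (complex ^ 'n) measure" "gauss 1 :: (complex ^ 'n) measure"
    by (rule pair_sigma_finite_gauss)
  have p1: "1 < p" "0 < p" using p by auto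
  have pq: "p + q = p * q" using q p1 by (simp add: field_simps)
  have q2: "q \<le> 2"
  proof -
    have "1 / p \<le> 1 / 2" using p by (intro divide_left_mono) auto
    then have "1 / 2 \<le> 1 / q" using q(2) by linarith
    then show ?thesis using q(1) by (simp add: field_simps)
  qed
  have U0: "0 \<le> U" using le[of 0] norm_ge_zero order_trans by blast
  have [measurable]: "u \<in> borel_measurable borel" by (rule borel_measurable_continuous_onI[OF u])
  define g where "g x = (\<integral>y. u y * ker r x y \<partial>gauss 1)" for x
  have g_cont: "continuous_on UNIV g"
    unfolding g_def[abs_def] by (rule continuous_on_entire[OF entire_integral_ker[OF _ le r(1,2)]]) simp
  then have [measurable]: "g \<in> borel_measurable borel" by (rule borel_measurable_continuous_onI)
  have up_int: "integrable (gauss 1) (\<lambda>x. cmod (u x) powr p)"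
    by (rule integrable_const_bound[of _ "U powr p"]) (use le p1 in \<open>auto intro!: powr_mono2\<close>)
  define A where "A = (\<integral>x. cmod (u x) powr p \<partial>gauss 1)"
  have A0: "0 \<le> A" unfolding A_def by (intro integral_nonneg_AE) auto
  have A_nn: "(\<integral>\<^sup>+x. ennreal (cmod (u x) powr p) \<partial>gauss 1) = ennreal A"
    unfolding A_def by (rule nn_integral_eq_integral[OF up_int]) simp
  have main: "(\<integral>\<^sup>+x. ennreal (cutoff k x * cmod (g x) powr p) \<partial>gauss 1) \<le> ennreal A" for k
  proof -
    define w where "w x = of_real (cutoff k x) * sgnp p (g x)" for x
    have sg: "continuous_on UNIV (\<lambda>x. sgnp p (g x))"
      by (rule continuous_on_compose2[OF continuous_on_sgnp[OF p1(1)] g_cont]) auto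
    then have w_cont: "continuous_on UNIV w"
      unfolding w_def[abs_def] by (intro continuous_intros) auto
    then have [measurable]: "w \<in> borel_measurable borel" by (rule borel_measurable_continuous_onI)
    obtain B where B: "\<And>x. cmod (w x) \<le> B"
      unfolding w_def by (rule cutoff_mult_bounded[OF sg]) blast
    have B0: "0 \<le> B" using B[of 0] norm_ge_zero order_trans by blast
    have gw: "g x * cnj (w x) = of_real (cutoff k x * cmod (g x) powr p)" for x
      using mult_cnj_sgnp[of "g x" p] by (simp add: w_def mult_ac)
    have pq1: "(p - 1) * q = p" using pq by (simp add: algebra_simps)
    \<comment> \<open>A cutoff value lies in the unit interval and does not increase when raised to
      the power \<open>q\<close>, so \<open>J\<close> also controls the norm of
      \<open>w\<close>.\<close>
    have wq: "cmod (w x) powr q \<le> cutoff k x * cmod (g x) powr p" for x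
    proof -
      have "cmod (w x) powr q = cutoff k x powr q * cmod (g x) powr p"
        using cutoff_bounds[of k x] by (simp add: w_def norm_mult cmod_sgnp powr_mult powr_powr pq1)
      also have "\<dots> \<le> cutoff k x * cmod (g x) powr p"
      proof (rule mult_right_mono)
        show "cutoff k x powr q \<le> cutoff k x"
          using cutoff_bounds[of k x] q powr_mono'[of 1 q "cutoff k x"] by (cases "cutoff k x = 0") auto
      qed simp
      finally show ?thesis .
    qed
    have w_bd: "cmod (w x) powr p' \<le> B powr p'" if "0 < p'" for x p' using B that by (intro powr_mono2) auto
    define J where "J = (\<integral>x. cutoff k x * cmod (g x) powr p \<partial>gauss 1)"
    have gp: "continuous_on UNIV (\<lambda>x. complex_of_real (cmod (g x) powr p))"
      using p1 by (intro continuous_intros continuous_on_powr' g_cont) auto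
    obtain B2 where B2: "\<And>x. cmod (of_real (cutoff k x) * of_real (cmod (g x) powr p)) \<le> B2"
      by (rule cutoff_mult_bounded[OF gp]) blast
    have J_int: "integrable (gauss 1) (\<lambda>x. cutoff k x * cmod (g x) powr p)"
      by (rule integrable_const_bound[of _ B2]) (use B2 in \<open>auto simp: norm_mult abs_mult\<close>)
    have J0: "0 \<le> J" unfolding J_def by (intro integral_nonneg_AE AE_I2 mult_nonneg_nonneg cutoff_bounds) simp
    define Qw where "Qw y = (\<integral>x. w x * ker r y x \<partial>gauss 1)" for y
    have [measurable]: "Qw \<in> borel_measurable borel" unfolding Qw_def[abs_def] by measurable
    have wq_int: "integrable (gauss 1) (\<lambda>x. cmod (w x) powr q)"
      by (rule integrable_const_bound[of _ "B powr q"]) (use w_bd q in auto)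
    have "(\<integral>\<^sup>+y. ennreal (cmod (Qw y) powr q) \<partial>gauss 1) \<le> (\<integral>\<^sup>+x. ennreal (cmod (w x) powr q) \<partial>gauss 1)"
      unfolding Qw_def by (rule contraction_le_2[OF q(1) q2 r w_cont B])
    also have "\<dots> \<le> (\<integral>\<^sup>+x. ennreal (cutoff k x * cmod (g x) powr p) \<partial>gauss 1)"
      by (intro nn_integral_mono ennreal_leI wq)
    also have "\<dots> = ennreal J"
      unfolding J_def by (intro nn_integral_eq_integral J_int AE_I2 mult_nonneg_nonneg cutoff_bounds) simp
    finally have Qle: "(\<integral>\<^sup>+y. ennreal (cmod (Qw y) powr q) \<partial>gauss 1) \<le> ennreal J" .
    note Qint = integrable_if_nn_integral_le[OF _ _ Qle J0, simplified]
    have "of_real J = (\<integral>x. g x * cnj (w x) \<partial>gauss 1)"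
      unfolding gw J_def by (rule integral_complex_of_real[symmetric])
    also have "\<dots> = (\<integral>x. \<integral>y. u y * ker r x y * cnj (w x) \<partial>gauss 1 \<partial>gauss 1)"
      by (simp add: g_def)
    also have "\<dots> = (\<integral>y. \<integral>x. u y * ker r x y * cnj (w x) \<partial>gauss 1 \<partial>gauss 1)"
    proof (rule P.Fubini_integral[symmetric], rule integrable_pair_gauss_bound)
      fix x y :: "complex ^ 'n"
      have "cmod (u y * ker r x y * cnj (w x)) \<le> U * (exp (2/7 * (norm x)\<^sup>2) * exp (7/8 * (norm y)\<^sup>2)) * B"
        unfolding norm_mult complex_mod_cnj using U0 by (intro mult_mono le norm_ker_le r B) auto
      then show "norm (case (x, y) of (x, y) \<Rightarrow> u y * ker r x y * cnj (w x)) \<le> (U * B) * exp (2/7 * (norm x)\<^sup>2) * exp (7/8 * (norm y)\<^sup>2)"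
        by (simp add: mult_ac)
    qed (simp_all add: split_beta')
    also have "\<dots> = (\<integral>y. u y * cnj (Qw y) \<partial>gauss 1)"
    proof (rule Bochner_Integration.integral_cong[OF refl])
      fix y
      have "cnj (Qw y) = (\<integral>x. ker r x y * cnj (w x) \<partial>gauss 1)"
        unfolding Qw_def Bochner_Integration.integral_cnj[symmetric] by (simp add: cnj_ker mult.commute)
      then show "(\<integral>x. u y * ker r x y * cnj (w x) \<partial>gauss 1) = u y * cnj (Qw y)"
        by (simp add: mult.assoc)
    qed
    finally have "cmod (of_real J) = cmod (\<integral>y. u y * cnj (Qw y) \<partial>gauss 1)" by simp
    also have "\<dots> \<le> (\<integral>y. cmod (u y * cnj (Qw y)) \<partial>gauss 1)" by (rule integral_norm_bound)
    also have "\<dots> \<le> A powr (1 / p) * (\<integral>y. cmod (cnj (Qw y)) powr q \<partial>gauss 1) powr (1 / q)"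
      unfolding A_def by (rule Hoelder_integral[OF p1(1) q]) (use up_int Qint in auto)
    also have "\<dots> \<le> A powr (1 / p) * J powr (1 / q)"
      using Qint(2) q by (intro mult_left_mono powr_mono2) auto
    finally have JA: "J \<le> A powr (1 / p) * J powr (1 / q)" using J0 by simp
    have "J \<le> A"
    proof (cases "J = 0")
      case False
      then have Jpos: "0 < J" using J0 by simp
      have "J powr (1 / p) * J powr (1 / q) = J"
        using Jpos q(2) by (simp flip: powr_add)
      then have "J powr (1 / p) * J powr (1 / q) \<le> A powr (1 / p) * J powr (1 / q)" using JA by simp
      then have "J powr (1 / p) \<le> A powr (1 / p)" using Jpos by simp
      from powr_mono2[OF _ _ this, of p] have "(J powr (1 / p)) powr p \<le> (A powr (1 / p)) powr p" using p1 by simp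
      then show ?thesis using p1 J0 A0 by (simp add: powr_powr)
    qed (use A0 in simp)
    moreover have "(\<integral>\<^sup>+x. ennreal (cutoff k x * cmod (g x) powr p) \<partial>gauss 1) = ennreal J"
      unfolding J_def by (intro nn_integral_eq_integral J_int AE_I2 mult_nonneg_nonneg cutoff_bounds) simp
    ultimately show ?thesis by (simp add: ennreal_leI)
  qed
  have "(\<integral>\<^sup>+x. ennreal (cmod (g x) powr p) \<partial>gauss 1) \<le> ennreal A"
  proof (rule nn_integral_le_limit[OF _ _ main tendsto_const])
    fix x
    have "(\<lambda>k. cutoff k x * cmod (g x) powr p) \<longlonglongrightarrow> 1 * cmod (g x) powr p"
      by (intro tendsto_mult cutoff_tendsto tendsto_const)
    then show "(\<lambda>k. ennreal (cutoff k x * cmod (g x) powr p)) \<longlonglongrightarrow> ennreal (cmod (g x) powr p)"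
      by (intro tendsto_ennrealI) simp
  qed simp
  then show ?thesis by (simp add: g_def A_nn)
qed

section \<open>All exponents, unbounded functions, rescaling\<close>

text \<open>The two expressions for \<open>4 / (p * q)\<close> let one \<open>r\<close> serve both
  the direct case and the dual case, in which the exponents change roles. The bound
  \<open>4 \<le> p * q\<close> gives \<open>r \<le> 1\<close>, which the kernel estimates
  require.\<close>

lemma conjugate_exponents:
  fixes p q :: real
  assumes p: "1 < p" and pq: "1 / p + 1 / q = 1"
  shows "1 < q" "p + q = p * q" "4 / (p * q) = 4 * (p - 1) / p\<^sup>2" "4 / (p * q) = 4 * (q - 1) / q\<^sup>2" "4 \<le> p * q"
proof -
  have "0 < 1 / p" "1 / p < 1" using p by auto
  then have "0 < 1 / q" "1 / q < 1" using pq by linarith+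
  then show q: "1 < q" by (smt (verit) divide_less_eq_1 zero_less_divide_iff)
  show s: "p + q = p * q" using pq p q by (simp add: field_simps)
  have "q * (p - 1) = p" "p * (q - 1) = q" using s by (simp_all add: algebra_simps)
  then show "4 / (p * q) = 4 * (p - 1) / p\<^sup>2" "4 / (p * q) = 4 * (q - 1) / q\<^sup>2"
    using p q by (simp_all add: field_simps power2_eq_square)
  have "0 \<le> (p - q)\<^sup>2" by simp
  also have "(p - q)\<^sup>2 = (p + q) * (p * q) - 4 * (p * q)" unfolding s[symmetric] by (simp add: power2_eq_square algebra_simps) (use s in algebra)
  finally have "4 * (p * q) \<le> (p * q) * (p * q)" using s by simp
  then show "4 \<le> p * q" using p q by (simp add: mult_le_cancel_right)
qed

lemma contraction_bounded:
  fixes u :: "complex ^ 'n \<Rightarrow> complex"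
  assumes p: "1 < p" and pq: "1 / p + 1 / q = 1" and r: "0 \<le> r" "r\<^sup>2 = 4 / (p * q)"
    and u: "continuous_on UNIV u" and le: "\<And>s. cmod (u s) \<le> U"
  shows "(\<integral>\<^sup>+x. ennreal (cmod (\<integral>y. u y * ker r x y \<partial>gauss 1) powr p) \<partial>gauss 1) \<le> (\<integral>\<^sup>+x. ennreal (cmod (u x) powr p) \<partial>gauss 1)"
proof -
  note c = conjugate_exponents[OF p pq]
  have "r\<^sup>2 \<le> 1\<^sup>2" unfolding r(2) using c(5) by simp
  then have r1: "r \<le> 1" by (rule power2_le_imp_le) simp
  show ?thesis
  proof (cases "p \<le> 2")
    case True
    then show ?thesis using contraction_le_2[OF p True r(1) r1 _ u le] r(2) c(3) by simp
  next
    case False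
    then show ?thesis using contraction_ge_2[OF _ c(1) pq r(1) r1 _ u le] r(2) c(4) by simp
  qed
qed

lemma integrable_ker_powr:
  assumes r: "0 \<le> r" and q: "0 < q"
  shows "integrable (gauss 1) (\<lambda>y :: complex ^ 'n. cmod (ker r x y) powr q)"
proof (rule integrable_dominated[OF integrable_exp_norm[of "q * r * norm x"]])
  fix y
  have "Re (cip x y) \<le> norm x * norm y" using complex_Re_le_cmod[of "cip x y"] norm_cip_le[of x y] by linarith
  then have "q * (r * Re (cip x y)) \<le> q * (r * (norm x * norm y))" using r q by (intro mult_left_mono) auto
  then show "norm (cmod (ker r x y) powr q) \<le> exp (q * r * norm x * norm y)"
    by (simp add: ker_def exp_powr_real mult_ac)
qed measurable

text \<open>Boundedness of \<open>u\<close> is removed by truncation. The kernel is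
  \<open>q\<close>-integrable in \<open>y\<close>, so the transforms of the truncations converge
  pointwise by dominated convergence, and Fatou carries the estimate to the limit.\<close>

lemma contraction_continuous:
  fixes u :: "complex ^ 'n \<Rightarrow> complex"
  assumes p: "1 < p" and pq: "1 / p + 1 / q = 1" and r: "0 \<le> r" "r\<^sup>2 = 4 / (p * q)"
    and u: "continuous_on UNIV u" and int: "integrable (gauss 1) (\<lambda>x. cmod (u x) powr p)"
  shows "(\<integral>\<^sup>+x. ennreal (cmod (\<integral>y. u y * ker r x y \<partial>gauss 1) powr p) \<partial>gauss 1) \<le> (\<integral>\<^sup>+x. ennreal (cmod (u x) powr p) \<partial>gauss 1)"
    "integrable (gauss 1) (\<lambda>y. u y * ker r x y)"
proof -
  note c = conjugate_exponents[OF p pq]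
  have [measurable]: "u \<in> borel_measurable borel" by (rule borel_measurable_continuous_onI[OF u])
  show iuk: "integrable (gauss 1) (\<lambda>y. u y * ker r x y)" for x
    by (rule Hoelder_integral[OF p c(1) pq _ _ int integrable_ker_powr]) (use r c(1) in auto)
  show "(\<integral>\<^sup>+x. ennreal (cmod (\<integral>y. u y * ker r x y \<partial>gauss 1) powr p) \<partial>gauss 1) \<le> (\<integral>\<^sup>+x. ennreal (cmod (u x) powr p) \<partial>gauss 1)"
  proof (rule nn_integral_le_limit[OF _ _ _ tendsto_const])
    fix k
    define uk where "uk y = of_real (cutoff k y) * u y" for y
    have uk: "continuous_on UNIV uk" unfolding uk_def[abs_def] by (intro continuous_intros u)
    obtain B where B: "\<And>x. cmod (uk x) \<le> B" unfolding uk_def by (rule cutoff_mult_bounded[OF u]) blast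
    have uk_le: "cmod (uk x) \<le> cmod (u x)" for x
      using cutoff_bounds[of k x] by (simp add: uk_def norm_mult mult_left_le_one_le)
    have "(\<integral>\<^sup>+x. ennreal (cmod (\<integral>y. uk y * ker r x y \<partial>gauss 1) powr p) \<partial>gauss 1) \<le> (\<integral>\<^sup>+x. ennreal (cmod (uk x) powr p) \<partial>gauss 1)"
      by (rule contraction_bounded[OF p pq r uk B])
    also have "\<dots> \<le> (\<integral>\<^sup>+x. ennreal (cmod (u x) powr p) \<partial>gauss 1)"
      using p by (intro nn_integral_mono ennreal_leI powr_mono2 uk_le) auto
    finally show "(\<integral>\<^sup>+x. ennreal (cmod (\<integral>y. of_real (cutoff k y) * u y * ker r x y \<partial>gauss 1) powr p) \<partial>gauss 1) \<le> (\<integral>\<^sup>+x. ennreal (cmod (u x) powr p) \<partial>gauss 1)"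
      by (simp add: uk_def)
  next
    fix x :: "complex ^ 'n"
    have "(\<lambda>k. \<integral>y. of_real (cutoff k y) * u y * ker r x y \<partial>gauss 1) \<longlonglongrightarrow> (\<integral>y. u y * ker r x y \<partial>gauss 1)"
    proof (rule integral_dominated_convergence[OF _ _ integrable_norm[OF iuk[of x]]])
      show "AE y in gauss 1. (\<lambda>k. of_real (cutoff k y) * u y * ker r x y) \<longlonglongrightarrow> u y * ker r x y"
      proof (rule AE_I2)
        fix y :: "complex ^ 'n"
        have "(\<lambda>k. of_real (cutoff k y) * u y * ker r x y) \<longlonglongrightarrow> of_real 1 * u y * ker r x y"
          by (intro tendsto_mult tendsto_of_real cutoff_tendsto tendsto_const)
        then show "(\<lambda>k. of_real (cutoff k y) * u y * ker r x y) \<longlonglongrightarrow> u y * ker r x y" by simp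
      qed
      show "AE y in gauss 1. cmod (of_real (cutoff k y) * u y * ker r x y) \<le> norm (u y * ker r x y)" for k
        by (intro AE_I2) (simp add: norm_mult mult.assoc mult_left_le_one_le cutoff_bounds)
    qed measurable
    then show "(\<lambda>k. ennreal (cmod (\<integral>y. of_real (cutoff k y) * u y * ker r x y \<partial>gauss 1) powr p)) \<longlonglongrightarrow> ennreal (cmod (\<integral>y. u y * ker r x y \<partial>gauss 1) powr p)"
      using p by (intro tendsto_ennrealI tendsto_powr' tendsto_norm tendsto_const) auto
  qed measurable
qed

lemma gauss_scale_integral:
  assumes b: "0 < b"
  shows "f \<in> borel_measurable borel \<Longrightarrow> (\<integral>\<^sup>+z. f z \<partial>(gauss b :: (complex ^ 'n) measure)) = (\<integral>\<^sup>+z. f ((1 / sqrt b) *\<^sub>R z) \<partial>gauss 1)"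
    "g \<in> borel_measurable borel \<Longrightarrow> (\<integral>z. (g z :: 'b::{banach, second_countable_topology}) \<partial>(gauss b :: (complex ^ 'n) measure)) = (\<integral>z. g ((1 / sqrt b) *\<^sub>R z) \<partial>gauss 1)"
    "g \<in> borel_measurable borel \<Longrightarrow> integrable (gauss b :: (complex ^ 'n) measure) g \<longleftrightarrow> integrable (gauss 1) (\<lambda>z. g ((1 / sqrt b) *\<^sub>R z))"
  unfolding gauss_scale[OF b, where 'n = 'n]
  by (simp_all add: nn_integral_distr integral_distr integrable_distr_eq)

text \<open>After rescaling to \<^term>\<open>gauss 1\<close> the kernel is \<^term>\<open>ker (2 / sqrt (p * q))\<close>.\<close>

lemma contraction_kernel:
  fixes u :: "complex ^ 'n \<Rightarrow> complex"
  assumes p: "1 < p" and pq: "1 / p + 1 / q = 1" and al: "0 < \<alpha>"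
    and u: "continuous_on UNIV u" and int: "integrable (gauss (\<alpha> * q / 2)) (\<lambda>x. cmod (u x) powr p)"
  shows "(\<integral>\<^sup>+z. ennreal (cmod (\<integral>w. u w * exp (of_real \<alpha> * cip z w) \<partial>gauss (\<alpha> * q / 2)) powr p) \<partial>gauss (\<alpha> * p / 2))
      \<le> (\<integral>\<^sup>+w. ennreal (cmod (u w) powr p) \<partial>gauss (\<alpha> * q / 2))" (is ?thesis1)
    "integrable (gauss (\<alpha> * q / 2)) (\<lambda>w. u w * exp (of_real \<alpha> * cip z w))" (is ?thesis2)
proof -
  note c = conjugate_exponents[OF p pq]
  define b where "b = \<alpha> * q / 2"
  define b' where "b' = \<alpha> * p / 2"
  have b: "0 < b" "0 < b'" using al p c by (auto simp: b_def b'_def)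
  define r where "r = 2 / sqrt (p * q)"
  have r: "0 \<le> r" "r\<^sup>2 = 4 / (p * q)" using p c by (auto simp: r_def power_divide)
  \<comment> \<open>Rescaling divides \<alpha> by
    \<open>sqrt b' * sqrt b = \<alpha> / 2 * sqrt (p * q)\<close>. The result is precisely the
    extreme \<open>r\<close> for which the contraction was shown.\<close>
  have r_eq: "r = \<alpha> * (1 / sqrt b') * (1 / sqrt b)"
  proof -
    have "sqrt b' * sqrt b = sqrt ((\<alpha> / 2)\<^sup>2 * (p * q))"
      unfolding real_sqrt_mult[symmetric] by (simp add: b_def b'_def power2_eq_square mult_ac)
    also have "\<dots> = \<alpha> / 2 * sqrt (p * q)" using al by (simp add: real_sqrt_mult)
    finally have "sqrt b' * sqrt b = \<alpha> / 2 * sqrt (p * q)" .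
    moreover have "\<alpha> * (1 / sqrt b') * (1 / sqrt b) = \<alpha> / (sqrt b' * sqrt b)" by simp
    ultimately have "\<alpha> * (1 / sqrt b') * (1 / sqrt b) = \<alpha> / (\<alpha> / 2 * sqrt (p * q))" by (simp only:)
    then show ?thesis using al by (simp add: r_def)
  qed
  have [measurable]: "u \<in> borel_measurable borel" by (rule borel_measurable_continuous_onI[OF u])
  define v where "v y = u ((1 / sqrt b) *\<^sub>R y)" for y
  have v: "continuous_on UNIV v"
    unfolding v_def[abs_def] by (intro continuous_on_compose2[OF u] continuous_intros) auto
  have vint: "integrable (gauss 1) (\<lambda>x. cmod (v x) powr p)"
    using int unfolding b_def[symmetric] by (subst (asm) gauss_scale_integral(3)[OF b(1)]) (auto simp: v_def)
  have ker_eq: "exp (of_real \<alpha> * cip ((1 / sqrt b') *\<^sub>R x) ((1 / sqrt b) *\<^sub>R y)) = ker r x y" for x y :: "complex ^ 'n"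
    unfolding ker_def r_eq by (simp only: cip_simps of_real_mult mult_ac)
  have T: "(\<integral>w. u w * exp (of_real \<alpha> * cip ((1 / sqrt b') *\<^sub>R x) w) \<partial>gauss b) = (\<integral>y. v y * ker r x y \<partial>gauss 1)" for x
    by (subst gauss_scale_integral(2)[OF b(1)]) (simp_all only: ker_eq v_def, measurable)
  have "(\<integral>\<^sup>+z. ennreal (cmod (\<integral>w. u w * exp (of_real \<alpha> * cip z w) \<partial>gauss b) powr p) \<partial>gauss b')
    = (\<integral>\<^sup>+x. ennreal (cmod (\<integral>y. v y * ker r x y \<partial>gauss 1) powr p) \<partial>gauss 1)"
  proof (subst gauss_scale_integral(1)[OF b(2)])
    have "(\<lambda>z. \<integral>y. u ((1 / sqrt b) *\<^sub>R y) * exp (of_real \<alpha> * cip z ((1 / sqrt b) *\<^sub>R y)) \<partial>gauss 1) \<in> borel_measurable borel"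
      by measurable
    moreover have "(\<integral>w. u w * exp (of_real \<alpha> * cip z w) \<partial>gauss b) = (\<integral>y. u ((1 / sqrt b) *\<^sub>R y) * exp (of_real \<alpha> * cip z ((1 / sqrt b) *\<^sub>R y)) \<partial>gauss 1)" for z
      by (subst gauss_scale_integral(2)[OF b(1)]) simp_all
    ultimately show "(\<lambda>z. ennreal (cmod (\<integral>w. u w * exp (of_real \<alpha> * cip z w) \<partial>gauss b) powr p)) \<in> borel_measurable borel"
      by simp
  qed (simp only: T)
  also have "\<dots> \<le> (\<integral>\<^sup>+x. ennreal (cmod (v x) powr p) \<partial>gauss 1)"
    by (rule contraction_continuous(1)[OF p pq r v vint])
  also have "\<dots> = (\<integral>\<^sup>+w. ennreal (cmod (u w) powr p) \<partial>gauss b)"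
    by (subst gauss_scale_integral(1)[OF b(1)]) (simp_all add: v_def)
  finally show ?thesis1 unfolding b_def b'_def .
  have "integrable (gauss b) (\<lambda>w. u w * exp (of_real \<alpha> * cip z w)) \<longleftrightarrow> integrable (gauss 1) (\<lambda>y. v y * ker r (sqrt b' *\<^sub>R z) y)"
    using ker_eq[of "sqrt b' *\<^sub>R z"] b by (subst gauss_scale_integral(3)[OF b(1)]) (simp_all add: v_def)
  then show ?thesis2 unfolding b_def[symmetric] using contraction_continuous(2)[OF p pq r v vint] by simp
qed

section \<open>The spaces and the pairing\<close>

lemma integrable_gauss_exp_norm:
  fixes b K :: real
  assumes b: "0 < b" shows "integrable (gauss b) (\<lambda>y :: complex ^ 'n. exp (K * norm y))"
proof (rule integrable_gauss_bound[OF _ b])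
  show "norm (exp (K * norm y)) \<le> exp (K\<^sup>2 / (4 * (b / 2))) * exp (b / 2 * (norm y)\<^sup>2)" for y :: "complex ^ 'n"
    using exp_mult_le[of "b / 2" K "norm y"] b by simp
qed (use b in auto)

lemma square_exp_le: "0 \<le> x \<Longrightarrow> x\<^sup>2 * exp (K * x) \<le> 2 * exp ((K + 1) * x)" for x K :: real
proof -
  assume x: "0 \<le> x"
  have "x\<^sup>2 \<le> 2 * exp x" using exp_lower_Taylor_quadratic[OF x] x by linarith
  then have "x\<^sup>2 * exp (K * x) \<le> 2 * exp x * exp (K * x)" by (intro mult_right_mono) auto
  then show ?thesis by (simp add: algebra_simps exp_add)
qed

lemma linear_exp_le: "0 \<le> x \<Longrightarrow> x * exp (K * x) \<le> exp ((K + 1) * x)" for x K :: real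
proof -
  assume x: "0 \<le> x"
  have "x \<le> exp x" using exp_ge_add_one_self[of x] by linarith
  then have "x * exp (K * x) \<le> exp x * exp (K * x)" by (intro mult_right_mono) auto
  then show ?thesis by (simp add: algebra_simps exp_add)
qed

text \<open>Exponential growth is harmless against a Gaussian weight. This places coherent states,
  their derivatives in the label and transforms of compactly supported functions in the
  spaces.\<close>

lemma Lp_holI:
  assumes "entire f" "0 < b" "0 < p" and le: "\<And>z. cmod (f z) \<le> D * exp (K * norm z)"
  shows "f \<in> Lp_hol p (gauss b)"
proof -
  have D: "0 \<le> D"
    using order_trans[OF norm_ge_zero le[of 0]] by simp
  have "integrable (gauss b) (\<lambda>z. cmod (f z) powr p)"
  proof (rule integrable_dominated)
    show "integrable (gauss b) (\<lambda>z :: complex ^ 'b. D powr p * exp (p * K * norm z))"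
      using integrable_gauss_exp_norm[OF assms(2), of "p * K", where 'n = 'b] by simp
    show "norm (cmod (f z) powr p) \<le> D powr p * exp (p * K * norm z)" for z
    proof -
      have "cmod (f z) powr p \<le> (D * exp (K * norm z)) powr p" using assms(3) by (intro powr_mono2 le) auto
      also have "\<dots> = D powr p * exp (p * K * norm z)" using D by (simp add: powr_mult exp_powr_real mult_ac)
      finally show ?thesis by simp
    qed
    show "(\<lambda>z. cmod (f z) powr p) \<in> borel_measurable (gauss b)" 
      using borel_measurable_entire[OF assms(1)] by simp
  qed
  then show ?thesis using assms(1) by (simp add: Lp_hol_def)
qed

text \<open>The factor \<open>e\<close> is kept apart from the profile \<open>d\<close> so that a
  remainder of the form \<open>(norm h)\<^sup>2 * d z\<close> has a norm of order
  \<open>(norm h)\<^sup>2\<close>.\<close>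

lemma Lp_norm_dominated:
  fixes f :: "'a \<Rightarrow> complex"
  assumes p: "0 < p" and [measurable]: "f \<in> borel_measurable M" and le: "\<And>z. cmod (f z) \<le> e * d z" and e: "0 \<le> e" and d: "\<And>z. 0 \<le> d z"
    and int: "integrable M (\<lambda>z. d z powr p)"
  shows "Lp_norm p M f \<le> e * (\<integral>z. d z powr p \<partial>M) powr (1 / p)"
proof -
  have *: "cmod (f z) powr p \<le> e powr p * d z powr p" for z
    unfolding powr_mult[symmetric] using p by (intro powr_mono2 le) auto
  have i: "integrable M (\<lambda>z. cmod (f z) powr p)"
    by (rule integrable_dominated[of _ "\<lambda>z. e powr p * d z powr p"]) (use int * in auto)
  have "(\<integral>z. cmod (f z) powr p \<partial>M) \<le> (\<integral>z. e powr p * d z powr p \<partial>M)"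
    by (intro integral_mono i * integrable_mult_right int)
  then have "Lp_norm p M f \<le> (\<integral>z. e powr p * d z powr p \<partial>M) powr (1 / p)"
    unfolding Lp_norm_def using p by (intro powr_mono2) (auto intro!: integral_nonneg_AE)
  also have "\<dots> = e * (\<integral>z. d z powr p \<partial>M) powr (1 / p)"
    using p e d by (simp add: powr_mult integral_nonneg_AE powr_powr)
  finally show ?thesis .
qed

lemma Lp_hol_add:
  assumes p: "0 < p" and "f \<in> Lp_hol p (gauss b)" "g \<in> Lp_hol p (gauss b)"
  shows "(\<lambda>z. f z + g z) \<in> Lp_hol p (gauss b)"
proof -
  have fg: "entire f" "entire g" "integrable (gauss b) (\<lambda>z. cmod (f z) powr p)" "integrable (gauss b) (\<lambda>z. cmod (g z) powr p)"
    using assms by (auto simp: Lp_hol_def)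
  have [measurable]: "f \<in> borel_measurable borel" "g \<in> borel_measurable borel" using fg by (auto intro: borel_measurable_entire)
  have "integrable (gauss b) (\<lambda>z. cmod (f z + g z) powr p)"
  proof (rule integrable_dominated)
    show "integrable (gauss b) (\<lambda>z. 2 powr p * (cmod (f z) powr p + cmod (g z) powr p))"
      using fg by simp
    fix z
    have "cmod (f z + g z) \<le> 2 * max (cmod (f z)) (cmod (g z))"
      using norm_triangle_ineq[of "f z" "g z"] by linarith
    then have "cmod (f z + g z) powr p \<le> (2 * max (cmod (f z)) (cmod (g z))) powr p"
      using p by (intro powr_mono2) auto
    also have "\<dots> = 2 powr p * max (cmod (f z)) (cmod (g z)) powr p" by (rule powr_mult)
    also have "\<dots> \<le> 2 powr p * (cmod (f z) powr p + cmod (g z) powr p)"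
      by (intro mult_left_mono) (auto simp: max_def)
    finally show "norm (cmod (f z + g z) powr p) \<le> 2 powr p * (cmod (f z) powr p + cmod (g z) powr p)" by simp
  qed measurable
  then show ?thesis using fg by (simp add: Lp_hol_def entire_add)
qed

lemma Lp_hol_mult:
  assumes "f \<in> Lp_hol p (gauss b)"
  shows "(\<lambda>z. c * f z) \<in> Lp_hol p (gauss b)"
  using assms by (auto simp: Lp_hol_def norm_mult powr_mult intro: entire_mult entire_const)

lemma Lp_norm_mult:
  assumes "0 < p" shows "Lp_norm p M (\<lambda>z. c * f z) = cmod c * Lp_norm p M f"
  using assms by (simp add: Lp_norm_def norm_mult powr_mult integral_nonneg_AE powr_powr)

lemma Lp_hol_diff:
  assumes p: "0 < p" and "f \<in> Lp_hol p (gauss b)" "g \<in> Lp_hol p (gauss b)"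
  shows "(\<lambda>z. f z - g z) \<in> Lp_hol p (gauss b)"
  using Lp_hol_add[OF p assms(2) Lp_hol_mult[OF assms(3), of "-1"]] by simp

lemma Lp_hol_0: "(\<lambda>z. 0) \<in> Lp_hol p (gauss b)"
  by (simp add: Lp_hol_def entire_const)

lemma Lp_hol_sum:
  assumes p: "0 < p" and "finite S" "\<And>v. v \<in> S \<Longrightarrow> f v \<in> Lp_hol p (gauss b)"
  shows "(\<lambda>z. \<Sum>v\<in>S. c v * f v z) \<in> Lp_hol p (gauss b)"
  using assms(2,3)
proof (induction S rule: finite_induct)
  case empty
  then show ?case by (simp add: Lp_hol_0)
next
  case (insert v S)
  then show ?case using Lp_hol_add[OF p Lp_hol_mult[of "f v"], of b "\<lambda>z. \<Sum>v\<in>S. c v * f v z" "c v"] by simp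
qed

section \<open>Coherent states\<close>

text \<open>The reproducing kernel of \<open>gauss \<alpha>\<close>, entire in \<open>z\<close> and
  antiholomorphic in \<open>w\<close>. The label \<open>w\<close> comes first so that
  \<open>coherent \<alpha> w\<close> is an element of the space.\<close>

definition coherent :: "real \<Rightarrow> complex ^ 'n \<Rightarrow> complex ^ 'n \<Rightarrow> complex" where
  "coherent \<alpha> w z = exp (of_real \<alpha> * cip z w)"

lemma coherent_measurable[measurable (raw)]:
  assumes [measurable]: "f \<in> borel_measurable M" "g \<in> borel_measurable M"
  shows "(\<lambda>x. coherent \<alpha> (f x) (g x)) \<in> borel_measurable M"
  unfolding coherent_def by measurable

lemma cnj_coherent: "cnj (coherent \<alpha> w z) = coherent \<alpha> z w"
  by (simp add: coherent_def exp_cnj cnj_cip)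

lemma norm_coherent_le: "0 \<le> \<alpha> \<Longrightarrow> norm w \<le> R \<Longrightarrow> cmod (coherent \<alpha> w z) \<le> exp (\<alpha> * R * norm z)"
proof -
  assume a: "0 \<le> \<alpha>" and w: "norm w \<le> R"
  have "Re (cip z w) \<le> norm z * norm w" using complex_Re_le_cmod[of "cip z w"] norm_cip_le[of z w] by linarith
  also have "\<dots> \<le> norm z * R" using w by (intro mult_left_mono) auto
  finally have "\<alpha> * Re (cip z w) \<le> \<alpha> * (norm z * R)" using a by (intro mult_left_mono) auto
  then show ?thesis by (simp add: coherent_def mult_ac)
qed

lemma entire_coherent: "entire (coherent \<alpha> w)"
  unfolding coherent_def[abs_def] by (rule entire_exp[OF entire_mult[OF entire_const entire_cip]])

lemma coherent_Lp_hol: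
  assumes "0 < \<alpha>" "0 < b" "0 < p" shows "coherent \<alpha> w \<in> Lp_hol p (gauss b)"
  using norm_coherent_le[of \<alpha> w "norm w"] assms
  by (intro Lp_holI[OF entire_coherent, where D = 1 and K = "\<alpha> * norm w"]) auto

lemma cip_coherent_Lp_hol:
  assumes "0 < \<alpha>" "0 < b" "0 < p" shows "(\<lambda>z. of_real \<alpha> * cip z h * coherent \<alpha> w z) \<in> Lp_hol p (gauss b)"
proof (rule Lp_holI[OF _ assms(2,3)])
  show "entire (\<lambda>z. of_real \<alpha> * cip z h * coherent \<alpha> w z)"
    by (intro entire_mult entire_const entire_cip entire_coherent)
  fix z
  have "cmod (of_real \<alpha> * cip z h * coherent \<alpha> w z) \<le> \<alpha> * (norm z * norm h) * exp (\<alpha> * norm w * norm z)"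
    unfolding norm_mult norm_of_real using assms by (intro mult_mono norm_cip_le norm_coherent_le) auto
  also have "\<dots> = \<alpha> * norm h * (norm z * exp (\<alpha> * norm w * norm z))" by simp
  also have "\<dots> \<le> \<alpha> * norm h * exp ((\<alpha> * norm w + 1) * norm z)"
    using assms by (intro mult_left_mono linear_exp_le) auto
  finally show "cmod (of_real \<alpha> * cip z h * coherent \<alpha> w z) \<le> \<alpha> * norm h * exp ((\<alpha> * norm w + 1) * norm z)" .
qed

text \<open>The profile in \<open>z\<close> grows only exponentially and does not depend on
  \<open>h\<close>; so pointwise differentiability in the label becomes differentiability in the
  norm of the space.\<close>

lemma coherent_remainder:
  assumes a: "0 < \<alpha>" and h: "norm h \<le> 1"
  shows "cmod (coherent \<alpha> (w + h) z - coherent \<alpha> w z - of_real \<alpha> * cip z h * coherent \<alpha> w z)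
    \<le> (norm h)\<^sup>2 * (2 * \<alpha>\<^sup>2 * exp ((\<alpha> * (norm w + 1) + 1) * norm z))"
proof -
  define x where "x = of_real \<alpha> * cip z h"
  have "coherent \<alpha> (w + h) z - coherent \<alpha> w z - x * coherent \<alpha> w z = coherent \<alpha> w z * (exp x - 1 - x)"
    by (simp add: coherent_def x_def cip_simps exp_add algebra_simps)
  moreover have x: "cmod x \<le> norm h * (\<alpha> * norm z)"
    using mult_left_mono[OF norm_cip_le[of z h], of \<alpha>] a by (simp add: x_def norm_mult mult_ac)
  moreover have "cmod (exp x - 1 - x) \<le> (norm h * (\<alpha> * norm z))\<^sup>2 * exp (\<alpha> * norm z)"
  proof -
    have "norm h * (\<alpha> * norm z) \<le> 1 * (\<alpha> * norm z)" using h a by (intro mult_right_mono) auto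
    then have "cmod x \<le> \<alpha> * norm z" using x by linarith
    then have "(cmod x)\<^sup>2 * exp (cmod x) \<le> (norm h * (\<alpha> * norm z))\<^sup>2 * exp (\<alpha> * norm z)"
      using power_mono[OF x, of 2] by (intro mult_mono) auto
    then show ?thesis using norm_exp_minus_linear_le[of x] by linarith
  qed
  ultimately have "cmod (coherent \<alpha> (w + h) z - coherent \<alpha> w z - x * coherent \<alpha> w z) 
      \<le> exp (\<alpha> * norm w * norm z) * ((norm h * (\<alpha> * norm z))\<^sup>2 * exp (\<alpha> * norm z))"
    using norm_coherent_le[of \<alpha> w "norm w" z] a by (simp only: norm_mult) (intro mult_mono, auto)
  also have "\<dots> = (norm h)\<^sup>2 * \<alpha>\<^sup>2 * ((norm z)\<^sup>2 * exp ((\<alpha> * (norm w + 1)) * norm z))"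
    by (simp add: power_mult_distrib algebra_simps exp_add)
  also have "\<dots> \<le> (norm h)\<^sup>2 * \<alpha>\<^sup>2 * (2 * exp ((\<alpha> * (norm w + 1) + 1) * norm z))"
    by (intro mult_left_mono square_exp_le) auto
  finally show ?thesis by (simp add: x_def mult_ac)
qed

section \<open>Upper bound and reproducing formula on the spaces\<close>

lemma powr_nat_swap: "0 \<le> x \<Longrightarrow> (x ^ n) powr c = (x powr c) ^ n" for x c :: real
  by (induction n) (auto simp: powr_mult)

text \<open>Each function absorbs half of the weight of \<open>gauss \<alpha>\<close>; its Lebesgue
  norm is then its Gaussian norm times a power of \<open>2 * pi / (\<alpha> * s)\<close>, which
  stems from the inverse normalisation of \<open>gauss (\<alpha> * s / 2)\<close>. As
  \<open>1 / p\<close> and \<open>1 / q\<close> add up to one, \<alpha> and \<open>pi\<close>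
  cancel, and \<open>2 / (p powr (1 / p) * q powr (1 / q))\<close> is left in each complex
  dimension.\<close>

lemma Hoelder_gauss:
  fixes f h :: "complex ^ 'n \<Rightarrow> complex"
  assumes p: "1 < p" and pq: "1 / p + 1 / q = 1" and a: "0 < \<alpha>"
    and f: "f \<in> Lp_hol p (gauss (\<alpha> * p / 2))" and h: "h \<in> Lp_hol q (gauss (\<alpha> * q / 2))"
  shows "integrable (gauss \<alpha>) (\<lambda>z. f z * cnj (h z))"
    "cmod (pairing \<alpha> f h) \<le> (2 * (1 / p powr (1 / p)) * (1 / q powr (1 / q))) ^ CARD('n)
      * Lp_norm p (gauss (\<alpha> * p / 2)) f * Lp_norm q (gauss (\<alpha> * q / 2)) h"
proof -
  note c = conjugate_exponents[OF p pq]
  have m[measurable]: "f \<in> borel_measurable borel" "h \<in> borel_measurable borel"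
    using f h by (auto simp: Lp_hol_def intro: borel_measurable_entire)
  define F where "F z = of_real (exp (- (\<alpha> / 2) * (norm z)\<^sup>2)) * f z" for z
  define H where "H z = of_real (exp (- (\<alpha> / 2) * (norm z)\<^sup>2)) * cnj (h z)" for z
  have [measurable]: "F \<in> borel_measurable borel" "H \<in> borel_measurable borel"
    unfolding F_def[abs_def] H_def[abs_def] by measurable
  \<comment> \<open>Stated for a general exponent \<open>s\<close>: it is used for \<open>F\<close>
    with \<open>p\<close> and for \<open>H\<close> with \<open>q\<close>.\<close>
  have norms: "integrable lborel (\<lambda>z. cmod (G z) powr s)" 
    "(\<integral>z. cmod (G z) powr s \<partial>lborel) powr (1 / s) = ((2 * pi / (\<alpha> * s)) powr (1 / s)) ^ CARD('n) * Lp_norm s (gauss (\<alpha> * s / 2)) g"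
    if s: "1 < s" and g: "integrable (gauss (\<alpha> * s / 2)) (\<lambda>z. cmod (g z) powr s)" and [measurable]: "g \<in> borel_measurable borel"
      and G: "\<And>z. cmod (G z) = exp (- (\<alpha> / 2) * (norm z)\<^sup>2) * cmod (g z)" for s and G g :: "complex ^ 'n \<Rightarrow> complex"
  proof -
    have b: "0 < \<alpha> * s / 2" using a s by simp
    have eq: "cmod (G z) powr s = (2 * pi / (\<alpha> * s)) ^ CARD('n) * (gauss_dens (\<alpha> * s / 2) z *\<^sub>R cmod (g z) powr s)" for z
    proof -
      have "cmod (G z) powr s = exp (- (\<alpha> * s / 2) * (norm z)\<^sup>2) * cmod (g z) powr s"
        unfolding G by (simp add: powr_mult exp_powr_real)
      moreover have "(2 * pi / (\<alpha> * s)) ^ CARD('n) * (\<alpha> * s / 2 / pi) ^ CARD('n) = 1"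
      proof -
        have "2 * pi / (\<alpha> * s) * (\<alpha> * s / 2 / pi) = 1" using a s by simp
        then show ?thesis by (simp only: power_mult_distrib[symmetric] power_one)
      qed
      ultimately show ?thesis by (simp add: gauss_dens_def)
    qed
    have "integrable lborel (\<lambda>z. gauss_dens (\<alpha> * s / 2) z *\<^sub>R cmod (g z) powr s)"
      using g by (subst (asm) integrable_gauss_iff) (use b in auto)
    then show "integrable lborel (\<lambda>z. cmod (G z) powr s)" unfolding eq by (rule integrable_mult_right)
    have "(\<integral>z. cmod (G z) powr s \<partial>lborel) = (2 * pi / (\<alpha> * s)) ^ CARD('n) * (\<integral>z. cmod (g z) powr s \<partial>gauss (\<alpha> * s / 2))"
      unfolding eq by (subst integral_gauss) (use b in auto)
    then show "(\<integral>z. cmod (G z) powr s \<partial>lborel) powr (1 / s) = ((2 * pi / (\<alpha> * s)) powr (1 / s)) ^ CARD('n) * Lp_norm s (gauss (\<alpha> * s / 2)) g"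
      using a s by (simp add: Lp_norm_def powr_mult integral_nonneg_AE powr_nat_swap)
  qed
  have F: "cmod (F z) = exp (- (\<alpha> / 2) * (norm z)\<^sup>2) * cmod (f z)" and H: "cmod (H z) = exp (- (\<alpha> / 2) * (norm z)\<^sup>2) * cmod (h z)" for z
    by (simp_all add: F_def H_def norm_mult)
  have fh: "integrable (gauss (\<alpha> * p / 2)) (\<lambda>z. cmod (f z) powr p)" "integrable (gauss (\<alpha> * q / 2)) (\<lambda>z. cmod (h z) powr q)"
    using f h by (auto simp: Lp_hol_def)
  note nF = norms[OF p fh(1) m(1) F] and nH = norms[OF c(1) fh(2) m(2) H]
  have eq: "gauss_dens \<alpha> z *\<^sub>R (f z * cnj (h z)) = of_real ((\<alpha> / pi) ^ CARD('n)) * (F z * H z)" for z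
  proof -
    have "exp (- \<alpha> * (norm z)\<^sup>2) = exp (- (\<alpha> / 2) * (norm z)\<^sup>2) * exp (- (\<alpha> / 2) * (norm z)\<^sup>2)"
      by (simp flip: exp_add)
    then show ?thesis unfolding gauss_dens_def F_def H_def by (simp add: scaleR_conv_of_real)
  qed
  have FH: "integrable lborel (\<lambda>z. F z * H z)"
    "(\<integral>z. cmod (F z * H z) \<partial>lborel) \<le> (\<integral>z. cmod (F z) powr p \<partial>lborel) powr (1 / p) * (\<integral>z. cmod (H z) powr q \<partial>lborel) powr (1 / q)"
    by (rule Hoelder_integral[OF p c(1) pq _ _ nF(1) nH(1)]; simp)+
  show "integrable (gauss \<alpha>) (\<lambda>z. f z * cnj (h z))"
    by (subst integrable_gauss_iff) (use a FH in \<open>simp_all add: eq\<close>)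
  have "pairing \<alpha> f h = of_real ((\<alpha> / pi) ^ CARD('n)) * (\<integral>z. F z * H z \<partial>lborel)"
    unfolding pairing_def by (subst integral_gauss) (use a in \<open>simp_all only: eq, simp_all\<close>)
  then have "cmod (pairing \<alpha> f h) = (\<alpha> / pi) ^ CARD('n) * cmod (\<integral>z. F z * H z \<partial>lborel)"
    using a by (simp add: norm_mult norm_power norm_divide)
  also have "\<dots> \<le> (\<alpha> / pi) ^ CARD('n) * (\<integral>z. cmod (F z * H z) \<partial>lborel)"
    using a by (intro mult_left_mono integral_norm_bound) auto
  also have "\<dots> \<le> (\<alpha> / pi) ^ CARD('n) * ((((2 * pi / (\<alpha> * p)) powr (1 / p)) ^ CARD('n) * Lp_norm p (gauss (\<alpha> * p / 2)) f)
       * (((2 * pi / (\<alpha> * q)) powr (1 / q)) ^ CARD('n) * Lp_norm q (gauss (\<alpha> * q / 2)) h))"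
    using a FH(2) unfolding nF(2) nH(2) by (intro mult_left_mono) auto
  also have "\<dots> = (\<alpha> / pi * (2 * pi / (\<alpha> * p)) powr (1 / p) * (2 * pi / (\<alpha> * q)) powr (1 / q)) ^ CARD('n)
      * Lp_norm p (gauss (\<alpha> * p / 2)) f * Lp_norm q (gauss (\<alpha> * q / 2)) h"
    by (simp only: power_mult_distrib mult_ac)
  also have "\<alpha> / pi * (2 * pi / (\<alpha> * p)) powr (1 / p) * (2 * pi / (\<alpha> * q)) powr (1 / q) = 2 * (1 / p powr (1 / p)) * (1 / q powr (1 / q))"
  proof -
    have "(2 * pi / (\<alpha> * s)) powr (1 / s) = (2 * pi / \<alpha>) powr (1 / s) / s powr (1 / s)" if "1 < s" for s
      using a that powr_divide[of "2 * pi / \<alpha>" s "1 / s"] by simp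
    then have "\<alpha> / pi * (2 * pi / (\<alpha> * p)) powr (1 / p) * (2 * pi / (\<alpha> * q)) powr (1 / q)
      = \<alpha> / pi * ((2 * pi / \<alpha>) powr (1 / p) * (2 * pi / \<alpha>) powr (1 / q)) / p powr (1 / p) / q powr (1 / q)"
      using p c(1) by simp
    also have "(2 * pi / \<alpha>) powr (1 / p) * (2 * pi / \<alpha>) powr (1 / q) = 2 * pi / \<alpha>"
      unfolding powr_add[symmetric] pq using a by simp
    finally show ?thesis using a by simp
  qed
  finally show "cmod (pairing \<alpha> f h) \<le> (2 * (1 / p powr (1 / p)) * (1 / q powr (1 / q))) ^ CARD('n)
      * Lp_norm p (gauss (\<alpha> * p / 2)) f * Lp_norm q (gauss (\<alpha> * q / 2)) h" .
qed

text \<open>The coherent state lies in the conjugate space, so Hoelder's inequality supplies the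
  integrability that the reproducing formula asks for.\<close>

lemma reproducing_Lp_hol:
  assumes p: "1 < p" and pq: "1 / p + 1 / q = 1" and a: "0 < \<alpha>" and f: "f \<in> Lp_hol p (gauss (\<alpha> * p / 2))"
  shows "(\<integral>w. f w * exp (of_real \<alpha> * cip z w) \<partial>gauss \<alpha>) = f z"
    "integrable (gauss \<alpha>) (\<lambda>w. f w * exp (of_real \<alpha> * cip z w))"
proof -
  note c = conjugate_exponents[OF p pq]
  have "coherent \<alpha> z \<in> Lp_hol q (gauss (\<alpha> * q / 2))"
    using a c by (intro coherent_Lp_hol) auto
  from Hoelder_gauss(1)[OF p pq a f this]
  show *: "integrable (gauss \<alpha>) (\<lambda>w. f w * exp (of_real \<alpha> * cip z w))"
    by (simp add: cnj_coherent) (simp add: coherent_def)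
  show "(\<integral>w. f w * exp (of_real \<alpha> * cip z w) \<partial>gauss \<alpha>) = f z"
    by (rule reproducing[OF _ a *]) (use f in \<open>simp add: Lp_hol_def\<close>)
qed

text \<open>The functional of \<open>h\<close> determines every value of \<open>h\<close>. This
  yields injectivity of the duality map and identifies \<open>h\<close> as the symbol of its own
  functional.\<close>

lemma pairing_coherent:
  assumes p: "1 < p" and pq: "1 / p + 1 / q = 1" and a: "0 < \<alpha>" and h: "h \<in> Lp_hol q (gauss (\<alpha> * q / 2))"
  shows "pairing \<alpha> (coherent \<alpha> w) h = cnj (h w)"
proof -
  note c = conjugate_exponents[OF p pq]
  have "1 / q + 1 / p = 1" using pq by simp
  from reproducing_Lp_hol(1)[OF c(1) this a h, of w]
  have "cnj (h w) = (\<integral>z. cnj (h z * exp (of_real \<alpha> * cip w z)) \<partial>gauss \<alpha>)"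
    unfolding Bochner_Integration.integral_cnj by simp
  also have "\<dots> = pairing \<alpha> (coherent \<alpha> w) h"
    unfolding pairing_def by (simp add: coherent_def exp_cnj cnj_cip mult.commute)
  finally show ?thesis ..
qed

section \<open>Bounded functionals\<close>

lemma entire_scaleR:
  assumes "entire f" shows "entire (\<lambda>z. f (c *\<^sub>R z))"
  unfolding entire_def
proof
  fix z
  obtain L where L: "(f has_derivative L) (at (c *\<^sub>R z))" "\<And>k v. L (k *s v) = k * L v"
    using entireD[OF assms] by blast
  have "((\<lambda>z. f (c *\<^sub>R z)) has_derivative (\<lambda>h. L (c *\<^sub>R h))) (at z)"
    by (rule has_derivative_compose[of "\<lambda>z. c *\<^sub>R z" "\<lambda>h. c *\<^sub>R h" z UNIV f L]) (auto intro!: derivative_eq_intros L(1))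
  moreover have "L (c *\<^sub>R (k *s v)) = k * L (c *\<^sub>R v)" for k v
  proof -
    have "c *\<^sub>R (k *s v) = k *s (c *\<^sub>R v)" by (simp add: vec_eq_iff)
    then show ?thesis by (simp only: L(2))
  qed
  ultimately show "\<exists>N. ((\<lambda>z. f (c *\<^sub>R z)) has_derivative N) (at z) \<and> (\<forall>k v. N (k *s v) = k * N v)" by blast
qed

text \<open>Rescaling to \<open>gauss 1\<close> turns the coherent state at \<open>z\<close> into
  \<open>ker 1\<close> at \<open>(\<alpha> / sqrt b) *\<^sub>R z\<close>.\<close>

lemma entire_integral_coherent:
  fixes u :: "complex ^ 'n \<Rightarrow> complex"
  assumes b: "0 < b" and [measurable]: "u \<in> borel_measurable borel" and le: "\<And>w. cmod (u w) \<le> U"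
  shows "entire (\<lambda>z. \<integral>w. u w * coherent \<alpha> w z \<partial>gauss b)"
proof -
  have "entire (\<lambda>x. \<integral>y. u ((1 / sqrt b) *\<^sub>R y) * ker 1 x y \<partial>gauss 1)"
    by (rule entire_integral_ker) (use le in auto)
  from entire_scaleR[OF this, of "\<alpha> / sqrt b"]
  show ?thesis
    by (subst gauss_scale_integral(2)[OF b]) (simp_all add: ker_def coherent_def cip_simps)
qed

text \<open>With labels replaced by a simple function, an integral of coherent states becomes a
  finite linear combination, on which a functional can be evaluated by linearity alone.\<close>

lemma integral_simple_function:
  fixes u :: "complex ^ 'n \<Rightarrow> complex" and G :: "complex ^ 'n \<Rightarrow> complex"
  assumes s: "simple_function borel s" and u: "integrable (gauss b) u"
  shows "(\<integral>w. u w * G (s w) \<partial>gauss b) = (\<Sum>v\<in>range s. (\<integral>w. indicat_real (s -` {v}) w *\<^sub>R u w \<partial>gauss b) * G v)"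
proof -
  have fin: "finite (range s)" using s by (simp add: simple_function_def)
  have sets: "s -` {v} \<in> sets (gauss b)" for v
    using simple_functionD(2)[OF s, of "{v}"] by simp
  have i: "integrable (gauss b) (\<lambda>w. indicat_real (s -` {v}) w *\<^sub>R u w)" for v
    by (rule integrable_mult_indicator[OF sets u])
  have "u w * G (s w) = (\<Sum>v\<in>range s. (indicat_real (s -` {v}) w *\<^sub>R u w) * G v)" for w
  proof -
    have "(\<Sum>v\<in>range s. (indicat_real (s -` {v}) w *\<^sub>R u w) * G v) = (\<Sum>v\<in>range s. if v = s w then u w * G v else 0)"
      by (intro sum.cong) (auto simp: indicator_def)
    also have "\<dots> = u w * G (s w)" using fin by simp
    finally show ?thesis ..
  qed
  then have "(\<integral>w. u w * G (s w) \<partial>gauss b) = (\<integral>w. (\<Sum>v\<in>range s. (indicat_real (s -` {v}) w *\<^sub>R u w) * G v) \<partial>gauss b)"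
    by (simp only:)
  also have "\<dots> = (\<Sum>v\<in>range s. \<integral>w. (indicat_real (s -` {v}) w *\<^sub>R u w) * G v \<partial>gauss b)"
    by (rule Bochner_Integration.integral_sum) (intro integrable_mult_left i)
  also have "\<dots> = (\<Sum>v\<in>range s. (\<integral>w. indicat_real (s -` {v}) w *\<^sub>R u w \<partial>gauss b) * G v)"
    by (intro sum.cong refl Bochner_Integration.integral_mult_left i)
  finally show ?thesis .
qed

section \<open>Representation of a bounded functional by its symbol\<close>

text \<open>Extensionality is left out, so that the pairing with a fixed \<open>h\<close> is covered
  as well as an abstract functional. The bound \<open>C\<close> is explicit because it becomes the
  bound on the norm of the symbol.\<close>

locale bounded_functional =
  fixes p q \<alpha> C :: real and \<Phi> :: "(complex ^ 'n \<Rightarrow> complex) \<Rightarrow> complex"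
  assumes p: "1 < p" and pq: "1 / p + 1 / q = 1" and a: "0 < \<alpha>" and C: "0 \<le> C"
    and add: "f \<in> Lp_hol p (gauss (\<alpha> * p / 2)) \<Longrightarrow> g \<in> Lp_hol p (gauss (\<alpha> * p / 2)) \<Longrightarrow> \<Phi> (\<lambda>z. f z + g z) = \<Phi> f + \<Phi> g"
    and scale: "f \<in> Lp_hol p (gauss (\<alpha> * p / 2)) \<Longrightarrow> \<Phi> (\<lambda>z. c * f z) = c * \<Phi> f"
    and bound: "f \<in> Lp_hol p (gauss (\<alpha> * p / 2)) \<Longrightarrow> cmod (\<Phi> f) \<le> C * Lp_norm p (gauss (\<alpha> * p / 2)) f"
begin

abbreviation V :: "(complex ^ 'n \<Rightarrow> complex) set" where "V \<equiv> Lp_hol p (gauss (\<alpha> * p / 2))"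
abbreviation NV :: "(complex ^ 'n \<Rightarrow> complex) \<Rightarrow> real" where "NV \<equiv> Lp_norm p (gauss (\<alpha> * p / 2))"

definition symbol :: "complex ^ 'n \<Rightarrow> complex" where
  "symbol w = cnj (\<Phi> (coherent \<alpha> w))"

lemma p0: "0 < p" using p by simp

lemma q: "1 < q" using conjugate_exponents(1)[OF p pq] .

lemma b: "0 < \<alpha> * q / 2" and b': "0 < \<alpha> * p / 2"
  using a p q by auto

lemma coh: "coherent \<alpha> w \<in> V"
  using a b' p0 by (rule coherent_Lp_hol)

lemma diff: "f \<in> V \<Longrightarrow> g \<in> V \<Longrightarrow> \<Phi> (\<lambda>z. f z - g z) = \<Phi> f - \<Phi> g"
  using add[OF _ Lp_hol_mult, of f g "-1"] scale[of g "-1"] by simp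

lemma sum_eq:
  assumes "finite S" "\<And>v. v \<in> S \<Longrightarrow> f v \<in> V"
  shows "\<Phi> (\<lambda>z. \<Sum>v\<in>S. c v * f v z) = (\<Sum>v\<in>S. c v * \<Phi> (f v))"
  using assms
proof (induction S rule: finite_induct)
  case empty
  then show ?case using scale[OF Lp_hol_0, of 0] by simp
next
  case (insert v S)
  have "(\<lambda>z. \<Sum>v\<in>S. c v * f v z) \<in> V"
    using insert by (intro Lp_hol_sum[OF p0]) auto
  then show ?case
    using insert add[OF Lp_hol_mult[of "f v" _ _ "c v"], of "\<lambda>z. \<Sum>v\<in>S. c v * f v z"] scale[of "f v" "c v"] by simp
qed

text \<open>The coherent state is antiholomorphic in its label, so the conjugation in
  \<open>symbol\<close> restores complex linearity of the derivative. The candidate \<open>L\<close>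
  comes from the functional applied to the derivative of the coherent state, and boundedness carries
  the quadratic remainder over.\<close>

lemma entire_symbol: "entire symbol"
proof (rule entireI)
  fix w
  define L where "L h = cnj (\<Phi> (\<lambda>z. of_real \<alpha> * cip z h * coherent \<alpha> w z))" for h
  have mem: "(\<lambda>z. of_real \<alpha> * cip z h * coherent \<alpha> w z) \<in> V" for h
    using a b' p0 by (rule cip_coherent_Lp_hol)
  show L_scale: "L (c *s v) = c * L v" for c v
    using scale[OF mem[of v], of "cnj c"] by (simp add: L_def cip_simps mult_ac)
  show "(symbol has_derivative L) (at w)"
  proof (rule has_derivative_quadratic)
    have "L (v + w) = L v + L w" for v w
      using add[OF mem[of v] mem[of w]] by (simp add: L_def cip_simps algebra_simps)
    moreover have "L (c *\<^sub>R v) = c *\<^sub>R L v" for c v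
      using scale[OF mem[of v], of "of_real c"] by (simp add: L_def cip_simps mult_ac scaleR_conv_of_real[where 'a = complex])
    ultimately show "bounded_linear L"
      by (intro linear_conv_bounded_linear[THEN iffD1] linearI)
  next
    define d where "d z = 2 * \<alpha>\<^sup>2 * exp ((\<alpha> * (norm w + 1) + 1) * norm z)" for z :: "complex ^ 'n"
    define I where "I = (\<integral>z. d z powr p \<partial>gauss (\<alpha> * p / 2)) powr (1 / p)"
    fix h :: "complex ^ 'n" assume h: "norm h \<le> 1"
    define R where "R z = coherent \<alpha> (w + h) z - coherent \<alpha> w z - of_real \<alpha> * cip z h * coherent \<alpha> w z" for z
    have R_mem: "R \<in> V"
      unfolding R_def[abs_def] by (intro Lp_hol_diff p0 coh mem)
    have "symbol (w + h) - symbol w - L h = cnj (\<Phi> R)"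
      unfolding R_def[abs_def] symbol_def L_def using diff[OF Lp_hol_diff[OF p0 coh coh] mem] diff[OF coh coh] by simp
    then have "cmod (symbol (w + h) - symbol w - L h) \<le> C * NV R" using bound[OF R_mem] by simp
    also have "\<dots> \<le> C * ((norm h)\<^sup>2 * I)"
    proof (intro mult_left_mono C)
      show "NV R \<le> (norm h)\<^sup>2 * I"
        unfolding I_def
      proof (rule Lp_norm_dominated[OF p0])
        show "R \<in> borel_measurable (gauss (\<alpha> * p / 2))" using R_mem by (simp add: Lp_hol_def borel_measurable_entire)
        show "cmod (R z) \<le> (norm h)\<^sup>2 * d z" for z
          unfolding R_def d_def by (rule coherent_remainder[OF a h])
        have "d z powr p = (2 * \<alpha>\<^sup>2) powr p * exp (p * (\<alpha> * (norm w + 1) + 1) * norm z)" for z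
          using a by (simp add: d_def powr_mult exp_powr_real mult_ac)
        then show "integrable (gauss (\<alpha> * p / 2)) (\<lambda>z. d z powr p)"
          using integrable_gauss_exp_norm[OF b', of "p * (\<alpha> * (norm w + 1) + 1)", where 'n = 'n] by simp
      qed (auto simp: d_def)
    qed
    finally show "cmod (symbol (w + h) - symbol w - L h) \<le> C * I * (norm h)\<^sup>2" by (simp add: mult_ac)
  qed
qed

text \<open>Dominated pointwise convergence implies convergence in norm, which a bounded functional
  respects.\<close>

lemma tendsto_functional:
  assumes f: "\<And>m. f m \<in> V" "g \<in> V" and lim: "\<And>z. (\<lambda>m. f m z) \<longlonglongrightarrow> g z"
    and le: "\<And>m z. cmod (f m z - g z) \<le> d z" and d: "integrable (gauss (\<alpha> * p / 2)) (\<lambda>z. d z powr p)"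
  shows "(\<lambda>m. \<Phi> (f m)) \<longlonglongrightarrow> \<Phi> g"
proof -
  have [measurable]: "f m \<in> borel_measurable borel" "g \<in> borel_measurable borel" for m
    using f by (auto simp: Lp_hol_def borel_measurable_entire)
  have "(\<lambda>m. \<integral>z. cmod (f m z - g z) powr p \<partial>gauss (\<alpha> * p / 2)) \<longlonglongrightarrow> (\<integral>z. 0 \<partial>(gauss (\<alpha> * p / 2) :: (complex ^ 'n) measure))"
  proof (rule integral_dominated_convergence[OF _ _ d])
    show "AE z in gauss (\<alpha> * p / 2). (\<lambda>m. cmod (f m z - g z) powr p) \<longlonglongrightarrow> 0"
    proof (rule AE_I2)
      fix z
      have "(\<lambda>m. cmod (f m z - g z) powr p) \<longlonglongrightarrow> cmod (g z - g z) powr p"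
        using p0 by (intro tendsto_powr' tendsto_norm tendsto_diff lim tendsto_const) auto
      then show "(\<lambda>m. cmod (f m z - g z) powr p) \<longlonglongrightarrow> 0" using p0 by simp
    qed
    show "AE z in gauss (\<alpha> * p / 2). norm (cmod (f m z - g z) powr p) \<le> d z powr p" for m
      using p0 le by (intro AE_I2) (auto intro!: powr_mono2)
  qed auto
  then have "(\<lambda>m. C * (\<integral>z. cmod (f m z - g z) powr p \<partial>gauss (\<alpha> * p / 2)) powr (1 / p)) \<longlonglongrightarrow> C * 0 powr (1 / p)"
    using p0 by (intro tendsto_mult tendsto_const tendsto_powr') (auto intro!: always_eventually integral_nonneg_AE)
  then have lim0: "(\<lambda>m. C * NV (\<lambda>z. f m z - g z)) \<longlonglongrightarrow> 0" using p0 by (simp add: Lp_norm_def)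
  have "(\<lambda>m. \<Phi> (f m) - \<Phi> g) \<longlonglongrightarrow> 0"
  proof (rule Lim_null_comparison[OF _ lim0], rule always_eventually, rule allI)
    fix m
    show "cmod (\<Phi> (f m) - \<Phi> g) \<le> C * NV (\<lambda>z. f m z - g z)"
      using bound[OF Lp_hol_diff[OF p0 f(1)[of m] f(2)]] diff[OF f(1)[of m] f(2)] by simp
  qed
  then show ?thesis by (rule LIM_zero_cancel)
qed

text \<open>Exchange of functional and integral. Labels are approximated by simple functions; the
  resulting finite sums converge to \<open>T\<close> in norm, and their images converge to the
  integral against the symbol. Bounded support keeps the labels in a ball, on which the symbol is
  bounded; its growth at infinity is still unknown.\<close>

lemma functional_integral:
  assumes u: "u \<in> borel_measurable borel" and U: "\<And>w. cmod (u w) \<le> U" and supp: "\<And>w. R \<le> norm w \<Longrightarrow> u w = 0"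
  defines "T \<equiv> \<lambda>z. \<integral>w. u w * coherent \<alpha> w z \<partial>gauss (\<alpha> * q / 2)"
  shows "T \<in> V" "\<Phi> T = (\<integral>w. u w * cnj (symbol w) \<partial>gauss (\<alpha> * q / 2))"
proof -
  interpret prob_space "gauss (\<alpha> * q / 2) :: (complex ^ 'n) measure" by (rule prob_space_gauss[OF b])
  note u[measurable]
  have U0: "0 \<le> U" using U[of 0] norm_ge_zero order_trans by blast
  have iu: "integrable (gauss (\<alpha> * q / 2)) u"
    by (rule integrable_const_bound[of _ U]) (use U in auto)
  \<comment> \<open>The radius is doubled because the approximating simple functions satisfy
    \<open>norm (s i x) \<le> 2 * norm x\<close>.\<close>
  define E where "E z = U * exp (\<alpha> * (2 * \<bar>R\<bar>) * norm z)" for z :: "complex ^ 'n"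
  have E0: "0 \<le> E z" for z using U0 by (simp add: E_def)
  have le: "cmod (u w * coherent \<alpha> v z) \<le> E z" if "norm v \<le> 2 * norm w" for v w z
  proof (cases "R \<le> norm w")
    case True
    then show ?thesis using supp E0 by simp
  next
    case False
    then have "norm v \<le> 2 * \<bar>R\<bar>" using that by linarith
    then show ?thesis unfolding norm_mult E_def using U0 a
      by (intro mult_mono U norm_coherent_le) auto
  qed
  have le_int: "cmod (\<integral>w. u w * coherent \<alpha> (s w) z \<partial>gauss (\<alpha> * q / 2)) \<le> E z" 
    "integrable (gauss (\<alpha> * q / 2)) (\<lambda>w. u w * coherent \<alpha> (s w) z)"
    if [measurable]: "s \<in> borel_measurable borel" and s: "\<And>w. norm (s w) \<le> 2 * norm w" for s z
  proof -
    show i: "integrable (gauss (\<alpha> * q / 2)) (\<lambda>w. u w * coherent \<alpha> (s w) z)"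
      by (rule integrable_const_bound[of _ "E z"]) (use le[OF s] in auto)
    show "cmod (\<integral>w. u w * coherent \<alpha> (s w) z \<partial>gauss (\<alpha> * q / 2)) \<le> E z"
      using norm_integral_le_integral[OF i, of "\<lambda>_. E z"] le[OF s] prob_space by simp
  qed
  have T_le: "cmod (T z) \<le> E z" for z
    unfolding T_def by (rule le_int(1)[of "\<lambda>w. w"]) auto
  show T: "T \<in> V"
  proof (rule Lp_holI[OF _ b' p0])
    show "entire T" unfolding T_def by (rule entire_integral_coherent[OF b u U])
    show "cmod (T z) \<le> U * exp (\<alpha> * (2 * \<bar>R\<bar>) * norm z)" for z using T_le[of z] by (simp add: E_def)
  qed
  obtain s :: "nat \<Rightarrow> complex ^ 'n \<Rightarrow> complex ^ 'n" where s: "\<And>i. simple_function borel (s i)"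
    and s_lim: "\<And>x. (\<lambda>i. s i x) \<longlonglongrightarrow> x" and s_le: "\<And>i x. norm (s i x) \<le> 2 * norm x"
    using borel_measurable_implies_sequence_metric[of "\<lambda>x :: complex ^ 'n. x" borel 0] by auto
  have s_meas[measurable]: "s i \<in> borel_measurable borel" for i
    using s[of i] by (rule borel_measurable_simple_function)
  define P where "P m z = (\<integral>w. u w * coherent \<alpha> (s m w) z \<partial>gauss (\<alpha> * q / 2))" for m z
  define c where "c m v = (\<integral>w. indicat_real (s m -` {v}) w *\<^sub>R u w \<partial>gauss (\<alpha> * q / 2))" for m v
  have fin: "finite (range (s m))" for m using s[of m] by (simp add: simple_function_def)
  have P_eq: "P m = (\<lambda>z. \<Sum>v\<in>range (s m). c m v * coherent \<alpha> v z)" for m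
    unfolding P_def c_def by (rule ext) (rule integral_simple_function[OF s iu])
  have P_mem: "P m \<in> V" for m unfolding P_eq by (rule Lp_hol_sum[OF p0 fin coh])
  have \<Phi>P: "\<Phi> (P m) = (\<integral>w. u w * cnj (symbol (s m w)) \<partial>gauss (\<alpha> * q / 2))" for m
  proof -
    have "\<Phi> (P m) = (\<Sum>v\<in>range (s m). c m v * \<Phi> (coherent \<alpha> v))"
      unfolding P_eq by (rule sum_eq[OF fin coh])
    also have "\<dots> = (\<Sum>v\<in>range (s m). c m v * cnj (symbol v))" by (simp add: symbol_def)
    also have "\<dots> = (\<integral>w. u w * cnj (symbol (s m w)) \<partial>gauss (\<alpha> * q / 2))"
      unfolding c_def by (rule integral_simple_function[OF s iu, symmetric])
    finally show ?thesis .
  qed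
  have symbol_cont: "continuous_on UNIV symbol" by (rule continuous_on_entire[OF entire_symbol])
  then have [measurable]: "symbol \<in> borel_measurable borel" by (rule borel_measurable_continuous_onI)
  have "(\<lambda>m. \<Phi> (P m)) \<longlonglongrightarrow> \<Phi> T"
  proof (rule tendsto_functional[OF P_mem T])
    fix z
    show "(\<lambda>m. P m z) \<longlonglongrightarrow> T z"
      unfolding P_def T_def
    proof (rule integral_dominated_convergence[where w = "\<lambda>_. E z"])
      show "AE w in gauss (\<alpha> * q / 2). (\<lambda>m. u w * coherent \<alpha> (s m w) z) \<longlonglongrightarrow> u w * coherent \<alpha> w z"
        unfolding coherent_def by (intro AE_I2 tendsto_intros s_lim)
      show "AE w in gauss (\<alpha> * q / 2). cmod (u w * coherent \<alpha> (s m w) z) \<le> E z" for m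
        by (intro AE_I2 le s_le)
    qed auto
  next
    fix m z
    have "cmod (P m z) \<le> E z" unfolding P_def by (rule le_int(1)[OF s_meas s_le])
    then show "cmod (P m z - T z) \<le> 2 * E z"
      using norm_triangle_ineq4[of "P m z" "T z"] T_le[of z] by linarith
  next
    have "(2 * E z) powr p = (2 * U) powr p * exp (p * (\<alpha> * (2 * \<bar>R\<bar>)) * norm z)" for z
    proof -
      have "(2 * E z) powr p = ((2 * U) * exp (\<alpha> * (2 * \<bar>R\<bar>) * norm z)) powr p" by (simp add: E_def mult.assoc)
      then show ?thesis unfolding powr_mult[of "2 * U"] by (simp add: exp_powr_real mult_ac)
    qed
    then show "integrable (gauss (\<alpha> * p / 2)) (\<lambda>z. (2 * E z) powr p)"
      using integrable_gauss_exp_norm[OF b', of "p * (\<alpha> * (2 * \<bar>R\<bar>))", where 'n = 'n] by simp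
  qed
  moreover have "(\<lambda>m. \<Phi> (P m)) \<longlonglongrightarrow> (\<integral>w. u w * cnj (symbol w) \<partial>gauss (\<alpha> * q / 2))"
    unfolding \<Phi>P
  proof -
    have "compact (symbol ` cball 0 (2 * \<bar>R\<bar>))"
      by (intro compact_continuous_image continuous_on_subset[OF symbol_cont]) auto
    then obtain B where B: "\<And>v. norm v \<le> 2 * \<bar>R\<bar> \<Longrightarrow> cmod (symbol v) \<le> B"
      using compact_imp_bounded bounded_iff by (metis imageI mem_cball_0)
    have B0: "0 \<le> B" using order_trans[OF norm_ge_zero B[of 0]] by simp
    show "(\<lambda>m. \<integral>w. u w * cnj (symbol (s m w)) \<partial>gauss (\<alpha> * q / 2)) \<longlonglongrightarrow> (\<integral>w. u w * cnj (symbol w) \<partial>gauss (\<alpha> * q / 2))"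
    proof (rule integral_dominated_convergence[where w = "\<lambda>_. U * B"])
      have "(\<lambda>m. symbol (s m w)) \<longlonglongrightarrow> symbol w" for w
        by (rule continuous_on_tendsto_compose[OF symbol_cont s_lim]) auto
      then show "AE w in gauss (\<alpha> * q / 2). (\<lambda>m. u w * cnj (symbol (s m w))) \<longlonglongrightarrow> u w * cnj (symbol w)"
        by (intro AE_I2 tendsto_mult tendsto_cnj tendsto_const)
      show "AE w in gauss (\<alpha> * q / 2). cmod (u w * cnj (symbol (s m w))) \<le> U * B" for m
      proof (rule AE_I2)
        fix w
        show "cmod (u w * cnj (symbol (s m w))) \<le> U * B"
        proof (cases "R \<le> norm w")
          case True
          then show ?thesis using supp U0 B0 by simp
        next
          case False
          then have "norm (s m w) \<le> 2 * \<bar>R\<bar>" using s_le[of m w] by linarith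
          then show ?thesis unfolding norm_mult complex_mod_cnj using U0 by (intro mult_mono U B) auto
        qed
      qed
    qed auto
  qed
  ultimately show "\<Phi> T = (\<integral>w. u w * cnj (symbol w) \<partial>gauss (\<alpha> * q / 2))"
    by (rule LIMSEQ_unique)
qed

text \<open>Tested on \<open>h |h|\<^bsup>q - 2\<^esup>\<close>, truncated, the contraction property bounds the norm of the symbol.\<close>

lemma symbol_bound:
  shows "symbol \<in> Lp_hol q (gauss (\<alpha> * q / 2))" "Lp_norm q (gauss (\<alpha> * q / 2)) symbol \<le> C"
proof -
  interpret prob_space "gauss (\<alpha> * q / 2) :: (complex ^ 'n) measure" by (rule prob_space_gauss[OF b])
  have cont: "continuous_on UNIV symbol" by (rule continuous_on_entire[OF entire_symbol])
  then have [measurable]: "symbol \<in> borel_measurable borel" by (rule borel_measurable_continuous_onI)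
  have qp: "(q - 1) * p = q" using conjugate_exponents(2)[OF p pq] by (simp add: algebra_simps)
  have main: "(\<integral>\<^sup>+w. ennreal (cutoff k w * cmod (symbol w) powr q) \<partial>gauss (\<alpha> * q / 2)) \<le> ennreal (C powr q)" for k
  proof -
    define J where "J = (\<integral>w. cutoff k w * cmod (symbol w) powr q \<partial>gauss (\<alpha> * q / 2))"
    define u where "u w = of_real (cutoff k w) * sgnp q (symbol w)" for w
    have sg: "continuous_on UNIV (\<lambda>x. sgnp q (symbol x))"
      by (rule continuous_on_compose2[OF continuous_on_sgnp[OF q] cont]) auto
    then have u: "continuous_on UNIV u" unfolding u_def[abs_def] by (intro continuous_intros) auto
    then have u_meas[measurable]: "u \<in> borel_measurable borel" by (rule borel_measurable_continuous_onI)
    obtain U where U: "\<And>w. cmod (u w) \<le> U" unfolding u_def by (rule cutoff_mult_bounded[OF sg]) blast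
    have supp: "real k + 1 \<le> norm w \<Longrightarrow> u w = 0" for w by (simp add: u_def cutoff_eq_0)
    have gp: "continuous_on UNIV (\<lambda>x. complex_of_real (cmod (symbol x) powr q))"
      using q by (intro continuous_intros continuous_on_powr' cont) auto
    obtain B2 where B2: "\<And>x. cmod (of_real (cutoff k x) * of_real (cmod (symbol x) powr q)) \<le> B2"
      by (rule cutoff_mult_bounded[OF gp]) blast
    have J_int: "integrable (gauss (\<alpha> * q / 2)) (\<lambda>x. cutoff k x * cmod (symbol x) powr q)"
      by (rule integrable_const_bound[of _ B2]) (use B2 in \<open>auto simp: norm_mult abs_mult\<close>)
    have J0: "0 \<le> J" unfolding J_def by (intro integral_nonneg_AE AE_I2 mult_nonneg_nonneg cutoff_bounds) simp
    define T where "T z = (\<integral>w. u w * coherent \<alpha> w z \<partial>gauss (\<alpha> * q / 2))" for z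
    have T: "T \<in> V" "\<Phi> T = (\<integral>w. u w * cnj (symbol w) \<partial>gauss (\<alpha> * q / 2))"
      using functional_integral[OF u_meas U supp] unfolding T_def[abs_def] by auto
    have "u w * cnj (symbol w) = of_real (cutoff k w * cmod (symbol w) powr q)" for w
    proof -
      have "u w * cnj (symbol w) = of_real (cutoff k w) * cnj (symbol w * cnj (sgnp q (symbol w)))" by (simp add: u_def)
      then show ?thesis unfolding mult_cnj_sgnp by simp
    qed
    then have "\<Phi> T = of_real J" unfolding T J_def by (simp only: integral_complex_of_real)
    \<comment> \<open>The contraction will bound \<open>NV T\<close> by
      \<open>J powr (1 / p)\<close>. As \<open>J\<close> is finite by truncation, this power can be
      cancelled, which leaves \<open>J powr (1 / q) \<le> C\<close> without any further
      constant.\<close>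
    then have 1: "J \<le> C * NV T" using bound[OF T(1)] J0 by simp
    have up: "cmod (u w) powr p \<le> cutoff k w * cmod (symbol w) powr q" for w
    proof -
      have "cmod (u w) powr p = cutoff k w powr p * cmod (symbol w) powr q"
        using cutoff_bounds[of k w] by (simp add: u_def norm_mult cmod_sgnp powr_mult powr_powr qp)
      also have "\<dots> \<le> cutoff k w * cmod (symbol w) powr q"
      proof (rule mult_right_mono)
        show "cutoff k w powr p \<le> cutoff k w"
          using cutoff_bounds[of k w] p powr_mono'[of 1 p "cutoff k w"] by (cases "cutoff k w = 0") auto
      qed simp
      finally show ?thesis .
    qed
    have up_int: "integrable (gauss (\<alpha> * q / 2)) (\<lambda>w. cmod (u w) powr p)"
      by (rule integrable_dominated[OF J_int]) (use up in auto)
    have J_nn: "(\<integral>\<^sup>+w. ennreal (cutoff k w * cmod (symbol w) powr q) \<partial>gauss (\<alpha> * q / 2)) = ennreal J"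
      unfolding J_def by (intro nn_integral_eq_integral J_int AE_I2 mult_nonneg_nonneg cutoff_bounds) simp
    have "(\<integral>\<^sup>+z. ennreal (cmod (T z) powr p) \<partial>gauss (\<alpha> * p / 2)) \<le> (\<integral>\<^sup>+w. ennreal (cmod (u w) powr p) \<partial>gauss (\<alpha> * q / 2))"
      using contraction_kernel(1)[OF p pq a u up_int] unfolding T_def coherent_def .
    also have "\<dots> \<le> ennreal J"
      unfolding J_nn[symmetric] by (intro nn_integral_mono ennreal_leI up)
    finally have T_le: "(\<integral>\<^sup>+z. ennreal (cmod (T z) powr p) \<partial>gauss (\<alpha> * p / 2)) \<le> ennreal J" .
    have "T \<in> borel_measurable borel" using T(1) by (simp add: Lp_hol_def borel_measurable_entire)
    then have "(\<integral>z. cmod (T z) powr p \<partial>gauss (\<alpha> * p / 2)) \<le> J"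
      by (intro integrable_if_nn_integral_le(2)[OF _ _ T_le J0]) auto
    then have "NV T \<le> J powr (1 / p)"
      unfolding Lp_norm_def using p0 by (intro powr_mono2) (auto intro!: integral_nonneg_AE)
    with 1 C have 2: "J \<le> C * J powr (1 / p)" by (meson mult_left_mono order_trans)
    have "J \<le> C powr q"
    proof (cases "J = 0")
      case False
      then have Jpos: "0 < J" using J0 by simp
      have "J powr (1 / q) * J powr (1 / p) = J" using Jpos pq by (simp add: add.commute flip: powr_add)
      then have "J powr (1 / q) * J powr (1 / p) \<le> C * J powr (1 / p)" using 2 by simp
      then have "J powr (1 / q) \<le> C" using Jpos by simp
      from powr_mono2[OF _ _ this, of q] show ?thesis using q J0 by (simp add: powr_powr)
    qed simp
    then show ?thesis unfolding J_nn by (rule ennreal_leI)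
  qed
  have "(\<integral>\<^sup>+w. ennreal (cmod (symbol w) powr q) \<partial>gauss (\<alpha> * q / 2)) \<le> ennreal (C powr q)"
  proof (rule nn_integral_le_limit[OF _ _ main tendsto_const])
    fix w
    have "(\<lambda>k. cutoff k w * cmod (symbol w) powr q) \<longlonglongrightarrow> 1 * cmod (symbol w) powr q"
      by (intro tendsto_mult cutoff_tendsto tendsto_const)
    then show "(\<lambda>k. ennreal (cutoff k w * cmod (symbol w) powr q)) \<longlonglongrightarrow> ennreal (cmod (symbol w) powr q)"
      by (intro tendsto_ennrealI) simp
  qed simp
  note i = integrable_if_nn_integral_le[OF _ _ this, simplified]
  show "symbol \<in> Lp_hol q (gauss (\<alpha> * q / 2))" using i(1) entire_symbol by (simp add: Lp_hol_def)
  have "Lp_norm q (gauss (\<alpha> * q / 2)) symbol \<le> (C powr q) powr (1 / q)"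
    unfolding Lp_norm_def using q i(2) by (intro powr_mono2) (auto intro!: integral_nonneg_AE)
  then show "Lp_norm q (gauss (\<alpha> * q / 2)) symbol \<le> C" using q C by (simp add: powr_powr)
qed

text \<open>By the reproducing formula, \<open>f\<close> is itself an integral of coherent states,
  with \<open>gauss \<alpha>\<close> rewritten as \<open>D\<close> times
  \<open>gauss (\<alpha> * q / 2)\<close>. For truncated integrals the claim is the exchange of
  functional and integral; the contraction, applied to the tails, shows that they converge to
  \<open>f\<close> in norm. No separate density statement for coherent states is invoked.\<close>

lemma functional_eq_pairing:
  assumes f: "f \<in> V"
  shows "\<Phi> f = pairing \<alpha> f symbol"
proof -
  have f_cont: "continuous_on UNIV f" using f by (simp add: Lp_hol_def continuous_on_entire)
  then have [measurable]: "f \<in> borel_measurable borel" by (rule borel_measurable_continuous_onI)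
  have [measurable]: "symbol \<in> borel_measurable borel" by (rule borel_measurable_entire[OF entire_symbol])
  \<comment> \<open>The density of \<open>gauss \<alpha>\<close> relative to
    \<open>gauss (\<alpha> * q / 2)\<close>.\<close>
  define D where "D w = (\<alpha> / (\<alpha> * q / 2)) ^ CARD('n) * exp ((\<alpha> * q / 2 - \<alpha>) * (norm w)\<^sup>2)" for w :: "complex ^ 'n"
  have D0: "0 < D w" for w using a q by (simp add: D_def)
  have D_cont: "continuous_on UNIV D" unfolding D_def[abs_def] by (intro continuous_intros)
  have [measurable]: "D \<in> borel_measurable borel" by (rule borel_measurable_continuous_onI[OF D_cont])
  have dens: "gauss_dens (\<alpha> * q / 2) w * D w = gauss_dens \<alpha> w" for w :: "complex ^ 'n"
  proof -
    have "(\<alpha> * q / 2 / pi) ^ CARD('n) * (\<alpha> / (\<alpha> * q / 2)) ^ CARD('n) = (\<alpha> / pi) ^ CARD('n)"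
      unfolding power_mult_distrib[symmetric] using a q by simp
    moreover have "exp (- (\<alpha> * q / 2) * (norm w)\<^sup>2) * exp ((\<alpha> * q / 2 - \<alpha>) * (norm w)\<^sup>2) = exp (- \<alpha> * (norm w)\<^sup>2)"
      unfolding mult_exp_exp by (simp add: algebra_simps)
    moreover have "(x * y) * (x' * y') = (x * x') * (y * y')" for x y x' y' :: real by simp
    ultimately show ?thesis unfolding gauss_dens_def D_def by (simp only:)
  qed
  have dens_int: "(\<integral>w. of_real (D w) * g w \<partial>gauss (\<alpha> * q / 2)) = (\<integral>w. g w \<partial>gauss \<alpha>)"
    "integrable (gauss (\<alpha> * q / 2)) (\<lambda>w. of_real (D w) * g w) \<longleftrightarrow> integrable (gauss \<alpha>) g"
    if [measurable]: "g \<in> borel_measurable borel" for g :: "complex ^ 'n \<Rightarrow> complex"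
  proof -
    have eq: "gauss_dens (\<alpha> * q / 2) w *\<^sub>R (of_real (D w) * g w) = gauss_dens \<alpha> w *\<^sub>R g w" for w
      unfolding dens[symmetric] by (simp add: scaleR_conv_of_real mult.assoc)
    show "(\<integral>w. of_real (D w) * g w \<partial>gauss (\<alpha> * q / 2)) = (\<integral>w. g w \<partial>gauss \<alpha>)"
      using b a by (simp add: integral_gauss eq)
    show "integrable (gauss (\<alpha> * q / 2)) (\<lambda>w. of_real (D w) * g w) \<longleftrightarrow> integrable (gauss \<alpha>) g"
      using b a by (simp add: integrable_gauss_iff eq)
  qed
  define u where "u w = of_real (D w) * f w" for w
  have u_cont: "continuous_on UNIV u" unfolding u_def[abs_def] by (intro continuous_intros D_cont f_cont)
  then have [measurable]: "u \<in> borel_measurable borel" by (rule borel_measurable_continuous_onI)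
  \<comment> \<open>Up to the constant \<open>c\<close>, \<open>|u|^p\<close> under
    \<open>gauss (\<alpha> * q / 2)\<close> is \<open>|f|^p\<close> under
    \<open>gauss (\<alpha> * p / 2)\<close>: the exponents of the weights match because
    \<open>p + q = p * q\<close>.\<close>
  have up_int: "integrable (gauss (\<alpha> * q / 2)) (\<lambda>w. cmod (u w) powr p)"
  proof -
    define c where "c = (\<alpha> * q / 2 / pi) ^ CARD('n) * ((\<alpha> / (\<alpha> * q / 2)) ^ CARD('n)) powr p / (\<alpha> * p / 2 / pi) ^ CARD('n)"
    have "gauss_dens (\<alpha> * q / 2) w *\<^sub>R cmod (u w) powr p = c *\<^sub>R (gauss_dens (\<alpha> * p / 2) w *\<^sub>R cmod (f w) powr p)" for w
    proof -
      have e: "- (\<alpha> * q / 2) * x + (\<alpha> * q / 2 - \<alpha>) * x * p = - (\<alpha> * p / 2) * x" for x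
      proof -
        have "- (\<alpha> * q / 2) * x + (\<alpha> * q / 2 - \<alpha>) * x * p = \<alpha> * x * (p * q / 2 - q / 2 - p)" by (simp add: algebra_simps)
        also have "p * q / 2 - q / 2 - p = - p / 2" unfolding conjugate_exponents(2)[OF p pq, symmetric] by (simp add: field_simps)
        finally show ?thesis by simp
      qed
      have ex: "exp (- (\<alpha> * q / 2) * (norm w)\<^sup>2) * exp ((\<alpha> * q / 2 - \<alpha>) * (norm w)\<^sup>2) powr p = exp (- (\<alpha> * p / 2) * (norm w)\<^sup>2)"
        unfolding exp_powr_real mult_exp_exp e ..
      have cc: "(\<alpha> * q / 2 / pi) ^ CARD('n) * ((\<alpha> / (\<alpha> * q / 2)) ^ CARD('n)) powr p = c * (\<alpha> * p / 2 / pi) ^ CARD('n)"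
        using a p by (simp add: c_def)
      have Dp: "cmod (u w) powr p = ((\<alpha> / (\<alpha> * q / 2)) ^ CARD('n)) powr p * exp ((\<alpha> * q / 2 - \<alpha>) * (norm w)\<^sup>2) powr p * cmod (f w) powr p"
        using D0[of w] unfolding u_def norm_mult norm_of_real powr_mult by (simp add: D_def powr_mult)
      have "gauss_dens (\<alpha> * q / 2) w * cmod (u w) powr p
        = ((\<alpha> * q / 2 / pi) ^ CARD('n) * ((\<alpha> / (\<alpha> * q / 2)) ^ CARD('n)) powr p) * (exp (- (\<alpha> * q / 2) * (norm w)\<^sup>2) * exp ((\<alpha> * q / 2 - \<alpha>) * (norm w)\<^sup>2) powr p) * cmod (f w) powr p"
        unfolding Dp gauss_dens_def by (simp only: mult_ac)
      also have "\<dots> = c * (gauss_dens (\<alpha> * p / 2) w * cmod (f w) powr p)"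
        unfolding ex cc gauss_dens_def by (simp only: mult_ac)
      finally show ?thesis by simp
    qed
    moreover have "integrable lborel (\<lambda>w. gauss_dens (\<alpha> * p / 2) w *\<^sub>R cmod (f w) powr p)"
      using f integrable_gauss_iff[of "\<lambda>w. cmod (f w) powr p" "\<alpha> * p / 2"] b' by (simp add: Lp_hol_def)
    ultimately show ?thesis
      by (subst integrable_gauss_iff) (use b in simp_all)
  qed
  have T_f: "(\<integral>w. u w * coherent \<alpha> w z \<partial>gauss (\<alpha> * q / 2)) = f z" "integrable (gauss (\<alpha> * q / 2)) (\<lambda>w. u w * coherent \<alpha> w z)" for z
    using reproducing_Lp_hol[OF p pq a f, of z] dens_int[of "\<lambda>w. f w * coherent \<alpha> w z"]
    by (simp_all add: u_def coherent_def mult.assoc)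
  have fs_int: "integrable (gauss \<alpha>) (\<lambda>w. f w * cnj (symbol w))"
    by (rule Hoelder_gauss(1)[OF p pq a f symbol_bound(1)])
  have us_int: "integrable (gauss (\<alpha> * q / 2)) (\<lambda>w. u w * cnj (symbol w))" 
    and us_eq: "(\<integral>w. u w * cnj (symbol w) \<partial>gauss (\<alpha> * q / 2)) = pairing \<alpha> f symbol"
    using dens_int[of "\<lambda>w. f w * cnj (symbol w)"] fs_int by (simp_all add: u_def mult.assoc pairing_def)
  define uk where "uk k w = of_real (cutoff k w) * u w" for k w
  have [measurable]: "uk k \<in> borel_measurable borel" for k unfolding uk_def[abs_def] by measurable
  define Tk where "Tk k z = (\<integral>w. uk k w * coherent \<alpha> w z \<partial>gauss (\<alpha> * q / 2))" for k z
  have Tk: "Tk k \<in> V" "\<Phi> (Tk k) = (\<integral>w. uk k w * cnj (symbol w) \<partial>gauss (\<alpha> * q / 2))" for k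
  proof -
    obtain U where U: "\<And>w. cmod (uk k w) \<le> U" unfolding uk_def by (rule cutoff_mult_bounded[OF u_cont]) blast
    have supp: "real k + 1 \<le> norm w \<Longrightarrow> uk k w = 0" for w by (simp add: uk_def cutoff_eq_0)
    have m: "uk k \<in> borel_measurable borel" by measurable
    show "Tk k \<in> V" "\<Phi> (Tk k) = (\<integral>w. uk k w * cnj (symbol w) \<partial>gauss (\<alpha> * q / 2))"
      using functional_integral[OF m U supp] unfolding Tk_def[abs_def] by auto
  qed
  have uk_le: "cmod (uk k w) \<le> cmod (u w)" for k w
    using cutoff_bounds[of k w] by (simp add: uk_def norm_mult mult_left_le_one_le)
  have uk_lim: "(\<lambda>k. uk k w) \<longlonglongrightarrow> u w" for w
  proof -
    have "(\<lambda>k. of_real (cutoff k w) * u w) \<longlonglongrightarrow> of_real 1 * u w"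
      by (intro tendsto_mult tendsto_of_real cutoff_tendsto tendsto_const)
    then show ?thesis by (simp add: uk_def)
  qed
  have "(\<lambda>k. \<Phi> (Tk k)) \<longlonglongrightarrow> (\<integral>w. u w * cnj (symbol w) \<partial>gauss (\<alpha> * q / 2))"
    unfolding Tk
  proof (rule integral_dominated_convergence[OF _ _ integrable_norm[OF us_int]])
    show "AE w in gauss (\<alpha> * q / 2). (\<lambda>k. uk k w * cnj (symbol w)) \<longlonglongrightarrow> u w * cnj (symbol w)"
      by (intro AE_I2 tendsto_mult uk_lim tendsto_const)
    show "AE w in gauss (\<alpha> * q / 2). cmod (uk k w * cnj (symbol w)) \<le> norm (u w * cnj (symbol w))" for k
      unfolding norm_mult by (intro AE_I2 mult_right_mono uk_le) auto
  qed measurable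
  moreover have "(\<lambda>k. \<Phi> (Tk k)) \<longlonglongrightarrow> \<Phi> f"
  proof -
    \<comment> \<open>The tails are \<open>p\<close>-integrable but need not be bounded, so the
      contraction is required in its form for unbounded continuous functions.\<close>
    define t where "t k w = u w - uk k w" for k w
    have [measurable]: "t k \<in> borel_measurable borel" for k unfolding t_def[abs_def] by measurable
    have t_cont: "continuous_on UNIV (t k)" for k
      unfolding t_def[abs_def] uk_def by (intro continuous_intros u_cont)
    have t_le: "cmod (t k w) \<le> cmod (u w)" for k w
    proof -
      have "t k w = of_real (1 - cutoff k w) * u w" by (simp add: t_def uk_def algebra_simps)
      then show ?thesis using cutoff_bounds[of k w] by (simp only: norm_mult norm_of_real) (simp add: mult_left_le_one_le)
    qed
    have tp_le: "cmod (t k w) powr p \<le> cmod (u w) powr p" for k w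
      using p0 by (intro powr_mono2 t_le) auto
    have tp_int: "integrable (gauss (\<alpha> * q / 2)) (\<lambda>w. cmod (t k w) powr p)" for k
      by (rule integrable_dominated[OF up_int]) (use tp_le in auto)
    define J where "J k = (\<integral>w. cmod (t k w) powr p \<partial>gauss (\<alpha> * q / 2))" for k
    have J0: "0 \<le> J k" for k unfolding J_def by (intro integral_nonneg_AE) auto
    have "(\<lambda>k. \<integral>w. cmod (t k w) powr p \<partial>gauss (\<alpha> * q / 2)) \<longlonglongrightarrow> (\<integral>w. 0 \<partial>(gauss (\<alpha> * q / 2) :: (complex ^ 'n) measure))"
    proof (rule integral_dominated_convergence[OF _ _ up_int])
      show "AE w in gauss (\<alpha> * q / 2). (\<lambda>k. cmod (t k w) powr p) \<longlonglongrightarrow> 0"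
      proof (rule AE_I2)
        fix w
        have "(\<lambda>k. cmod (t k w) powr p) \<longlonglongrightarrow> cmod (u w - u w) powr p"
          unfolding t_def using p0 by (intro tendsto_powr' tendsto_norm tendsto_diff uk_lim tendsto_const) auto
        then show "(\<lambda>k. cmod (t k w) powr p) \<longlonglongrightarrow> 0" using p0 by simp
      qed
      show "AE w in gauss (\<alpha> * q / 2). norm (cmod (t k w) powr p) \<le> cmod (u w) powr p" for k
        using tp_le by (intro AE_I2) simp
    qed auto
    then have "J \<longlonglongrightarrow> 0" by (simp add: J_def[abs_def])
    then have "(\<lambda>k. C * J k powr (1 / p)) \<longlonglongrightarrow> C * 0 powr (1 / p)"
      using p0 J0 by (intro tendsto_mult tendsto_const tendsto_powr') auto
    then have lim0: "(\<lambda>k. C * J k powr (1 / p)) \<longlonglongrightarrow> 0" using p0 by simp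
    have "cmod (\<Phi> (Tk k) - \<Phi> f) \<le> C * J k powr (1 / p)" for k
    proof -
      define S where "S z = f z - Tk k z" for z
      have S: "S \<in> V" "\<Phi> S = \<Phi> f - \<Phi> (Tk k)"
        unfolding S_def[abs_def] using Lp_hol_diff[OF p0 f Tk(1)] diff[OF f Tk(1)] by auto
      have uk_int: "integrable (gauss (\<alpha> * q / 2)) (\<lambda>w. uk k w * coherent \<alpha> w z)" for z
        by (rule integrable_dominated[OF integrable_norm[OF T_f(2)[of z]]]) (auto simp: norm_mult intro!: mult_right_mono uk_le)
      have S_eq: "S z = (\<integral>w. t k w * coherent \<alpha> w z \<partial>gauss (\<alpha> * q / 2))" for z
        unfolding S_def Tk_def T_f(1)[symmetric] t_def left_diff_distrib
        by (rule Bochner_Integration.integral_diff[symmetric, OF T_f(2) uk_int])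
      have "(\<integral>\<^sup>+z. ennreal (cmod (S z) powr p) \<partial>gauss (\<alpha> * p / 2)) \<le> (\<integral>\<^sup>+w. ennreal (cmod (t k w) powr p) \<partial>gauss (\<alpha> * q / 2))"
        using contraction_kernel(1)[OF p pq a t_cont tp_int] unfolding S_eq coherent_def .
      also have "\<dots> = ennreal (J k)"
        unfolding J_def by (intro nn_integral_eq_integral tp_int) auto
      finally have S_le: "(\<integral>\<^sup>+z. ennreal (cmod (S z) powr p) \<partial>gauss (\<alpha> * p / 2)) \<le> ennreal (J k)" .
      have "S \<in> borel_measurable borel" using S(1) by (simp add: Lp_hol_def borel_measurable_entire)
      then have "(\<integral>z. cmod (S z) powr p \<partial>gauss (\<alpha> * p / 2)) \<le> J k"
        by (intro integrable_if_nn_integral_le(2)[OF _ _ S_le J0]) auto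
      then have "NV S \<le> J k powr (1 / p)"
        unfolding Lp_norm_def using p0 by (intro powr_mono2) (auto intro!: integral_nonneg_AE)
      then have "C * NV S \<le> C * J k powr (1 / p)" using C by (rule mult_left_mono)
      then show ?thesis using bound[OF S(1)] unfolding S(2) by (simp add: norm_minus_commute)
    qed
    then have "(\<lambda>k. \<Phi> (Tk k) - \<Phi> f) \<longlonglongrightarrow> 0"
      by (intro Lim_null_comparison[OF _ lim0] always_eventually) auto
    then show ?thesis by (rule LIM_zero_cancel)
  qed
  ultimately show ?thesis unfolding us_eq by (rule LIMSEQ_unique[rotated])
qed

end

section \<open>Duality\<close>

lemma pairing_linear:
  fixes f g h k :: "complex ^ 'n \<Rightarrow> complex"
  assumes p: "1 < p" and pq: "1 / p + 1 / q = 1" and a: "0 < \<alpha>"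
    and f: "f \<in> Lp_hol p (gauss (\<alpha> * p / 2))" "g \<in> Lp_hol p (gauss (\<alpha> * p / 2))"
    and h: "h \<in> Lp_hol q (gauss (\<alpha> * q / 2))" "k \<in> Lp_hol q (gauss (\<alpha> * q / 2))"
  shows "pairing \<alpha> (\<lambda>z. f z + g z) h = pairing \<alpha> f h + pairing \<alpha> g h"
    "pairing \<alpha> (\<lambda>z. c * f z) h = c * pairing \<alpha> f h"
    "pairing \<alpha> f (\<lambda>z. h z + k z) = pairing \<alpha> f h + pairing \<alpha> f k"
    "pairing \<alpha> f (\<lambda>z. c * h z) = cnj c * pairing \<alpha> f h"
proof -
  note i = Hoelder_gauss(1)[OF p pq a]
  show "pairing \<alpha> (\<lambda>z. f z + g z) h = pairing \<alpha> f h + pairing \<alpha> g h"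
    unfolding pairing_def distrib_right
    by (rule Bochner_Integration.integral_add[OF i[OF f(1) h(1)] i[OF f(2) h(1)]])
  show "pairing \<alpha> (\<lambda>z. c * f z) h = c * pairing \<alpha> f h"
    unfolding pairing_def mult.assoc
    by (rule Bochner_Integration.integral_mult_right) (rule i[OF f(1) h(1)])
  show "pairing \<alpha> f (\<lambda>z. h z + k z) = pairing \<alpha> f h + pairing \<alpha> f k"
    unfolding pairing_def complex_cnj_add distrib_left
    by (rule Bochner_Integration.integral_add[OF i[OF f(1) h(1)] i[OF f(1) h(2)]])
  have "pairing \<alpha> f (\<lambda>z. c * h z) = (\<integral>z. cnj c * (f z * cnj (h z)) \<partial>gauss \<alpha>)"
    unfolding pairing_def by (simp add: mult_ac)
  also have "\<dots> = cnj c * pairing \<alpha> f h"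
    unfolding pairing_def by (rule Bochner_Integration.integral_mult_right) (rule i[OF f(1) h(1)])
  finally show "pairing \<alpha> f (\<lambda>z. c * h z) = cnj c * pairing \<alpha> f h" .
qed

lemma bounded_functional_pairing:
  fixes h :: "complex ^ 'n \<Rightarrow> complex"
  assumes p: "1 < p" and pq: "1 / p + 1 / q = 1" and a: "0 < \<alpha>" and C: "0 \<le> C"
    and h: "h \<in> Lp_hol q (gauss (\<alpha> * q / 2))"
    and le: "\<And>f. f \<in> Lp_hol p (gauss (\<alpha> * p / 2)) \<Longrightarrow> cmod (pairing \<alpha> f h) \<le> C * Lp_norm p (gauss (\<alpha> * p / 2)) f"
  shows "bounded_functional p q \<alpha> C (\<lambda>f. pairing \<alpha> f h)"
proof
  fix f g :: "complex ^ 'n \<Rightarrow> complex" and c assume f: "f \<in> Lp_hol p (gauss (\<alpha> * p / 2))"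
  show "pairing \<alpha> (\<lambda>z. c * f z) h = c * pairing \<alpha> f h"
    by (rule pairing_linear(2)[OF p pq a f f h h])
  show "cmod (pairing \<alpha> f h) \<le> C * Lp_norm p (gauss (\<alpha> * p / 2)) f" by (rule le[OF f])
  assume g: "g \<in> Lp_hol p (gauss (\<alpha> * p / 2))"
  show "pairing \<alpha> (\<lambda>z. f z + g z) h = pairing \<alpha> f h + pairing \<alpha> g h"
    by (rule pairing_linear(1)[OF p pq a f g h h])
qed (rule p pq a C)+

text \<open>The symbol of the functional given by \<open>h\<close> is \<open>h\<close> itself, so
  the bound on the symbol is the lower estimate of duality, with constant one.\<close>

lemma Lp_norm_le_of_pairing_bound:
  assumes p: "1 < p" and pq: "1 / p + 1 / q = 1" and a: "0 < \<alpha>" and C: "0 \<le> C"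
    and h: "h \<in> Lp_hol q (gauss (\<alpha> * q / 2))"
    and le: "\<And>f. f \<in> Lp_hol p (gauss (\<alpha> * p / 2)) \<Longrightarrow> cmod (pairing \<alpha> f h) \<le> C * Lp_norm p (gauss (\<alpha> * p / 2)) f"
  shows "Lp_norm q (gauss (\<alpha> * q / 2)) h \<le> C"
proof -
  interpret bounded_functional p q \<alpha> C "\<lambda>f. pairing \<alpha> f h"
    by (rule bounded_functional_pairing[OF p pq a C h le])
  have "symbol = h"
    unfolding symbol_def[abs_def] pairing_coherent[OF p pq a h] by simp
  with symbol_bound(2) show ?thesis by simp
qed

theorem theorem1p2:
  fixes p p' \<alpha> :: real
    and V W :: "(complex ^ 'n \<Rightarrow> complex) set"
    and NV NW :: "(complex ^ 'n \<Rightarrow> complex) \<Rightarrow> real"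
  assumes "1 < p" and "1 / p + 1 / p' = 1" and "0 < \<alpha>"
  defines "V \<equiv> Lp_hol p (gauss (\<alpha> * p / 2))"
    and "NV \<equiv> Lp_norm p (gauss (\<alpha> * p / 2))"
    and "W \<equiv> Lp_hol p' (gauss (\<alpha> * p' / 2))"
    and "NW \<equiv> Lp_norm p' (gauss (\<alpha> * p' / 2))"
  shows "dual_in_pairing \<alpha> V NV W \<and>
    (\<forall>h\<in>W.
       NW h \<le> functional_norm V NV (pairing_functional \<alpha> V h) \<and>
       functional_norm V NV (pairing_functional \<alpha> V h)
         \<le> (2 * (1 / p powr (1 / p)) * (1 / p' powr (1 / p'))) ^ CARD('n) * NW h)"
proof -
  note ex = assms(1-3)
  have p0: "0 < p" using ex by simp
  define K where "K = (2 * (1 / p powr (1 / p)) * (1 / p' powr (1 / p'))) ^ CARD('n)"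
  have K: "0 \<le> K" by (simp add: K_def)
  have NV0: "0 \<le> NV f" and NW0: "0 \<le> NW f" for f by (simp_all add: NV_def NW_def Lp_norm_def)
  have V_add: "(\<lambda>z. f z + g z) \<in> V" if "f \<in> V" "g \<in> V" for f g
    using that unfolding V_def by (rule Lp_hol_add[OF p0])
  have V_mult: "(\<lambda>z. c * f z) \<in> V" if "f \<in> V" for f c
    using that unfolding V_def by (rule Lp_hol_mult)
  have NV_mult: "NV (\<lambda>z. c * f z) = cmod c * NV f" for c f
    unfolding NV_def by (rule Lp_norm_mult[OF p0])
  have V_coherent: "coherent \<alpha> w \<in> V" for w
    unfolding V_def using ex by (intro coherent_Lp_hol) auto
  have hoelder: "cmod (pairing \<alpha> f h) \<le> (K * NW h) * NV f" if "f \<in> V" "h \<in> W" for f h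
    using Hoelder_gauss(2)[OF ex, of f h] that by (simp add: V_def W_def NV_def NW_def K_def mult_ac)
  note lin = pairing_linear[OF ex, where 'n = 'n, folded V_def W_def]
  have pf: "pairing_functional \<alpha> V h f = pairing \<alpha> f h" if "f \<in> V" for f h
    using that by (simp add: pairing_functional_def)
  have bij: "bij_betw (pairing_functional \<alpha> V) W (bounded_functionals V NV)"
  proof (rule bij_betw_imageI)
    show "inj_on (pairing_functional \<alpha> V) W"
    proof (rule inj_onI)
      fix h k assume h: "h \<in> W" and k: "k \<in> W" and eq: "pairing_functional \<alpha> V h = pairing_functional \<alpha> V k"
      have "cnj (h w) = cnj (k w)" for w
        using fun_cong[OF eq, of "coherent \<alpha> w"] pairing_coherent[OF ex h[unfolded W_def]] pairing_coherent[OF ex k[unfolded W_def]]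
        by (simp add: pf[OF V_coherent])
      then show "h = k" by auto
    qed
    show "pairing_functional \<alpha> V ` W = bounded_functionals V NV"
    proof (intro set_eqI iffI)
      fix \<Phi> assume "\<Phi> \<in> pairing_functional \<alpha> V ` W"
      then obtain h where h: "h \<in> W" and \<Phi>: "\<Phi> = pairing_functional \<alpha> V h" by blast
      have "\<Phi> \<in> extensional V" by (simp add: \<Phi> pairing_functional_def)
      moreover have "\<Phi> (\<lambda>z. f z + g z) = \<Phi> f + \<Phi> g" if "f \<in> V" "g \<in> V" for f g
        unfolding \<Phi> pf[OF V_add[OF that]] pf[OF that(1)] pf[OF that(2)] by (rule lin(1)[OF that h h])
      moreover have "\<Phi> (\<lambda>z. c * f z) = c * \<Phi> f" if "f \<in> V" for c f
        unfolding \<Phi> pf[OF V_mult[OF that]] pf[OF that] by (rule lin(2)[OF that that h h])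
      moreover have "\<exists>C. \<forall>f\<in>V. cmod (\<Phi> f) \<le> C * NV f"
        using hoelder[OF _ h] by (intro exI[of _ "K * NW h"]) (simp add: \<Phi> pf)
      ultimately show "\<Phi> \<in> bounded_functionals V NV" by (simp add: bounded_functionals_def)
    next
      fix \<Phi> assume \<Phi>: "\<Phi> \<in> bounded_functionals V NV"
      then have ext: "\<Phi> \<in> extensional V" and add: "\<And>f g. f \<in> V \<Longrightarrow> g \<in> V \<Longrightarrow> \<Phi> (\<lambda>z. f z + g z) = \<Phi> f + \<Phi> g"
        and scale: "\<And>c f. f \<in> V \<Longrightarrow> \<Phi> (\<lambda>z. c * f z) = c * \<Phi> f" and "\<exists>C. \<forall>f\<in>V. cmod (\<Phi> f) \<le> C * NV f"
        by (simp_all add: bounded_functionals_def)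
      then obtain C where C: "\<And>f. f \<in> V \<Longrightarrow> cmod (\<Phi> f) \<le> C * NV f" by blast
      \<comment> \<open>The constant in \<open>bounded_functionals\<close> carries no sign, while
        the locale asks for a nonnegative one.\<close>
      have C': "cmod (\<Phi> f) \<le> max 0 C * NV f" if "f \<in> V" for f
        using C[OF that] mult_right_mono[of C "max 0 C" "NV f"] NV0[of f] by simp
      interpret bounded_functional p p' \<alpha> "max 0 C" \<Phi>
        by standard (use ex add scale C' in \<open>simp_all add: V_def NV_def\<close>)
      have "pairing_functional \<alpha> V symbol = \<Phi>"
      proof (rule extensionalityI[OF _ ext])
        show "pairing_functional \<alpha> V symbol \<in> extensional V" by (simp add: pairing_functional_def)
        fix f assume "f \<in> V"
        then show "pairing_functional \<alpha> V symbol f = \<Phi> f"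
          using functional_eq_pairing[of f] by (simp add: pf) (simp add: V_def)
      qed
      moreover have "symbol \<in> W" unfolding W_def by (rule symbol_bound(1))
      ultimately show "\<Phi> \<in> pairing_functional \<alpha> V ` W" by (metis image_eqI)
    qed
  qed
  have dual: "dual_in_pairing \<alpha> V NV W"
    unfolding dual_in_pairing_def
  proof (intro conjI ballI allI bij)
    fix f h k c assume f: "f \<in> V" and h: "h \<in> W"
    show "integrable (gauss \<alpha>) (\<lambda>z. f z * cnj (h z))"
      using Hoelder_gauss(1)[OF ex, of f h] f h by (simp add: V_def W_def)
    show "pairing \<alpha> f (\<lambda>z. c * h z) = cnj c * pairing \<alpha> f h"
      by (rule lin(4)[OF f f h h])
    assume k: "k \<in> W"
    show "pairing \<alpha> f (\<lambda>z. h z + k z) = pairing \<alpha> f h + pairing \<alpha> f k"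
      by (rule lin(3)[OF f f h k])
  qed
  moreover have "NW h \<le> functional_norm V NV (pairing_functional \<alpha> V h) \<and>
       functional_norm V NV (pairing_functional \<alpha> V h) \<le> K * NW h" if h: "h \<in> W" for h
  proof
    let ?S = "{f \<in> V. NV f \<le> 1}"
    define s where "s = functional_norm V NV (pairing_functional \<alpha> V h)"
    have KN: "0 \<le> K * NW h" using K NW0 by simp
    have le: "cmod (pairing_functional \<alpha> V h f) \<le> K * NW h" if "f \<in> ?S" for f
    proof -
      have "cmod (pairing \<alpha> f h) \<le> (K * NW h) * NV f" using hoelder that h by simp
      also have "\<dots> \<le> (K * NW h) * 1" using that KN by (intro mult_left_mono) auto
      finally show ?thesis using that by (simp add: pf)
    qed
    have zero: "(\<lambda>z. 0) \<in> ?S" using p0 by (simp add: V_def NV_def Lp_hol_0 Lp_norm_def)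
    \<comment> \<open>A supremum of reals bounds its members only for sets bounded above; Hoelder's
      inequality provides this.\<close>
    have bdd: "bdd_above ((\<lambda>f. cmod (pairing_functional \<alpha> V h f)) ` ?S)"
      using le by (intro bdd_aboveI2) auto
    have upper: "cmod (pairing_functional \<alpha> V h f) \<le> s" if "f \<in> ?S" for f
      unfolding s_def functional_norm_def by (rule cSUP_upper[OF that bdd])
    have s0: "0 \<le> s" using upper[OF zero] norm_ge_zero order_trans by blast
    show "functional_norm V NV (pairing_functional \<alpha> V h) \<le> K * NW h"
      unfolding functional_norm_def by (rule cSUP_least) (use zero le in auto)
    \<comment> \<open>Homogeneity extends the bound from the unit ball to all of \<open>V\<close>.
      If \<open>NV f = 0\<close>, rescaling is impossible, but then Hoelder's inequality makes the
      pairing vanish.\<close>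
    have "cmod (pairing \<alpha> f h) \<le> s * NV f" if f: "f \<in> V" for f
    proof (cases "NV f = 0")
      case True
      then show ?thesis using hoelder[OF f h] by simp
    next
      case False
      then have N: "0 < NV f" using NV0[of f] by simp
      define c where "c = complex_of_real (1 / NV f)"
      have c: "cmod c = 1 / NV f" using N by (simp add: c_def norm_divide)
      have "(\<lambda>z. c * f z) \<in> ?S" using V_mult[OF f] N by (simp add: NV_mult c)
      from upper[OF this] have "cmod (c * pairing \<alpha> f h) \<le> s"
        by (simp add: pf[OF V_mult[OF f]] lin(2)[OF f f h h])
      then show ?thesis using N by (simp add: norm_mult c divide_le_eq)
    qed
    then show "NW h \<le> functional_norm V NV (pairing_functional \<alpha> V h)"
      unfolding s_def[symmetric] NW_def
      by (intro Lp_norm_le_of_pairing_bound[OF ex s0]) (use h in \<open>simp_all add: V_def W_def NV_def\<close>)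
  qed
  ultimately show ?thesis unfolding K_def by blast
qed

end
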